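(* Let $X,Y$ be symplectic manifolds, let $M=(M,\omega_M,p_0,p_1)$ be a connected symplectic manifold with two marked points, and let $\varphi_t:Y\to X$, $t\in[0,1]$, be a symplectic isotopy (a smooth family of symplectic embeddings). If there exists $I\in SCor(M,X)$, then $\varphi_0$ is $M$-homotopic to $\varphi_1$.
   Context: All manifolds are smooth without boundary; products carry the product symplectic form. A symplectic embedding $f:Y\to X$ is an embedding with $f^*\omega_X=\omega_Y$. Symplectic correspondences: for $n\ge0$, $SCor_n(Y,X)$ is the set of global sections over $Y$ of the sheafification of the presheaf sending an open $U\subset Y$ to the set of unordered $n$-tuples $\{f_1,\dots,f_n\}$ of smooth maps $U\to X$ with $\sum_i f_i^*\omega_X=\omega_Y|_U$, two tuples being identified if $\{f_i(y)\}_i=\{g_i(y)\}_i$ as unordered tuples with multiplicity for every $y\in U$. $SCor^0_n(Y,X)$ (isotropic correspondences) is defined likewise with $\sum_i f_i^*\omega_X=0$. $F+G$ denotes local concatenation. On $\coprod_{n\ge0}SCor_n(Y,X)$ let $\sim$ be the equivalence relation generated by $F\sim F+G$ with $G$ isotropic; $SCor(Y,X)$ is the set of global sections over $Y$ of the sheafification of $U\mapsto(\coprod_n SCor_n(U,X))/\!\sim$. $SC(Y,X)=\mathbb{Z}[SCor(Y,X)]$ is the free abelian group (zero if $SCor(Y,X)=\emptyset$). A symplectic embedding $f:Y\to X$ is regarded as $\{f\}\in SCor(Y,X)\subset SC(Y,X)$. For $H\in SCor(Y',X)$ and a symplectic embedding $h:Y\to Y'$, $H\circ h\in SCor(Y,X)$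 is locally given by $\{f_i\circ h\}$ where $H$ is locally $\{f_i\}$; extended linearly to $SC$. $M$-homotopy: $F,G\in SC(Y,X)$ are $M$-homotopic if there is $H\in SC(Y\times M,X)$ with $H\circ i_0=F$ and $H\circ i_1=G$, where $i_\varepsilon:Y=Y\times p_\varepsilon\hookrightarrow Y\times M$. *)

theory Defs
  imports "HOL-Analysis.Analysis" "HOL-Algebra.Free_Abelian_Groups"
begin

section \<open>Smooth and symplectic manifolds\<close>

text \<open>
  Used only for open \<open>S\<close> and finite-dimensional source. There, \<open>C_k_on (Suc k)\<close> says that
  \<open>f\<close> is differentiable and all its directional derivatives are \<open>C\<^sup>k\<close>.
\<close>

primrec C_k_on ::
  "nat \<Rightarrow> 'e::real_normed_vector set \<Rightarrow> ('e \<Rightarrow> 'f::real_normed_vector) \<Rightarrow> bool" where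
  "C_k_on 0 S f \<longleftrightarrow> continuous_on S f"
| "C_k_on (Suc k) S f \<longleftrightarrow>
     (\<forall>x\<in>S. f differentiable (at x)) \<and>
     (\<forall>v. C_k_on k S (\<lambda>x. frechet_derivative f (at x) v))"

definition smooth_on ::
  "'e::real_normed_vector set \<Rightarrow> ('e \<Rightarrow> 'f::real_normed_vector) \<Rightarrow> bool" where
  "smooth_on S f \<longleftrightarrow> (\<forall>k. C_k_on k S f)"

text \<open>
  A manifold is a topological space with an atlas indexed by \<open>charts\<close>. The model space \<open>'e\<close> is a
  real normed space, required below to be finite-dimensional; unlike class
  \<open>euclidean_space\<close>, this admits manifolds of dimension 0.
\<close>

record ('a, 'e, 'i) manifold =
  mtop :: "'a topology"
  charts :: "'i set"
  cdom :: "'i \<Rightarrow> 'a set"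
  coord :: "'i \<Rightarrow> 'a \<Rightarrow> 'e"

abbreviation points :: "('a, 'e, 'i, 'z) manifold_scheme \<Rightarrow> 'a set" where
  "points M \<equiv> topspace (mtop M)"

definition param :: "('a, 'e, 'i, 'z) manifold_scheme \<Rightarrow> 'i \<Rightarrow> 'e \<Rightarrow> 'a" where
  "param M i = inv_into (cdom M i) (coord M i)"

definition smooth_manifold :: "('a, 'e::real_normed_vector, 'i, 'z) manifold_scheme \<Rightarrow> bool" where
  "smooth_manifold M \<longleftrightarrow>
     Hausdorff_space (mtop M) \<and> second_countable (mtop M) \<and>
     (\<exists>B::'e set. finite B \<and> span B = UNIV) \<and>
     (\<Union>i\<in>charts M. cdom M i) = points M \<and>
     (\<forall>i\<in>charts M.
        openin (mtop M) (cdom M i) \<and> open (coord M i ` cdom M i) \<and>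
        homeomorphic_map (subtopology (mtop M) (cdom M i))
          (top_of_set (coord M i ` cdom M i)) (coord M i)) \<and>
     (\<forall>i\<in>charts M. \<forall>j\<in>charts M.
        smooth_on (coord M i ` (cdom M i \<inter> cdom M j)) (coord M j \<circ> param M i))"

definition smooth_map ::
  "('a, 'e::real_normed_vector, 'i, 'z) manifold_scheme \<Rightarrow> 'a set \<Rightarrow>
   ('b, 'f::real_normed_vector, 'j, 'w) manifold_scheme \<Rightarrow> ('a \<Rightarrow> 'b) \<Rightarrow> bool" where
  "smooth_map M U N f \<longleftrightarrow>
     continuous_map (subtopology (mtop M) U) (mtop N) f \<and>
     (\<forall>i\<in>charts M. \<forall>j\<in>charts N.
        smooth_on (coord M i ` {p \<in> U \<inter> cdom M i. f p \<in> cdom N j}) (coord N j \<circ> f \<circ> param M i))"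

text \<open>The differential of \<open>f\<close> at \<open>p\<close>, read in the charts \<open>i\<close> at \<open>p\<close> and \<open>j\<close> at \<open>f p\<close>.\<close>

definition differential ::
  "('a, 'e::real_normed_vector, 'i, 'z) manifold_scheme \<Rightarrow> 'i \<Rightarrow>
   ('b, 'f::real_normed_vector, 'j, 'w) manifold_scheme \<Rightarrow> 'j \<Rightarrow> ('a \<Rightarrow> 'b) \<Rightarrow> 'a \<Rightarrow> 'e \<Rightarrow> 'f" where
  "differential M i N j f p = frechet_derivative (coord N j \<circ> f \<circ> param M i) (at (coord M i p))"

text \<open>
  A 2-form is given by its expressions in the charts: \<open>\<omega> i p v w\<close> is its value at \<open>p \<in> cdom M i\<close> on
  the tangent vectors that have coordinates \<open>v\<close>, \<open>w\<close> in chart \<open>i\<close>. The second conjunct below makes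
  these expressions agree on overlaps. In chart coordinates and for constant vector fields,
  \<open>d\<omega>(u,v,w) = D\<^sub>u \<omega>(v,w) - D\<^sub>v \<omega>(u,w) + D\<^sub>w \<omega>(u,v)\<close>.
\<close>

type_synonym ('a, 'e, 'i) form2 = "'i \<Rightarrow> 'a \<Rightarrow> 'e \<Rightarrow> 'e \<Rightarrow> real"

definition two_form ::
  "('a, 'e::real_normed_vector, 'i, 'z) manifold_scheme \<Rightarrow> ('a, 'e, 'i) form2 \<Rightarrow> bool" where
  "two_form M \<omega> \<longleftrightarrow>
     (\<forall>i\<in>charts M. \<forall>p\<in>cdom M i.
        (\<forall>w. linear (\<lambda>v. \<omega> i p v w)) \<and> (\<forall>v w. \<omega> i p w v = - \<omega> i p v w)) \<and>
     (\<forall>i\<in>charts M. \<forall>j\<in>charts M. \<forall>p\<in>cdom M i \<inter> cdom M j. \<forall>v w.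
        \<omega> i p v w =
        \<omega> j p (differential M i M j (\<lambda>x. x) p v) (differential M i M j (\<lambda>x. x) p w)) \<and>
     (\<forall>i\<in>charts M. \<forall>v w. smooth_on (coord M i ` cdom M i) (\<lambda>x. \<omega> i (param M i x) v w))"

definition closed_form ::
  "('a, 'e::real_normed_vector, 'i, 'z) manifold_scheme \<Rightarrow> ('a, 'e, 'i) form2 \<Rightarrow> bool" where
  "closed_form M \<omega> \<longleftrightarrow>
     (\<forall>i\<in>charts M. \<forall>x\<in>coord M i ` cdom M i. \<forall>u v w.
        frechet_derivative (\<lambda>x. \<omega> i (param M i x) v w) (at x) u
      - frechet_derivative (\<lambda>x. \<omega> i (param M i x) u w) (at x) v
      + frechet_derivative (\<lambda>x. \<omega> i (param M i x) u v) (at x) w = 0)"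

definition nondegenerate ::
  "('a, 'e::real_normed_vector, 'i, 'z) manifold_scheme \<Rightarrow> ('a, 'e, 'i) form2 \<Rightarrow> bool" where
  "nondegenerate M \<omega> \<longleftrightarrow>
     (\<forall>i\<in>charts M. \<forall>p\<in>cdom M i. \<forall>v. v \<noteq> 0 \<longrightarrow> (\<exists>w. \<omega> i p v w \<noteq> 0))"

record ('a, 'e, 'i) symplectic = "('a, 'e, 'i) manifold" +
  sform :: "('a, 'e, 'i) form2"

definition symplectic_manifold :: "('a, 'e::real_normed_vector, 'i) symplectic \<Rightarrow> bool" where
  "symplectic_manifold M \<longleftrightarrow>
     smooth_manifold M \<and> two_form M (sform M) \<and> closed_form M (sform M) \<and>
     nondegenerate M (sform M)"

definition prod_manifold ::
  "('a, 'e, 'i, 'z) manifold_scheme \<Rightarrow> ('b, 'f, 'j, 'w) manifold_scheme \<Rightarrow>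
   ('a \<times> 'b, 'e \<times> 'f, 'i \<times> 'j) manifold" where
  "prod_manifold M N =
     \<lparr>mtop = prod_topology (mtop M) (mtop N),
      charts = charts M \<times> charts N,
      cdom = (\<lambda>(i, j). cdom M i \<times> cdom N j),
      coord = (\<lambda>(i, j) (p, q). (coord M i p, coord N j q))\<rparr>"

definition prod_symplectic ::
  "('a, 'e, 'i) symplectic \<Rightarrow> ('b, 'f, 'j) symplectic \<Rightarrow>
   ('a \<times> 'b, 'e \<times> 'f, 'i \<times> 'j) symplectic" where
  "prod_symplectic M N =
     \<lparr>mtop = mtop (prod_manifold M N), charts = charts (prod_manifold M N),
      cdom = cdom (prod_manifold M N), coord = coord (prod_manifold M N),
      sform = (\<lambda>(i, j) (p, q) (v, v') (w, w'). sform M i p v w + sform N j q v' w')\<rparr>"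

text \<open>
  The chart \<open>j\<close> of \<open>X\<close> at \<open>f p\<close> is arbitrary; for a \<open>two_form\<close> and a map smooth near \<open>p\<close> the
  result does not depend on it.
\<close>

definition pullback ::
  "('a, 'e::real_normed_vector, 'i, 'z) manifold_scheme \<Rightarrow>
   ('b, 'f::real_normed_vector, 'j, 'w) manifold_scheme \<Rightarrow>
   ('a \<Rightarrow> 'b) \<Rightarrow> ('b, 'f, 'j) form2 \<Rightarrow> ('a, 'e, 'i) form2" where
  "pullback Y X f \<omega> i p v w =
     (let j = (SOME j. j \<in> charts X \<and> f p \<in> cdom X j)
      in \<omega> j (f p) (differential Y i X j f p v) (differential Y i X j f p w))"

definition smooth_embedding ::
  "('a, 'e::real_normed_vector, 'i, 'z) manifold_scheme \<Rightarrow>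
   ('b, 'f::real_normed_vector, 'j, 'w) manifold_scheme \<Rightarrow> ('a \<Rightarrow> 'b) \<Rightarrow> bool" where
  "smooth_embedding Y X f \<longleftrightarrow>
     smooth_map Y (points Y) X f \<and> embedding_map (mtop Y) (mtop X) f \<and>
     (\<forall>i\<in>charts Y. \<forall>j\<in>charts X. \<forall>p\<in>cdom Y i. f p \<in> cdom X j \<longrightarrow> inj (differential Y i X j f p))"

definition symplectic_embedding ::
  "('a, 'e::real_normed_vector, 'i) symplectic \<Rightarrow> ('b, 'f::real_normed_vector, 'j) symplectic \<Rightarrow>
   ('a \<Rightarrow> 'b) \<Rightarrow> bool" where
  "symplectic_embedding Y X f \<longleftrightarrow>
     smooth_embedding Y X f \<and>
     (\<forall>i\<in>charts Y. \<forall>p\<in>cdom Y i. \<forall>v w. pullback Y X f (sform X) i p v w = sform Y i p v w)"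

definition real_line :: "(real, real, unit) manifold" where
  "real_line =
     \<lparr>mtop = euclidean, charts = {()}, cdom = (\<lambda>_. UNIV), coord = (\<lambda>_ x. x)\<rparr>"

text \<open>
  Smoothness of \<open>\<phi>\<close> on \<open>[0,1] \<times> Y\<close>, including at \<open>t = 0\<close> and \<open>t = 1\<close>, means that \<open>\<phi>\<close> extends
  locally to a smooth map on an open subset of \<open>\<real> \<times> Y\<close>.
\<close>

definition symplectic_isotopy ::
  "('a, 'e::real_normed_vector, 'i) symplectic \<Rightarrow> ('b, 'f::real_normed_vector, 'j) symplectic \<Rightarrow>
   (real \<Rightarrow> 'a \<Rightarrow> 'b) \<Rightarrow> bool" where
  "symplectic_isotopy Y X \<phi> \<longleftrightarrow>
     (\<forall>t\<in>{0..1}. symplectic_embedding Y X (\<phi> t)) \<and>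
     (\<forall>t\<in>{0..1}. \<forall>y\<in>points Y. \<exists>J U \<Phi>.
        open J \<and> t \<in> J \<and> openin (mtop Y) U \<and> y \<in> U \<and>
        smooth_map (prod_manifold real_line Y) (J \<times> U) X \<Phi> \<and>
        (\<forall>s\<in>J \<inter> {0..1}. \<forall>z\<in>U. \<Phi> (s, z) = \<phi> s z))"


section \<open>Presheaves of sets and sheafification\<close>

text \<open>\<open>res P V s\<close> is the restriction of a section \<open>s\<close> to the smaller open set \<open>V\<close>.\<close>

record ('a, 's) presheaf =
  sections :: "'a set \<Rightarrow> 's set"
  res :: "'a set \<Rightarrow> 's \<Rightarrow> 's"

text \<open>The germ at \<open>x\<close> of \<open>s\<close>, a section over \<open>U\<close>, as an equivalence class of pairs (domain, section).\<close>

definition germ ::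
  "'a topology \<Rightarrow> ('a, 's) presheaf \<Rightarrow> 'a set \<Rightarrow> 's \<Rightarrow> 'a \<Rightarrow> ('a set \<times> 's) set" where
  "germ T P U s x =
     {(V, t). openin T V \<and> x \<in> V \<and> t \<in> sections P V \<and>
        (\<exists>W. openin T W \<and> x \<in> W \<and> W \<subseteq> U \<inter> V \<and> res P W s = res P W t)}"

definition sheafify ::
  "'a topology \<Rightarrow> ('a, 's) presheaf \<Rightarrow> ('a, 'a \<Rightarrow> ('a set \<times> 's) set) presheaf" where
  "sheafify T P =
     \<lparr>sections = (\<lambda>U. {\<sigma> \<in> extensional U. \<forall>x\<in>U. \<exists>V s.
         openin T V \<and> x \<in> V \<and> V \<subseteq> U \<and> s \<in> sections P V \<and> (\<forall>z\<in>V. \<sigma> z = germ T P V s z)}),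
      res = (\<lambda>V \<sigma>. restrict \<sigma> V)\<rparr>"

text \<open>The canonical map from a presheaf to its sheafification.\<close>

definition to_sheaf ::
  "'a topology \<Rightarrow> ('a, 's) presheaf \<Rightarrow> 'a set \<Rightarrow> 's \<Rightarrow> 'a \<Rightarrow> ('a set \<times> 's) set" where
  "to_sheaf T P U s = restrict (germ T P U s) U"

text \<open>
  Quotient by equivalence relations \<open>R U\<close> that are compatible with restriction: the restriction of
  a class is the class containing the restrictions of its members.
\<close>

definition quotient_presheaf ::
  "('a set \<Rightarrow> ('s \<times> 's) set) \<Rightarrow> ('a, 's) presheaf \<Rightarrow> ('a, 's set) presheaf" where
  "quotient_presheaf R P =
     \<lparr>sections = (\<lambda>U. sections P U // R U), res = (\<lambda>V c. R V `` (res P V ` c))\<rparr>"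


section \<open>Symplectic correspondences\<close>

text \<open>
  An unordered tuple of maps \<open>U \<rightarrow> X\<close> is a multiset of functions, each extensional on \<open>U\<close>.
  With \<open>\<theta> = \<omega>\<^sub>Y\<close> one gets the symplectic, with \<open>\<theta> = 0\<close> the isotropic tuples.
\<close>

type_synonym ('a, 'b) tuple = "('a \<Rightarrow> 'b) multiset"
type_synonym ('a, 'b) cor_n = "'a \<Rightarrow> ('a set \<times> ('a, 'b) tuple set) set"
type_synonym ('a, 'b) cor = "'a \<Rightarrow> ('a set \<times> (nat \<times> ('a, 'b) cor_n) set) set"

definition tuples ::
  "('a, 'e::real_normed_vector, 'i) symplectic \<Rightarrow> ('b, 'f::real_normed_vector, 'j) symplectic \<Rightarrow>
   ('a, 'e, 'i) form2 \<Rightarrow> nat \<Rightarrow> 'a set \<Rightarrow> ('a, 'b) tuple set" where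
  "tuples Y X \<theta> n U =
     {fs. size fs = n \<and> (\<forall>f\<in>#fs. f \<in> extensional U \<and> smooth_map Y U X f) \<and>
        (\<forall>i\<in>charts Y. \<forall>y\<in>U \<inter> cdom Y i. \<forall>v w.
           (\<Sum>f\<in>#fs. pullback Y X f (sform X) i y v w) = \<theta> i y v w)}"

definition tuple_presheaf ::
  "('a, 'e::real_normed_vector, 'i) symplectic \<Rightarrow> ('b, 'f::real_normed_vector, 'j) symplectic \<Rightarrow>
   ('a, 'e, 'i) form2 \<Rightarrow> nat \<Rightarrow> ('a, ('a, 'b) tuple) presheaf" where
  "tuple_presheaf Y X \<theta> n =
     \<lparr>sections = tuples Y X \<theta> n, res = (\<lambda>V fs. image_mset (\<lambda>f. restrict f V) fs)\<rparr>"

definition same_values ::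
  "('a, 'e::real_normed_vector, 'i) symplectic \<Rightarrow> ('b, 'f::real_normed_vector, 'j) symplectic \<Rightarrow>
   ('a, 'e, 'i) form2 \<Rightarrow> nat \<Rightarrow> 'a set \<Rightarrow> (('a, 'b) tuple \<times> ('a, 'b) tuple) set" where
  "same_values Y X \<theta> n U =
     {(fs, gs). fs \<in> tuples Y X \<theta> n U \<and> gs \<in> tuples Y X \<theta> n U \<and>
        (\<forall>y\<in>U. image_mset (\<lambda>f. f y) fs = image_mset (\<lambda>g. g y) gs)}"

definition cor_n_presheaf ::
  "('a, 'e::real_normed_vector, 'i) symplectic \<Rightarrow> ('b, 'f::real_normed_vector, 'j) symplectic \<Rightarrow>
   ('a, 'e, 'i) form2 \<Rightarrow> nat \<Rightarrow> ('a, ('a, 'b) tuple set) presheaf" where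
  "cor_n_presheaf Y X \<theta> n = quotient_presheaf (same_values Y X \<theta> n) (tuple_presheaf Y X \<theta> n)"

text \<open>
  \<open>cor_n Y X \<theta> n U\<close> is \<open>SCor\<^sub>n(U,X)\<close> for \<open>\<theta> = \<omega>\<^sub>Y\<close> and \<open>SCor\<^sup>0\<^sub>n(U,X)\<close> for \<open>\<theta> = 0\<close>, where the open set
  \<open>U \<subseteq> Y\<close> carries the restricted structure: sections over \<open>U\<close> of the sheaf on \<open>Y\<close>.
\<close>

definition cor_n ::
  "('a, 'e::real_normed_vector, 'i) symplectic \<Rightarrow> ('b, 'f::real_normed_vector, 'j) symplectic \<Rightarrow>
   ('a, 'e, 'i) form2 \<Rightarrow> nat \<Rightarrow> 'a set \<Rightarrow> ('a, 'b) cor_n set" where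
  "cor_n Y X \<theta> n U = sections (sheafify (mtop Y) (cor_n_presheaf Y X \<theta> n)) U"

definition SCor_n ::
  "('a, 'e::real_normed_vector, 'i) symplectic \<Rightarrow> ('b, 'f::real_normed_vector, 'j) symplectic \<Rightarrow>
   nat \<Rightarrow> 'a set \<Rightarrow> ('a, 'b) cor_n set" where
  "SCor_n Y X n U = cor_n Y X (sform Y) n U"

definition zero_form :: "('a, 'e, 'i) form2" where
  "zero_form = (\<lambda>i p v w. 0)"

definition SCor0_n ::
  "('a, 'e::real_normed_vector, 'i) symplectic \<Rightarrow> ('b, 'f::real_normed_vector, 'j) symplectic \<Rightarrow>
   nat \<Rightarrow> 'a set \<Rightarrow> ('a, 'b) cor_n set" where
  "SCor0_n Y X n U = cor_n Y X zero_form n U"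

definition cor_n_of_tuple ::
  "('a, 'e::real_normed_vector, 'i) symplectic \<Rightarrow> ('b, 'f::real_normed_vector, 'j) symplectic \<Rightarrow>
   ('a, 'e, 'i) form2 \<Rightarrow> nat \<Rightarrow> 'a set \<Rightarrow> ('a, 'b) tuple \<Rightarrow> ('a, 'b) cor_n" where
  "cor_n_of_tuple Y X \<theta> n U fs =
     to_sheaf (mtop Y) (cor_n_presheaf Y X \<theta> n) U (same_values Y X \<theta> n U `` {fs})"

text \<open>\<open>K = F + G\<close> over \<open>U\<close>, for symplectic \<open>F\<close> of size \<open>n\<close> and isotropic \<open>G\<close> of size \<open>m\<close>.\<close>

definition is_concat ::
  "('a, 'e::real_normed_vector, 'i) symplectic \<Rightarrow> ('b, 'f::real_normed_vector, 'j) symplectic \<Rightarrow>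
   'a set \<Rightarrow> nat \<Rightarrow> nat \<Rightarrow> ('a, 'b) cor_n \<Rightarrow> ('a, 'b) cor_n \<Rightarrow> ('a, 'b) cor_n \<Rightarrow> bool" where
  "is_concat Y X U n m F G K \<longleftrightarrow>
     (\<forall>y\<in>U. \<exists>V fs gs.
        openin (mtop Y) V \<and> y \<in> V \<and> V \<subseteq> U \<and>
        fs \<in> tuples Y X (sform Y) n V \<and> gs \<in> tuples Y X zero_form m V \<and>
        restrict F V = cor_n_of_tuple Y X (sform Y) n V fs \<and>
        restrict G V = cor_n_of_tuple Y X zero_form m V gs \<and>
        restrict K V = cor_n_of_tuple Y X (sform Y) (n + m) V (fs + gs))"

definition coprod_presheaf ::
  "('a, 'e::real_normed_vector, 'i) symplectic \<Rightarrow> ('b, 'f::real_normed_vector, 'j) symplectic \<Rightarrow>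
   ('a, nat \<times> ('a, 'b) cor_n) presheaf" where
  "coprod_presheaf Y X =
     \<lparr>sections = (\<lambda>U. SIGMA n:UNIV. SCor_n Y X n U), res = (\<lambda>V (n, F). (n, restrict F V))\<rparr>"

definition add_isotropic ::
  "('a, 'e::real_normed_vector, 'i) symplectic \<Rightarrow> ('b, 'f::real_normed_vector, 'j) symplectic \<Rightarrow>
   'a set \<Rightarrow> nat \<times> ('a, 'b) cor_n \<Rightarrow> nat \<times> ('a, 'b) cor_n \<Rightarrow> bool" where
  "add_isotropic Y X U A B \<longleftrightarrow>
     (\<exists>n m F G K. A = (n, F) \<and> B = (n + m, K) \<and>
        F \<in> SCor_n Y X n U \<and> G \<in> SCor0_n Y X m U \<and> K \<in> SCor_n Y X (n + m) U \<and>
        is_concat Y X U n m F G K)"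

definition stable_equiv ::
  "('a, 'e::real_normed_vector, 'i) symplectic \<Rightarrow> ('b, 'f::real_normed_vector, 'j) symplectic \<Rightarrow>
   'a set \<Rightarrow> ((nat \<times> ('a, 'b) cor_n) \<times> (nat \<times> ('a, 'b) cor_n)) set" where
  "stable_equiv Y X U =
     {(A, B). A \<in> sections (coprod_presheaf Y X) U \<and> B \<in> sections (coprod_presheaf Y X) U \<and>
        equivclp (add_isotropic Y X U) A B}"

definition cor_presheaf ::
  "('a, 'e::real_normed_vector, 'i) symplectic \<Rightarrow> ('b, 'f::real_normed_vector, 'j) symplectic \<Rightarrow>
   ('a, (nat \<times> ('a, 'b) cor_n) set) presheaf" where
  "cor_presheaf Y X = quotient_presheaf (stable_equiv Y X) (coprod_presheaf Y X)"

definition SCor ::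
  "('a, 'e::real_normed_vector, 'i) symplectic \<Rightarrow> ('b, 'f::real_normed_vector, 'j) symplectic \<Rightarrow>
   ('a, 'b) cor set" where
  "SCor Y X = sections (sheafify (mtop Y) (cor_presheaf Y X)) (points Y)"

text \<open>The section over \<open>U\<close> determined by a symplectic tuple on \<open>U\<close>.\<close>

definition cor_of_tuple ::
  "('a, 'e::real_normed_vector, 'i) symplectic \<Rightarrow> ('b, 'f::real_normed_vector, 'j) symplectic \<Rightarrow>
   'a set \<Rightarrow> ('a, 'b) tuple \<Rightarrow> ('a, 'b) cor" where
  "cor_of_tuple Y X U fs =
     to_sheaf (mtop Y) (cor_presheaf Y X) U
       (stable_equiv Y X U `` {(size fs, cor_n_of_tuple Y X (sform Y) (size fs) U fs)})"

definition given_by ::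
  "('a, 'e::real_normed_vector, 'i) symplectic \<Rightarrow> ('b, 'f::real_normed_vector, 'j) symplectic \<Rightarrow>
   'a set \<Rightarrow> ('a, 'b) tuple \<Rightarrow> ('a, 'b) cor \<Rightarrow> bool" where
  "given_by Y X U fs H \<longleftrightarrow>
     openin (mtop Y) U \<and> fs \<in> tuples Y X (sform Y) (size fs) U \<and>
     restrict H U = cor_of_tuple Y X U fs"

text \<open>\<open>H \<circ> h\<close>: the element of \<open>SCor Y X\<close> given locally by \<open>{f\<^sub>i \<circ> h}\<close> where \<open>H\<close> is given by \<open>{f\<^sub>i}\<close>.\<close>

definition is_cor_comp ::
  "('a, 'e::real_normed_vector, 'i) symplectic \<Rightarrow> ('c, 'g::real_normed_vector, 'k) symplectic \<Rightarrow>
   ('b, 'f::real_normed_vector, 'j) symplectic \<Rightarrow>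
   ('c, 'b) cor \<Rightarrow> ('a \<Rightarrow> 'c) \<Rightarrow> ('a, 'b) cor \<Rightarrow> bool" where
  "is_cor_comp Y Y' X H h K \<longleftrightarrow>
     K \<in> SCor Y X \<and>
     (\<forall>y\<in>points Y. \<exists>U V fs.
        y \<in> U \<and> h ` U \<subseteq> V \<and> given_by Y' X V fs H \<and>
        given_by Y X U (image_mset (\<lambda>f. restrict (f \<circ> h) U) fs) K)"

definition cor_comp ::
  "('a, 'e::real_normed_vector, 'i) symplectic \<Rightarrow> ('c, 'g::real_normed_vector, 'k) symplectic \<Rightarrow>
   ('b, 'f::real_normed_vector, 'j) symplectic \<Rightarrow>
   ('c, 'b) cor \<Rightarrow> ('a \<Rightarrow> 'c) \<Rightarrow> ('a, 'b) cor" where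
  "cor_comp Y Y' X H h = (THE K. is_cor_comp Y Y' X H h K)"


section \<open>Linearization and M-homotopy\<close>

definition SC ::
  "('a, 'e::real_normed_vector, 'i) symplectic \<Rightarrow> ('b, 'f::real_normed_vector, 'j) symplectic \<Rightarrow>
   (('a, 'b) cor \<Rightarrow>\<^sub>0 int) set" where
  "SC Y X = carrier (free_Abelian_group (SCor Y X))"

definition SC_comp ::
  "('a, 'e::real_normed_vector, 'i) symplectic \<Rightarrow> ('c, 'g::real_normed_vector, 'k) symplectic \<Rightarrow>
   ('b, 'f::real_normed_vector, 'j) symplectic \<Rightarrow>
   (('c, 'b) cor \<Rightarrow>\<^sub>0 int) \<Rightarrow> ('a \<Rightarrow> 'c) \<Rightarrow> (('a, 'b) cor \<Rightarrow>\<^sub>0 int)" where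
  "SC_comp Y Y' X H h = frag_extend (\<lambda>F. frag_of (cor_comp Y Y' X F h)) H"

text \<open>A symplectic embedding \<open>f\<close> regarded as the element \<open>{f}\<close> of \<open>SC Y X\<close>.\<close>

definition embedding_cor ::
  "('a, 'e::real_normed_vector, 'i) symplectic \<Rightarrow> ('b, 'f::real_normed_vector, 'j) symplectic \<Rightarrow>
   ('a \<Rightarrow> 'b) \<Rightarrow> (('a, 'b) cor \<Rightarrow>\<^sub>0 int)" where
  "embedding_cor Y X f = frag_of (cor_of_tuple Y X (points Y) {#restrict f (points Y)#})"

definition M_homotopic ::
  "('c, 'g::real_normed_vector, 'k) symplectic \<Rightarrow> 'c \<Rightarrow> 'c \<Rightarrow>
   ('a, 'e::real_normed_vector, 'i) symplectic \<Rightarrow> ('b, 'f::real_normed_vector, 'j) symplectic \<Rightarrow>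
   (('a, 'b) cor \<Rightarrow>\<^sub>0 int) \<Rightarrow> (('a, 'b) cor \<Rightarrow>\<^sub>0 int) \<Rightarrow> bool" where
  "M_homotopic M p\<^sub>0 p\<^sub>1 Y X F G \<longleftrightarrow>
     F \<in> SC Y X \<and> G \<in> SC Y X \<and>
     (\<exists>H \<in> SC (prod_symplectic Y M) X.
        SC_comp Y (prod_symplectic Y M) X H (\<lambda>y. (y, p\<^sub>0)) = F \<and>
        SC_comp Y (prod_symplectic Y M) X H (\<lambda>y. (y, p\<^sub>1)) = G)"

end

(* Isotropic tuples are only required to have vanishing total pullback. Hence, if as is a tuple of
   maps to X with total pullback -omega, any two symplectic tuples fs and gs satisfy
   fs ~ fs + (gs + as) = gs + (fs + as) ~ gs. Such a tuple exists locally as soon as omega_X does not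
   vanish identically: by the Poincare lemma -omega is locally a sum of forms da /\ db, each of which
   is the pullback of omega_X along a map into a plane on which omega_X is an area form in Darboux
   coordinates. So SCor(N, X) has at most one element for N = Y, M and Y x M. It is inhabited for
   Y x M, where phi_0 o pr_Y and I o pr_M together give local symplectic tuples, and the element H
   found in this way necessarily restricts to phi_0 over p_0 and to phi_1 over p_1. *)

theory Submission
  imports Defs
begin

section \<open>Calculus of smooth maps\<close>

text \<open>That \<omega>_X is nonzero where this matters comes from the local tuples themselves: if
  N has positive dimension, \<omega>_N is nonzero at each point, so some map of a tuple for
  \<omega>_N has nonzero pullback. In dimension 0 the empty tuple is enough. For Y x M the tuple for
  -\<omega> is assembled along the two projections, without checking that the product is symplectic.
  Darboux coordinates are needed in a plane only. There a 2-form has one coefficient \<rho>;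
  integrating \<rho> in one variable and inverting makes the form standard near the origin. This
  chart is local, hence primitives and coordinates are normalised to vanish at the base point. The
  analytic obstacle is that a model space has just a norm and a finite spanning set, and that
  \<open>C_k_on\<close> differentiates in one fixed direction at a time. So continuity of linear
  coordinates is proved first, and derivatives are expanded in a finite basis wherever the direction
  varies: in the chain rule and under the integral sign.\<close>

lemma C_k_on_cong:
  assumes "open S" "\<And>x. x \<in> S \<Longrightarrow> f x = g x"
  shows "C_k_on k S f \<longleftrightarrow> C_k_on k S g"
  using assms(2)
proof (induction k arbitrary: f g)
  case 0
  then show ?case by (simp cong: continuous_on_cong)
next
  case (Suc k)
  have D: "f differentiable at x \<longleftrightarrow> g differentiable at x" if "x \<in> S" for x
    unfolding differentiable_def
    using has_derivative_transform_within_open[OF _ assms(1) that] Suc.prems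
    by (metis (no_types, lifting))
  have E: "frechet_derivative f (at x) = frechet_derivative g (at x)" if "x \<in> S" "f differentiable at x" for x
    using that frechet_derivative_transform_within_open[OF that(2) assms(1) that(1) Suc.prems] by metis
  show ?case
    using D E Suc.IH[of "\<lambda>x. frechet_derivative f (at x) v" "\<lambda>x. frechet_derivative g (at x) v" for v]
    by (auto simp: D E)
qed

text \<open>Derivatives are taken \<open>at x\<close>, not within \<open>S\<close>, so the condition
  is local. Used where the intermediate chart changes from point to point.\<close>

lemma C_k_on_local:
  assumes "\<And>x. x \<in> S \<Longrightarrow> \<exists>T. open T \<and> x \<in> T \<and> C_k_on k T f"
  shows "C_k_on k S f"
  using assms
proof (induction k arbitrary: f)
  case 0
  have "isCont f x" if "x \<in> S" for x
    using 0[OF that] by (auto simp: continuous_on_eq_continuous_at)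
  then show ?case by (simp add: continuous_at_imp_continuous_on)
next
  case (Suc k)
  then show ?case by (auto; metis)
qed

lemma C_k_on_subset: "C_k_on k S f \<Longrightarrow> T \<subseteq> S \<Longrightarrow> C_k_on k T f"
  by (induction k arbitrary: f) (auto intro: continuous_on_subset)

lemma C_k_on_imp_continuous_on: "C_k_on k S f \<Longrightarrow> continuous_on S f"
  by (cases k) (auto intro!: continuous_at_imp_continuous_on differentiable_imp_continuous_within)

lemma C_k_on_Suc_imp: "C_k_on (Suc k) S f \<Longrightarrow> C_k_on k S f"
proof (induction k arbitrary: f)
  case 0
  then show ?case using C_k_on_imp_continuous_on by fastforce
next
  case (Suc k)
  then show ?case by (metis C_k_on.simps(2))
qed

text \<open>Any explicit formula \<open>f'\<close> may replace \<open>frechet_derivative\<close>.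
  The closure properties below are inductions on \<open>k\<close> whose step is the differentiation
  rule for the operation in question, fed into this rule.\<close>

lemma C_k_on_SucI:
  assumes "\<And>x. x \<in> S \<Longrightarrow> (f has_derivative f' x) (at x)" "open S"
    "\<And>v. C_k_on k S (\<lambda>x. f' x v)"
  shows "C_k_on (Suc k) S f"
proof -
  have "f' x = frechet_derivative f (at x)" if "x \<in> S" for x
    using assms(1)[OF that] by (rule frechet_derivative_at)
  then have "C_k_on k S (\<lambda>x. frechet_derivative f (at x) v)" for v
    using assms(3)[of v] C_k_on_cong[OF assms(2), of "\<lambda>x. f' x v" "\<lambda>x. frechet_derivative f (at x) v"] by simp
  then show ?thesis using assms(1) by (auto simp: differentiable_def)
qed

lemma C_k_on_SucD:
  assumes "C_k_on (Suc k) S f"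
  shows "x \<in> S \<Longrightarrow> (f has_derivative frechet_derivative f (at x)) (at x)"
    "C_k_on k S (\<lambda>x. frechet_derivative f (at x) v)"
  using assms by (auto simp: frechet_derivative_works[symmetric])

lemma C_k_on_const: "C_k_on k S (\<lambda>x. c)"
  by (induction k arbitrary: c) auto

lemma C_k_on_bounded_linear: "bounded_linear L \<Longrightarrow> C_k_on k S L"
proof (induction k)
  case 0
  then show ?case by (simp add: linear_continuous_on)
next
  case (Suc k)
  have "frechet_derivative L (at x) = L" for x
    using bounded_linear_imp_has_derivative[OF Suc.prems] frechet_derivative_at by metis
  then show ?case using Suc.prems by (simp add: C_k_on_const bounded_linear_imp_differentiable)
qed

lemma C_k_on_bounded_linear_comp:
  assumes "bounded_linear L" "open S" "C_k_on k S f"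
  shows "C_k_on k S (\<lambda>x. L (f x))"
  using assms(3)
proof (induction k arbitrary: f)
  case 0
  then show ?case by (simp add: bounded_linear.continuous_on[OF assms(1)])
next
  case (Suc k)
  show ?case
    by (rule C_k_on_SucI[OF bounded_linear.has_derivative[OF assms(1) C_k_on_SucD(1)[OF Suc.prems]] assms(2)
          Suc.IH[OF C_k_on_SucD(2)[OF Suc.prems]]])
qed

lemma C_k_on_add:
  assumes "open S" "C_k_on k S f" "C_k_on k S g"
  shows "C_k_on k S (\<lambda>x. f x + g x)"
  using assms(2,3)
proof (induction k arbitrary: f g)
  case 0
  then show ?case by (simp add: continuous_on_add)
next
  case (Suc k)
  show ?case
    by (rule C_k_on_SucI[OF has_derivative_add[OF C_k_on_SucD(1)[OF Suc.prems(1)] C_k_on_SucD(1)[OF Suc.prems(2)]] assms(1)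
          Suc.IH[OF C_k_on_SucD(2)[OF Suc.prems(1)] C_k_on_SucD(2)[OF Suc.prems(2)]]])
qed

lemma C_k_on_sum:
  assumes "open S" "\<And>i. i \<in> I \<Longrightarrow> C_k_on k S (f i)"
  shows "C_k_on k S (\<lambda>x. \<Sum>i\<in>I. f i x)"
  using assms(2)
  by (induction I rule: infinite_finite_induct) (auto simp: C_k_on_const C_k_on_add[OF assms(1)])

text \<open>The Leibniz formula contains the undifferentiated factors; \<open>C_k_on_Suc_imp\<close>
  lowers them to the class \<open>k\<close> of the induction hypothesis.\<close>

lemma C_k_on_scaleR:
  fixes r :: "'e::real_normed_vector \<Rightarrow> real"
  assumes "open S" "C_k_on k S r" "C_k_on k S f"
  shows "C_k_on k S (\<lambda>x. r x *\<^sub>R f x)"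
  using assms(2,3)
proof (induction k arbitrary: r f)
  case 0
  then show ?case by (simp add: continuous_on_scaleR)
next
  case (Suc k)
  show ?case
    by (rule C_k_on_SucI[OF has_derivative_scaleR[OF C_k_on_SucD(1)[OF Suc.prems(1)] C_k_on_SucD(1)[OF Suc.prems(2)]] assms(1)
          C_k_on_add[OF assms(1) Suc.IH[OF C_k_on_Suc_imp[OF Suc.prems(1)] C_k_on_SucD(2)[OF Suc.prems(2)]]
             Suc.IH[OF C_k_on_SucD(2)[OF Suc.prems(1)] C_k_on_Suc_imp[OF Suc.prems(2)]]]])
qed

lemma C_k_on_mult:
  fixes r :: "'e::real_normed_vector \<Rightarrow> real"
  assumes "open S" "C_k_on k S r" "C_k_on k S f"
  shows "C_k_on k S (\<lambda>x. r x * f x)"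
  using C_k_on_scaleR[OF assms] by simp

lemma C_k_on_Pair:
  assumes "open S" "C_k_on k S f" "C_k_on k S g"
  shows "C_k_on k S (\<lambda>x. (f x, g x))"
  using assms(2,3)
proof (induction k arbitrary: f g)
  case 0
  then show ?case by (simp add: continuous_on_Pair)
next
  case (Suc k)
  show ?case
    by (rule C_k_on_SucI[OF has_derivative_Pair[OF C_k_on_SucD(1)[OF Suc.prems(1)] C_k_on_SucD(1)[OF Suc.prems(2)]] assms(1)
          Suc.IH[OF C_k_on_SucD(2)[OF Suc.prems(1)] C_k_on_SucD(2)[OF Suc.prems(2)]]])
qed

text \<open>The derivative is written as a product of copies of \<open>inverse\<close>, so its
  regularity is the induction hypothesis again.\<close>

lemma C_k_on_inverse: "C_k_on k (- {0}) (inverse :: real \<Rightarrow> real)"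
proof (induction k)
  case 0
  show ?case by (simp add: continuous_on_inverse)
next
  case (Suc k)
  have o: "open (- {0::real})" by auto
  show ?case
  proof (rule C_k_on_SucI[OF _ o])
    show "(inverse has_derivative (\<lambda>v. (- v) *\<^sub>R (inverse x *\<^sub>R inverse x))) (at x)" if "x \<in> -{0}" for x :: real
      using that by (auto intro!: derivative_eq_intros)
    show "C_k_on k (- {0}) (\<lambda>x. - v *\<^sub>R inverse x *\<^sub>R inverse x)" for v :: real
      by (intro C_k_on_scaleR o C_k_on_const Suc.IH)
  qed
qed

section \<open>Finite-dimensional normed spaces\<close>

text \<open>In the induction, the bound for \<open>B\<close> makes \<open>span B\<close> closed, so
  the new vector \<open>a\<close> has positive distance from it. This distance bounds the
  coefficient of \<open>a\<close>, and subtracting the component along \<open>a\<close> reduces the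
  other coefficients to \<open>B\<close>.\<close>

lemma coordinate_bound:
  fixes B :: "'e::real_normed_vector set"
  assumes "finite B" "independent B"
  shows "\<exists>K. \<forall>u. \<forall>b\<in>B. \<bar>u b\<bar> \<le> K * norm (\<Sum>b\<in>B. u b *\<^sub>R b)"
  using assms
proof (induction B rule: finite_induct)
  case empty
  then show ?case by simp
next
  case (insert a B)
  have indB: "independent B" using insert.prems independent_mono by blast
  then obtain K where K: "\<And>u b. b \<in> B \<Longrightarrow> \<bar>u b\<bar> \<le> K * norm (\<Sum>b\<in>B. u b *\<^sub>R b)"
    using insert.IH by metis
  have aB: "a \<notin> span B" using insert by (simp add: independent_insert)
  \<comment> \<open>a limit of points of \<open>span B\<close> has convergent coordinates, hence lies in \<open>span B\<close>\<close>
  have "closed (span B)"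
  proof (unfold closed_sequential_limits, intro allI impI, elim conjE)
    fix x l assume x: "\<forall>n. x n \<in> span B" and l: "x \<longlonglongrightarrow> l"
    then have "\<forall>n. \<exists>c. x n = (\<Sum>b\<in>B. c b *\<^sub>R b)"
      unfolding span_finite[OF insert(1)] by auto
    then obtain u where u: "\<And>n. x n = (\<Sum>b\<in>B. u n b *\<^sub>R b)" by metis
    have "Cauchy x" using l LIMSEQ_imp_Cauchy by blast
    have "Cauchy (\<lambda>n. u n b)" if b: "b \<in> B" for b
    proof (rule metric_CauchyI)
      fix e :: real assume "e > 0"
      have "\<bar>K\<bar> + 1 > 0" by simp
      then obtain N where N: "\<And>m n. m \<ge> N \<Longrightarrow> n \<ge> N \<Longrightarrow> dist (x m) (x n) < e / (\<bar>K\<bar> + 1)"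
        using metric_CauchyD[OF \<open>Cauchy x\<close> divide_pos_pos[OF \<open>e > 0\<close>]] by blast
      have "dist (u m b) (u n b) < e" if "m \<ge> N" "n \<ge> N" for m n
      proof -
        have "\<bar>u m b - u n b\<bar> \<le> K * norm (x m - x n)"
          using K[OF b, of "\<lambda>b. u m b - u n b"] by (simp add: u scaleR_left_diff_distrib sum_subtractf)
        also have "\<dots> \<le> (\<bar>K\<bar> + 1) * norm (x m - x n)" by (intro mult_right_mono) auto
        also have "\<dots> < e" using N[OF that] \<open>\<bar>K\<bar> + 1 > 0\<close> by (simp add: dist_norm field_simps)
        finally show ?thesis by (simp add: dist_real_def)
      qed
      then show "\<exists>N. \<forall>m\<ge>N. \<forall>n\<ge>N. dist (u m b) (u n b) < e" by blast
    qed
    then have c: "(\<lambda>n. u n b) \<longlonglongrightarrow> lim (\<lambda>n. u n b)" if "b \<in> B" for b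
      using that by (simp add: Cauchy_convergent_iff convergent_LIMSEQ_iff)
    define c where "c b = lim (\<lambda>n. u n b)" for b
    have c: "(\<lambda>n. u n b) \<longlonglongrightarrow> c b" if "b \<in> B" for b using c[OF that] by (simp add: c_def)
    have "(\<lambda>n. \<Sum>b\<in>B. u n b *\<^sub>R b) \<longlonglongrightarrow> (\<Sum>b\<in>B. c b *\<^sub>R b)"
      by (intro tendsto_sum tendsto_scaleR c tendsto_const)
    then have "x \<longlonglongrightarrow> (\<Sum>b\<in>B. c b *\<^sub>R b)" by (simp add: u[symmetric])
    then have "l = (\<Sum>b\<in>B. c b *\<^sub>R b)" using l LIMSEQ_unique by blast
    then show "l \<in> span B" by (simp add: span_sum span_scale span_base)
  qed
  then obtain d where d: "d > 0" "\<And>y. y \<in> span B \<Longrightarrow> d \<le> dist a y"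
    using aB unfolding closed_def open_dist
    by (metis ComplI ComplD dist_commute not_le)
  \<comment> \<open>For nonzero \<open>r\<close> the vector is \<open>r\<close> times the difference
    of \<open>a\<close> and an element of \<open>span B\<close>.\<close>
  have low: "\<bar>r\<bar> * d \<le> norm (r *\<^sub>R a + y)" if y: "y \<in> span B" for r y
  proof (cases "r = 0")
    case False
    have "- (y /\<^sub>R r) \<in> span B" using y by (simp add: span_neg span_scale)
    from d(2)[OF this] have "d \<le> norm (a + y /\<^sub>R r)" by (simp add: dist_norm)
    then have "\<bar>r\<bar> * d \<le> norm (r *\<^sub>R (a + y /\<^sub>R r))" by (simp add: mult_left_mono)
    also have "r *\<^sub>R (a + y /\<^sub>R r) = r *\<^sub>R a + y" using False by (simp add: scaleR_add_right)
    finally show ?thesis .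
  qed simp
  \<comment> \<open>The first entry of the maximum serves \<open>b = a\<close>. The second serves
    \<open>b\<close> in \<open>B\<close> and comes from
    \<open>norm y \<le> (1 + norm a / d) * norm x\<close>.\<close>
  have "\<bar>u b\<bar> \<le> max (1 / d) (\<bar>K\<bar> * (1 + norm a / d)) * norm (\<Sum>b\<in>insert a B. u b *\<^sub>R b)"
    if b: "b \<in> insert a B" for u b
  proof -
    define y where "y = (\<Sum>b\<in>B. u b *\<^sub>R b)"
    have y: "y \<in> span B" by (simp add: y_def span_sum span_scale span_base)
    define x where "x = u a *\<^sub>R a + y"
    have x: "(\<Sum>b\<in>insert a B. u b *\<^sub>R b) = x" using insert by (simp add: x_def y_def)
    have ua: "\<bar>u a\<bar> \<le> 1 / d * norm x" using low[OF y, of "u a"] d by (simp add: x_def field_simps)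
    show ?thesis
    proof (cases "b = a")
      case True
      have "1 / d * norm x \<le> max (1 / d) (\<bar>K\<bar> * (1 + norm a / d)) * norm x"
        by (intro mult_right_mono) auto
      then show ?thesis using ua True x by simp
    next
      case False
      have "norm y = norm (x - u a *\<^sub>R a)" by (simp add: x_def)
      also have "\<dots> \<le> norm x + \<bar>u a\<bar> * norm a" by (metis norm_scaleR norm_triangle_ineq4)
      also have "\<dots> \<le> norm x + 1 / d * norm x * norm a" using ua by (intro add_left_mono mult_right_mono) auto
      finally have ny: "norm y \<le> (1 + norm a / d) * norm x" by (simp add: algebra_simps)
      have "\<bar>u b\<bar> \<le> K * norm y" using K[of b u] b False by (simp add: y_def)
      also have "\<dots> \<le> \<bar>K\<bar> * norm y" by (intro mult_right_mono) auto
      also have "\<dots> \<le> \<bar>K\<bar> * ((1 + norm a / d) * norm x)" using ny by (intro mult_left_mono) auto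
      also have "\<dots> \<le> max (1 / d) (\<bar>K\<bar> * (1 + norm a / d)) * norm x"
        by (simp only: mult.assoc[symmetric], intro mult_right_mono) auto
      finally show ?thesis using x by simp
    qed
  qed
  then show ?case by blast
qed

definition fin_basis :: "'e::real_normed_vector set \<Rightarrow> bool" where
  "fin_basis B \<longleftrightarrow> finite B \<and> independent B \<and> span B = UNIV"

lemma fin_basis_exists:
  assumes "\<exists>B::'e::real_normed_vector set. finite B \<and> span B = UNIV"
  shows "\<exists>B::'e set. fin_basis B"
proof -
  obtain C :: "'e set" where C: "finite C" "span C = UNIV" using assms by auto
  obtain B where "B \<subseteq> C" "independent B" "span B = span C"
    by (metis basis_exists maximal_independent_subset span_eq span_mono span_span subset_antisym)
  then show ?thesis using C finite_subset unfolding fin_basis_def by metis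
qed

lemma fin_basis_sum:
  assumes "fin_basis B"
  shows "(\<Sum>b\<in>B. representation B x b *\<^sub>R b) = x"
  using assms sum_representation_eq[of B x B] by (simp add: fin_basis_def)

text \<open>Continuity of coordinates is \<open>coordinate_bound\<close> applied to the expansion of
  \<open>x\<close>. It is what lets a finite basis be used in the calculus of
  \<open>C_k_on\<close>.\<close>

lemma bounded_linear_representation:
  assumes "fin_basis (B :: 'e::real_normed_vector set)"
  shows "bounded_linear (\<lambda>x. representation B x b)"
proof -
  have B: "finite B" "independent B" "span B = UNIV" using assms by (auto simp: fin_basis_def)
  obtain K where K: "\<And>u b. b \<in> B \<Longrightarrow> \<bar>u b\<bar> \<le> K * norm (\<Sum>b\<in>B. u b *\<^sub>R b)"
    using coordinate_bound[OF B(1,2)] by blast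
  have "norm (representation B x b) \<le> norm x * \<bar>K\<bar>" for x
  proof (cases "b \<in> B")
    case True
    then have "\<bar>representation B x b\<bar> \<le> K * norm x"
      using K[OF True, of "representation B x"] fin_basis_sum[OF assms] by simp
    also have "\<dots> \<le> norm x * \<bar>K\<bar>" by (subst mult.commute, intro mult_left_mono) auto
    finally show ?thesis by simp
  next
    case False
    then have "representation B x b = 0" using representation_ne_zero by blast
    then show ?thesis by simp
  qed
  then show ?thesis
    by (intro bounded_linear_intro[where K="\<bar>K\<bar>"])
       (auto simp: representation_add[OF B(2)] representation_scale[OF B(2)] B(3))
qed

lemma linear_fin_basis:
  assumes "fin_basis B" "linear L"
  shows "L x = (\<Sum>b\<in>B. representation B x b *\<^sub>R L b)"
proof -
  have "L x = L (\<Sum>b\<in>B. representation B x b *\<^sub>R b)" using fin_basis_sum[OF assms(1)] by simp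
  then show ?thesis by (simp add: linear_sum[OF assms(2)] linear_scale[OF assms(2)])
qed

text \<open>In Df(g x)(Dg x v) the direction varies with x, while \<open>C_k_on\<close> controls
  fixed directions only. Expanding Dg x v in a basis of the middle space gives a finite sum of
  products to which the induction hypothesis applies; this is where finite dimension enters.\<close>

lemma C_k_on_compose:
  fixes g :: "'e::real_normed_vector \<Rightarrow> 'f::real_normed_vector" and f :: "'f \<Rightarrow> 'h::real_normed_vector"
  assumes "\<exists>B::'f set. finite B \<and> span B = UNIV" "open S" "open T" "g ` S \<subseteq> T"
    "C_k_on k T f" "C_k_on k S g"
  shows "C_k_on k S (\<lambda>x. f (g x))"
proof -
  obtain B :: "'f set" where B: "fin_basis B" using fin_basis_exists[OF assms(1)] by auto
  show ?thesis
    using assms(5,6)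
  proof (induction k arbitrary: f)
    case 0
    then show ?case using continuous_on_compose2[OF _ _ assms(4)] by auto
  next
    case (Suc k)
    let ?Df = "\<lambda>x. frechet_derivative f (at x)" and ?Dg = "\<lambda>x. frechet_derivative g (at x)"
    show ?case
    proof (rule C_k_on_SucI[OF _ assms(2)])
      fix x assume x: "x \<in> S"
      have gx: "g x \<in> T" using x assms(4) by auto
      have L: "linear (?Df (g x))"
        using C_k_on_SucD(1)[OF Suc.prems(1) gx] has_derivative_linear by blast
      have "((\<lambda>x. f (g x)) has_derivative (\<lambda>v. ?Df (g x) (?Dg x v))) (at x)"
        using has_derivative_compose[OF C_k_on_SucD(1)[OF Suc.prems(2) x] C_k_on_SucD(1)[OF Suc.prems(1) gx]] .
      then show "((\<lambda>x. f (g x)) has_derivative (\<lambda>v. \<Sum>b\<in>B. representation B (?Dg x v) b *\<^sub>R ?Df (g x) b)) (at x)"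
        by (simp add: linear_fin_basis[OF B L, symmetric])
    next
      show "C_k_on k S (\<lambda>x. \<Sum>b\<in>B. representation B (?Dg x v) b *\<^sub>R ?Df (g x) b)" for v
        by (intro C_k_on_sum C_k_on_scaleR assms(2) Suc.IH C_k_on_SucD(2)[OF Suc.prems(1)]
            C_k_on_bounded_linear_comp[OF bounded_linear_representation[OF B]]
            C_k_on_SucD(2)[OF Suc.prems(2)] C_k_on_Suc_imp[OF Suc.prems(2)])
    qed
  qed
qed

section \<open>Integrals depending on a parameter\<close>

lemma partial_derivative_snd:
  assumes "C_k_on (Suc k) W f" "(s, x) \<in> W"
  shows "((\<lambda>y. f (s, y)) has_derivative (\<lambda>v. frechet_derivative f (at (s, x)) (0, v))) (at x)"
proof -
  have "((\<lambda>y. (s, y)) has_derivative (\<lambda>v. (0, v))) (at x)"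
    by (intro derivative_intros)
  from has_derivative_compose[OF this C_k_on_SucD(1)[OF assms]] show ?thesis .
qed

text \<open>Differentiation under the integral sign. Compactness of [0,1] makes the partial
  derivatives in basis directions close to their values at \<open>x\<close>, uniformly in
  \<open>s\<close>; the coordinate bound extends this to all directions, and the mean value
  inequality turns it into an error estimate. \<open>W\<close> is kept separate from
  \<open>{0..1} \<times> S\<close> because the closure properties of \<open>C_k_on\<close> ask for
  an open set.\<close>

lemma has_derivative_integral_param:
  fixes f :: "real \<times> 'e::real_normed_vector \<Rightarrow> real"
  assumes fin: "\<exists>B::'e set. finite B \<and> span B = UNIV" and S: "open S" and W: "{0..1} \<times> S \<subseteq> W"
    and f: "C_k_on (Suc k) W f" and x: "x \<in> S"
  shows "((\<lambda>x. integral {0..1} (\<lambda>s. f (s, x))) has_derivative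
      (\<lambda>v. integral {0..1} (\<lambda>s. frechet_derivative f (at (s, x)) (0, v)))) (at x)"
proof -
  obtain B :: "'e set" where B: "fin_basis B" using fin_basis_exists[OF fin] by auto
  then have finB: "finite B" by (simp add: fin_basis_def)
  define D where "D s y v = frechet_derivative f (at (s, y)) (0, v)" for s y v
  define \<xi> where "\<xi> = representation B"
  have "continuous_on W (\<lambda>p. frechet_derivative f (at p) (0, v))" for v
    using C_k_on_SucD(2)[OF f] C_k_on_imp_continuous_on by blast
  then have contD: "continuous_on (S \<times> {0..1}) (\<lambda>(y, s). D s y v)" for v
    unfolding D_def case_prod_beta
    by (rule continuous_on_compose2) (use W in \<open>auto intro!: continuous_intros\<close>)
  have contf: "continuous_on W f" using f C_k_on_imp_continuous_on by blast
  have inW: "(s, y) \<in> W" if "s \<in> {0..1}" "y \<in> S" for s y using that W by auto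
  have derf: "((\<lambda>y. f (s, y)) has_derivative D s y) (at y)" if "s \<in> {0..1}" "y \<in> S" for s y
    unfolding D_def by (rule partial_derivative_snd[OF f inW[OF that]])
  have linD: "linear (D s y)" if "s \<in> {0..1}" "y \<in> S" for s y
    using derf[OF that] has_derivative_linear by blast
  have intf: "(\<lambda>s. f (s, y)) integrable_on {0..1}" if "y \<in> S" for y
    by (intro integrable_continuous_real continuous_on_compose2[OF contf] continuous_intros) (use that W in auto)
  have intD: "(\<lambda>s. D s y v) integrable_on {0..1}" if "y \<in> S" for y v
  proof -
    have "continuous_on {0..1} (\<lambda>s. (\<lambda>(y, s). D s y v) (y, s))"
      by (rule continuous_on_compose2[OF contD]) (use that in \<open>auto intro!: continuous_intros\<close>)
    then show ?thesis by (intro integrable_continuous_real) simp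
  qed
  define L where "L v = integral {0..1} (\<lambda>s. D s x v)" for v
  have L: "L = (\<lambda>v. \<Sum>b\<in>B. \<xi> v b *\<^sub>R L b)"
  proof
    fix v
    have "L v = integral {0..1} (\<lambda>s. \<Sum>b\<in>B. \<xi> v b *\<^sub>R D s x b)"
      unfolding L_def \<xi>_def by (intro integral_cong linear_fin_basis[OF B linD] x)
    also have "\<dots> = (\<Sum>b\<in>B. \<xi> v b *\<^sub>R L b)"
      unfolding L_def using finB intD[OF x] by (subst integral_sum) (auto intro!: integrable_on_mult_right)
    finally show "L v = (\<Sum>b\<in>B. \<xi> v b *\<^sub>R L b)" .
  qed
  \<comment> \<open>By the expansion \<open>L\<close> the integral is a finite combination of
    coordinate functionals.\<close>
  have blL: "bounded_linear L"
    by (subst L) (unfold \<xi>_def, intro bounded_linear_sum bounded_linear_scaleR_const bounded_linear_representation B)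
  have "\<exists>K. \<forall>v. \<forall>b\<in>B. \<bar>\<xi> v b\<bar> \<le> K * norm v"
    unfolding \<xi>_def using coordinate_bound[of B] fin_basis_sum[OF B] B unfolding fin_basis_def by metis
  then obtain K0 where K0: "\<And>v b. b \<in> B \<Longrightarrow> \<bar>\<xi> v b\<bar> \<le> K0 * norm v" by blast
  define K where "K = \<bar>K0\<bar> + 1"
  have K: "\<bar>\<xi> v b\<bar> \<le> K * norm v" if "b \<in> B" for v b
    by (rule order_trans[OF K0[OF that]], unfold K_def, intro mult_right_mono) auto
  have Kpos: "K > 0" by (simp add: K_def)
  have "\<exists>d>0. \<forall>y. norm (y - x) < d \<longrightarrow>
          norm (integral {0..1} (\<lambda>s. f (s, y)) - integral {0..1} (\<lambda>s. f (s, x)) - L (y - x)) \<le> e * norm (y - x)"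
    if e: "e > 0" for e
  proof -
    \<comment> \<open>The basis directions together contribute at most
      \<open>card B * K * e'\<close>, which stays below \<open>e\<close>. The \<open>+ 1\<close>
      keeps the quotient meaningful for an empty basis, that is in dimension 0.\<close>
    define e' where "e' = e / (real (card B) * K + 1)"
    have den: "real (card B) * K + 1 > 0" using Kpos by (simp add: add_nonneg_pos)
    have e': "e' > 0" using e den by (simp add: e'_def)
    \<comment> \<open>Compactness of [0,1] gives one neighbourhood of \<open>x\<close> that works
      for all \<open>s\<close>.\<close>
    have "\<exists>X. x \<in> X \<and> open X \<and> (\<forall>y\<in>X \<inter> S. \<forall>s\<in>{0..1}. \<bar>D s y b - D s x b\<bar> \<le> e')" for b
      by (rule continuous_on_prod_compactE[OF contD[of b] compact_Icc x e'])
        (auto simp: dist_real_def)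
    then obtain X where X: "\<And>b. x \<in> X b" "\<And>b. open (X b)"
      "\<And>b y s. y \<in> X b \<inter> S \<Longrightarrow> s \<in> {0..1} \<Longrightarrow> \<bar>D s y b - D s x b\<bar> \<le> e'" by metis
    have "open (S \<inter> (\<Inter>b\<in>B. X b))" using S X(2) finB by (intro open_Int open_INT) auto
    moreover have "x \<in> S \<inter> (\<Inter>b\<in>B. X b)" using x X(1) by auto
    ultimately obtain d where d: "d > 0" "ball x d \<subseteq> S \<inter> (\<Inter>b\<in>B. X b)"
      using open_contains_ball by metis
    have Dle: "\<bar>D s y v - D s x v\<bar> \<le> e * norm v" if y: "y \<in> ball x d" and s: "s \<in> {0..1}" for s y v
    proof -
      have yS: "y \<in> S" "\<And>b. b \<in> B \<Longrightarrow> y \<in> X b" using d y by auto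
      have "D s y v - D s x v = (\<Sum>b\<in>B. \<xi> v b * (D s y b - D s x b))"
        by (subst linear_fin_basis[OF B linD[OF s yS(1)]], subst linear_fin_basis[OF B linD[OF s x]])
          (simp add: \<xi>_def sum_subtractf right_diff_distrib)
      also have "\<bar>\<dots>\<bar> \<le> (\<Sum>b\<in>B. \<bar>\<xi> v b\<bar> * \<bar>D s y b - D s x b\<bar>)"
        by (rule order_trans[OF sum_abs]) (simp add: abs_mult)
      also have "\<dots> \<le> (\<Sum>b\<in>B. (K * norm v) * e')"
        using K X(3) yS s by (intro sum_mono mult_mono) (auto simp: K_def)
      also have "\<dots> = real (card B) * K * e' * norm v" by simp
      also have "\<dots> \<le> e * norm v"
        using e' den e by (intro mult_right_mono) (auto simp: e'_def field_simps)
      finally show ?thesis .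
    qed
    have bound: "\<bar>f (s, y) - f (s, x) - D s x (y - x)\<bar> \<le> e * norm (y - x)"
      if y: "y \<in> ball x d" and s: "s \<in> {0..1}" for s y
    proof -
      \<comment> \<open>Mean value inequality for the function y |-> f (s, y) - D s x y, whose
        derivative has norm at most \<open>e\<close> on the ball by \<open>Dle\<close>.\<close>
      have "norm ((f (s, y) - D s x y) - (f (s, x) - D s x x)) \<le> e * norm (y - x)"
      proof (rule differentiable_bound[of "ball x d" "\<lambda>y. f (s, y) - D s x y" "\<lambda>y v. D s y v - D s x v"])
        show "((\<lambda>y. f (s, y) - D s x y) has_derivative (\<lambda>v. D s z v - D s x v)) (at z within ball x d)"
          if "z \<in> ball x d" for z
          using that d s x
          by (intro has_derivative_diff has_derivative_at_withinI[OF derf]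
              bounded_linear_imp_has_derivative has_derivative_bounded_linear[OF derf]) auto
        show "onorm (\<lambda>v. D s z v - D s x v) \<le> e" if "z \<in> ball x d" for z
          using Dle[OF that s] e by (intro onorm_bound) auto
      qed (use y d in auto)
      moreover have "D s x (y - x) = D s x y - D s x x" by (rule linear_diff[OF linD[OF s x]])
      ultimately show ?thesis by (simp add: algebra_simps)
    qed
    have "norm (integral {0..1} (\<lambda>s. f (s, y)) - integral {0..1} (\<lambda>s. f (s, x)) - L (y - x)) \<le> e * norm (y - x)"
      if "norm (y - x) < d" for y
    proof -
      have y: "y \<in> ball x d" using that by (simp add: dist_norm norm_minus_commute)
      then have yS: "y \<in> S" using d by auto
      have "integral {0..1} (\<lambda>s. f (s, y)) - integral {0..1} (\<lambda>s. f (s, x)) - L (y - x)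
          = integral {0..1} (\<lambda>s. f (s, y) - f (s, x) - D s x (y - x))"
        unfolding L_def using intf[OF yS] intf[OF x] intD[OF x]
        by (simp add: integral_diff integrable_diff)
      also have "norm \<dots> \<le> integral {0..1} (\<lambda>s::real. e * norm (y - x))"
        using bound[OF y] intf[OF yS] intf[OF x] intD[OF x]
        by (intro integral_norm_bound_integral integrable_diff) auto
      finally show ?thesis by simp
    qed
    then show ?thesis using d(1) by blast
  qed
  then show ?thesis
    unfolding has_derivative_at_alt using blL by (simp add: L_def[abs_def] D_def[abs_def])
qed

text \<open>The derivative is again a parameter integral, with a directional derivative of
  \<open>f\<close> as integrand, so the induction on \<open>k\<close> closes.\<close>

lemma C_k_on_integral_param:
  fixes f :: "real \<times> 'e::real_normed_vector \<Rightarrow> real"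
  assumes fin: "\<exists>B::'e set. finite B \<and> span B = UNIV" and S: "open S" and W: "{0..1} \<times> S \<subseteq> W"
    and f: "C_k_on k W f"
  shows "C_k_on k S (\<lambda>x. integral {0..1} (\<lambda>s. f (s, x)))"
  using f
proof (induction k arbitrary: f)
  case 0
  have "continuous_on (S \<times> cbox 0 1) (\<lambda>(y, s). f (s, y))"
    unfolding case_prod_beta
    by (rule continuous_on_compose2[of W f]) (use 0 W in \<open>auto intro!: continuous_intros\<close>)
  from integral_continuous_on_param[OF this] show ?case by simp
next
  case (Suc k)
  show ?case
    by (rule C_k_on_SucI[OF has_derivative_integral_param[OF fin S W Suc.prems] S
          Suc.IH[OF C_k_on_SucD(2)[OF Suc.prems]]])
qed

section \<open>Local normal forms of closed 2-forms\<close>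

lemma C_k_on_diff_const:
  assumes "open S" shows "C_k_on k S (\<lambda>x. x - a)"
  using C_k_on_add[OF assms C_k_on_bounded_linear[OF bounded_linear_ident] C_k_on_const[of k S "- a"]] by simp

text \<open>\<open>A b\<close> is the coefficient of \<open>d\<xi>\<^sub>b\<close> in the cone primitive
  \<open>\<integral>\<^sub>0\<^sup>1 s \<theta>(x\<^sub>0 + s (x - x\<^sub>0))(x - x\<^sub>0, \<cdot>) ds\<close>, so that \<open>\<theta> = \<Sum>\<^sub>b dA\<^sub>b \<and> d\<xi>\<^sub>b\<close> for the coordinates \<open>\<xi>\<^sub>b\<close> of \<open>B\<close>.\<close>

lemma poincare:
  fixes \<theta> :: "'e::real_normed_vector \<Rightarrow> 'e \<Rightarrow> 'e \<Rightarrow> real"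
  assumes B: "fin_basis B" and S: "open S" "x\<^sub>0 \<in> S"
    and lin: "\<And>x w. x \<in> S \<Longrightarrow> linear (\<lambda>v. \<theta> x v w)"
    and alt: "\<And>x v w. x \<in> S \<Longrightarrow> \<theta> x w v = - \<theta> x v w"
    and smooth: "\<And>v w. smooth_on S (\<lambda>x. \<theta> x v w)"
    and closed: "\<And>x u v w. x \<in> S \<Longrightarrow>
        frechet_derivative (\<lambda>x. \<theta> x v w) (at x) u - frechet_derivative (\<lambda>x. \<theta> x u w) (at x) v
      + frechet_derivative (\<lambda>x. \<theta> x u v) (at x) w = 0"
  shows "\<exists>T A. open T \<and> x\<^sub>0 \<in> T \<and> T \<subseteq> S \<and> (\<forall>b. smooth_on T (A b) \<and> A b x\<^sub>0 = 0) \<and>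
     (\<forall>x\<in>T. \<forall>v w. \<theta> x v w = (\<Sum>b\<in>B. frechet_derivative (A b) (at x) v * representation B w b
         - frechet_derivative (A b) (at x) w * representation B v b))"
proof -
  have fin: "\<exists>B::'e set. finite B \<and> span B = UNIV" using B by (auto simp: fin_basis_def)
  have finB: "finite B" using B by (simp add: fin_basis_def)
  define \<xi> where "\<xi> = representation B"
  have \<xi>_bl: "bounded_linear (\<lambda>v. \<xi> v b)" for b
    unfolding \<xi>_def by (rule bounded_linear_representation[OF B])
  define D where "D x u v w = frechet_derivative (\<lambda>x. \<theta> x v w) (at x) u" for x u v w
  have der: "((\<lambda>x. \<theta> x v w) has_derivative (\<lambda>u. D x u v w)) (at x)" if "x \<in> S" for x v w
    using smooth[of v w] that C_k_on_SucD(1)[of 0 S "\<lambda>x. \<theta> x v w" x] unfolding smooth_on_def D_def by blast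
  have linv: "\<theta> x v w = (\<Sum>c\<in>B. \<xi> v c * \<theta> x c w)" if "x \<in> S" for x v w
    unfolding \<xi>_def using linear_fin_basis[OF B lin[OF that], of v w] by (simp only: real_scaleR_def)
  have linw: "\<theta> x v w = (\<Sum>b\<in>B. \<xi> w b * \<theta> x v b)" if "x \<in> S" for x v w
  proof -
    have "\<theta> x v w = - \<theta> x w v" by (rule alt[OF that])
    also have "\<dots> = - (\<Sum>b\<in>B. \<xi> w b * \<theta> x b v)" using linv[OF that, of w v] by (rule arg_cong)
    also have "\<dots> = (\<Sum>b\<in>B. \<xi> w b * - \<theta> x b v)" by (simp add: sum_negf)
    also have "\<dots> = (\<Sum>b\<in>B. \<xi> w b * \<theta> x v b)" by (intro sum.cong refl) (metis alt[OF that])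
    finally show ?thesis .
  qed
  \<comment> \<open>The basis expansions of \<theta> hold on the open set \<open>S\<close>, hence
    may be differentiated term by term.\<close>
  have Dv: "D x u v w = (\<Sum>c\<in>B. \<xi> v c * D x u c w)" if "x \<in> S" for x u v w
  proof -
    have "((\<lambda>x. \<Sum>c\<in>B. \<xi> v c * \<theta> x c w) has_derivative (\<lambda>u. \<Sum>c\<in>B. \<xi> v c * D x u c w)) (at x)"
      by (intro has_derivative_sum has_derivative_mult_right der that)
    then have "((\<lambda>x. \<theta> x v w) has_derivative (\<lambda>u. \<Sum>c\<in>B. \<xi> v c * D x u c w)) (at x)"
      by (rule has_derivative_transform_within_open[OF _ S(1) that]) (rule linv[symmetric])
    from fun_cong[OF has_derivative_unique[OF der[OF that] this]] show ?thesis .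
  qed
  have Dw: "D x u v w = (\<Sum>b\<in>B. \<xi> w b * D x u v b)" if "x \<in> S" for x u v w
  proof -
    have "((\<lambda>x. \<Sum>b\<in>B. \<xi> w b * \<theta> x v b) has_derivative (\<lambda>u. \<Sum>b\<in>B. \<xi> w b * D x u v b)) (at x)"
      by (intro has_derivative_sum has_derivative_mult_right der that)
    then have "((\<lambda>x. \<theta> x v w) has_derivative (\<lambda>u. \<Sum>b\<in>B. \<xi> w b * D x u v b)) (at x)"
      by (rule has_derivative_transform_within_open[OF _ S(1) that]) (rule linw[symmetric])
    from fun_cong[OF has_derivative_unique[OF der[OF that] this]] show ?thesis .
  qed
  obtain r where r: "r > 0" "ball x\<^sub>0 r \<subseteq> S" using S open_contains_ball by blast
  \<comment> \<open>A ball is star-shaped about its centre, so the segments traced by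
    \<open>z\<close> stay inside.\<close>
  define T where "T = ball x\<^sub>0 r"
  have T: "open T" "x\<^sub>0 \<in> T" "T \<subseteq> S" "convex T" using r by (auto simp: T_def)
  define z where "z p = x\<^sub>0 + fst p *\<^sub>R (snd p - x\<^sub>0)" for p :: "real \<times> 'e"
  define W where "W = z -` S"
  have "continuous_on UNIV z" unfolding z_def by (intro continuous_intros)
  then have W: "open W" unfolding W_def using S(1) by (simp add: open_vimage continuous_on_eq_continuous_within)
  have zT: "z (s, x) \<in> T" if "s \<in> {0..1}" "x \<in> T" for s x
  proof -
    have "(1 - s) *\<^sub>R x\<^sub>0 + s *\<^sub>R x \<in> T" using convexD_alt[OF T(4) T(2) that(2)] that(1) by auto
    then show ?thesis by (simp add: z_def algebra_simps)
  qed
  then have sub: "{0..1} \<times> T \<subseteq> W" by (auto simp: W_def intro!: subsetD[OF T(3)])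
  define f where "f b p = fst p * (\<Sum>c\<in>B. \<xi> (snd p - x\<^sub>0) c * \<theta> (z p) c b)" for b p
  have zC: "C_k_on k W z" for k
    unfolding z_def
    by (intro C_k_on_add C_k_on_const C_k_on_scaleR W C_k_on_bounded_linear bounded_linear_fst
        C_k_on_compose[OF fin W open_UNIV _ C_k_on_diff_const] bounded_linear_snd open_UNIV) auto
  have fC: "C_k_on k W (f b)" for k b
    unfolding f_def
    by (intro C_k_on_mult C_k_on_sum W C_k_on_bounded_linear bounded_linear_fst
        C_k_on_compose[OF fin W S(1) _ smooth[unfolded smooth_on_def, rule_format] zC]
        C_k_on_bounded_linear_comp[OF \<xi>_bl]
        C_k_on_compose[OF fin W open_UNIV _ C_k_on_diff_const] bounded_linear_snd open_UNIV)
      (auto simp: W_def)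
  define A where "A b x = integral {0..1} (\<lambda>s. f b (s, x))" for b x
  have "smooth_on T (A b)" for b
    unfolding smooth_on_def A_def using C_k_on_integral_param[OF fin T(1) sub fC] by blast
  moreover have "A b x\<^sub>0 = 0" for b
  proof -
    have "\<xi> 0 c = 0" for c using linear_0[OF bounded_linear.linear[OF \<xi>_bl]] .
    then show ?thesis by (simp add: A_def f_def)
  qed
  moreover have "\<theta> x v w = (\<Sum>b\<in>B. frechet_derivative (A b) (at x) v * \<xi> w b
         - frechet_derivative (A b) (at x) w * \<xi> v b)" if x: "x \<in> T" for x v w
  proof -
    \<comment> \<open>The factor \<open>s\<^sup>2\<close> is the weight \<open>s\<close> of the
      primitive times the inner derivative \<open>s\<close> of the contraction
      \<open>z\<close>.\<close>
    define F where "F s v b = s * \<theta> (z (s, x)) v b + s\<^sup>2 * D (z (s, x)) v (x - x\<^sub>0) b" for s v b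
    have F: "frechet_derivative (f b) (at (s, x)) (0, v) = F s v b" if s: "s \<in> {0..1}" for s v b
    proof -
      have zS: "z (s, x) \<in> S" using zT[OF s x] T(3) by auto
      have "((\<lambda>y. z (s, y)) has_derivative (\<lambda>v. s *\<^sub>R v)) (at x)"
        unfolding z_def by (auto intro!: derivative_eq_intros)
      then have d1: "((\<lambda>y. \<theta> (z (s, y)) c b) has_derivative (\<lambda>v. D (z (s, x)) (s *\<^sub>R v) c b)) (at x)" for c
        using has_derivative_compose[of "\<lambda>y. z (s, y)", OF _ der[OF zS]] by blast
      have d2: "((\<lambda>y. \<xi> (y - x\<^sub>0) c) has_derivative (\<lambda>v. \<xi> v c)) (at x)" for c
        by (rule bounded_linear.has_derivative[OF \<xi>_bl]) (auto intro!: derivative_eq_intros)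
      have "((\<lambda>y. f b (s, y)) has_derivative (\<lambda>v. s * (\<Sum>c\<in>B. \<xi> (x - x\<^sub>0) c * D (z (s, x)) (s *\<^sub>R v) c b
          + \<xi> v c * \<theta> (z (s, x)) c b))) (at x)"
        unfolding f_def fst_conv snd_conv
        by (intro has_derivative_mult_right has_derivative_sum has_derivative_mult d1 d2)
      then have "frechet_derivative (f b) (at (s, x)) (0, v) = s * (\<Sum>c\<in>B. \<xi> (x - x\<^sub>0) c * D (z (s, x)) (s *\<^sub>R v) c b
          + \<xi> v c * \<theta> (z (s, x)) c b)"
        using fun_cong[OF has_derivative_unique[OF partial_derivative_snd[OF fC[of "Suc 0" b]]]] sub s x by blast
      also have "\<dots> = s * (D (z (s, x)) (s *\<^sub>R v) (x - x\<^sub>0) b + \<theta> (z (s, x)) v b)"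
        unfolding sum.distrib Dv[OF zS, of _ "x - x\<^sub>0"] linv[OF zS, of v] ..
      also have "D (z (s, x)) (s *\<^sub>R v) (x - x\<^sub>0) b = s * D (z (s, x)) v (x - x\<^sub>0) b"
        using linear_scale[OF has_derivative_linear[OF der[OF zS]]] by simp
      finally show ?thesis by (simp add: F_def algebra_simps power2_eq_square)
    qed
    have contF: "(\<lambda>s. F s v b) integrable_on {0..1}" for v b
    proof -
      have "continuous_on W (\<lambda>p. frechet_derivative (f b) (at p) (0, v))"
        using C_k_on_imp_continuous_on[OF C_k_on_SucD(2)[OF fC[of "Suc 0" b]]] .
      then have "continuous_on {0..1} (\<lambda>s. frechet_derivative (f b) (at (s, x)) (0, v))"
        by (rule continuous_on_compose2) (use sub x in \<open>auto intro!: continuous_intros\<close>)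
      then have "continuous_on {0..1} (\<lambda>s. F s v b)" by (rule continuous_on_eq) (rule F)
      then show ?thesis by (rule integrable_continuous_real)
    qed
    have DA: "frechet_derivative (A b) (at x) v = integral {0..1} (\<lambda>s. F s v b)" for v b
    proof -
      have "frechet_derivative (A b) (at x) v = integral {0..1} (\<lambda>s. frechet_derivative (f b) (at (s, x)) (0, v))"
        using frechet_derivative_at[OF has_derivative_integral_param[OF fin T(1) sub fC x]] unfolding A_def by metis
      also have "\<dots> = integral {0..1} (\<lambda>s. F s v b)" by (rule integral_cong) (rule F)
      finally show ?thesis .
    qed
    define G where "G v w s = (\<Sum>b\<in>B. F s v b * \<xi> w b)" for v w s
    have intG: "integral {0..1} (G v w) = (\<Sum>b\<in>B. frechet_derivative (A b) (at x) v * \<xi> w b)" "G v w integrable_on {0..1}" for v w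
      unfolding G_def DA using finB contF
      by (auto simp: integral_sum integrable_on_mult_left intro!: integrable_sum integrable_on_mult_left)
    \<comment> \<open>Antisymmetrising in v and w doubles the first term, and closedness merges the
      two derivative terms into one radial derivative. The right-hand side is the derivative of
      \<open>s\<^sup>2 * \<theta> (z (s, x)) v w\<close> in \<open>s\<close>.\<close>
    have GG: "G v w s - G w v s = 2 * s * \<theta> (z (s, x)) v w + s\<^sup>2 * D (z (s, x)) (x - x\<^sub>0) v w" if s: "s \<in> {0..1}" for s
    proof -
      have zS: "z (s, x) \<in> S" using zT[OF s x] T(3) by auto
      have G: "G v w s = s * \<theta> (z (s, x)) v w + s\<^sup>2 * D (z (s, x)) v (x - x\<^sub>0) w" for v w
        unfolding G_def F_def linw[OF zS, of v w] Dw[OF zS, of v "x - x\<^sub>0" w]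
        by (simp add: sum.distrib sum_distrib_left algebra_simps)
      have "D (z (s, x)) (x - x\<^sub>0) v w - D (z (s, x)) v (x - x\<^sub>0) w + D (z (s, x)) w (x - x\<^sub>0) v = 0"
        unfolding D_def by (rule closed[OF zS])
      then show ?thesis using alt[OF zS, of v w] by (simp add: G algebra_simps flip: distrib_left)
    qed
    \<comment> \<open>At s = 0 the weight vanishes and at s = 1 the contraction is the identity, so
      only \<theta> at \<open>x\<close> survives.\<close>
    have "((\<lambda>s. 2 * s * \<theta> (z (s, x)) v w + s\<^sup>2 * D (z (s, x)) (x - x\<^sub>0) v w) has_integral
        (1\<^sup>2 * \<theta> (z (1, x)) v w - 0\<^sup>2 * \<theta> (z (0, x)) v w)) {0..1}"
    proof (rule fundamental_theorem_of_calculus)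
      fix s :: real assume s: "s \<in> {0..1}"
      have zS: "z (s, x) \<in> S" using zT[OF s x] T(3) by auto
      have "((\<lambda>s. z (s, x)) has_derivative (\<lambda>h. h *\<^sub>R (x - x\<^sub>0))) (at s)"
        unfolding z_def by (auto intro!: derivative_eq_intros)
      then have "((\<lambda>s. \<theta> (z (s, x)) v w) has_derivative (\<lambda>h. D (z (s, x)) (h *\<^sub>R (x - x\<^sub>0)) v w)) (at s)"
        using has_derivative_compose[of "\<lambda>s. z (s, x)", OF _ der[OF zS]] by blast
      moreover have "(\<lambda>h. D (z (s, x)) (h *\<^sub>R (x - x\<^sub>0)) v w) = (\<lambda>h. h * D (z (s, x)) (x - x\<^sub>0) v w)"
        using linear_scale[OF has_derivative_linear[OF der[OF zS]]] by simp
      ultimately have "((\<lambda>s. \<theta> (z (s, x)) v w) has_field_derivative D (z (s, x)) (x - x\<^sub>0) v w) (at s)"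
        by (simp add: has_field_derivative_def mult_commute_abs)
      then have "((\<lambda>s. s\<^sup>2 * \<theta> (z (s, x)) v w) has_field_derivative
          2 * s * \<theta> (z (s, x)) v w + s\<^sup>2 * D (z (s, x)) (x - x\<^sub>0) v w) (at s)"
        by (auto intro!: derivative_eq_intros)
      then show "((\<lambda>s. s\<^sup>2 * \<theta> (z (s, x)) v w) has_vector_derivative
          2 * s * \<theta> (z (s, x)) v w + s\<^sup>2 * D (z (s, x)) (x - x\<^sub>0) v w) (at s within {0..1})"
        by (simp add: has_real_derivative_iff_has_vector_derivative has_vector_derivative_at_within)
    qed simp
    moreover have "1\<^sup>2 * \<theta> (z (1, x)) v w - 0\<^sup>2 * \<theta> (z (0, x)) v w = \<theta> x v w" by (simp add: z_def)
    ultimately have "((\<lambda>s. 2 * s * \<theta> (z (s, x)) v w + s\<^sup>2 * D (z (s, x)) (x - x\<^sub>0) v w) has_integral \<theta> x v w) {0..1}"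
      by (simp only:)
    then have "((\<lambda>s. G v w s - G w v s) has_integral \<theta> x v w) {0..1}"
      by (rule has_integral_eq[rotated]) (rule GG[symmetric])
    then have "\<theta> x v w = integral {0..1} (\<lambda>s. G v w s - G w v s)" by (simp add: integral_unique)
    also have "\<dots> = integral {0..1} (G v w) - integral {0..1} (G w v)" by (rule integral_diff[OF intG(2) intG(2)])
    finally show ?thesis by (simp add: intG(1) sum_subtractf)
  qed
  ultimately show ?thesis using T unfolding \<xi>_def by blast
qed

text \<open>\<open>(u, snd)\<close> is the local inverse of \<open>(R, snd)\<close> for \<open>R (a, b) = \<integral>\<^sub>0\<^sup>a \<rho> (s, b) ds\<close>; it pulls
  \<open>\<rho> da \<and> db\<close> back to the standard area form.\<close>

lemma planar_darboux:
  fixes \<rho> :: "real \<times> real \<Rightarrow> real"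
  assumes P: "open P" "0 \<in> P" and smooth: "smooth_on P \<rho>" and nz: "\<rho> 0 \<noteq> 0"
  shows "\<exists>(N::(real \<times> real) set) u. open N \<and> 0 \<in> N \<and> smooth_on N u \<and> u 0 = 0 \<and>
    (\<forall>z\<in>N. (u z, snd z) \<in> P \<and> \<rho> (u z, snd z) * frechet_derivative u (at z) (1, 0) = 1)"
proof -
  have fin: "\<exists>B::(real \<times> real) set. finite B \<and> span B = UNIV"
    using finite_Basis span_Basis by blast
  have cont\<rho>: "continuous_on P \<rho>" using smooth C_k_on_imp_continuous_on by (auto simp: smooth_on_def)
  have "open (P \<inter> \<rho> -` (- {0}))" by (rule continuous_open_preimage[OF cont\<rho> P(1)]) auto
  then obtain r where r: "r > 0" "ball 0 r \<subseteq> P \<inter> \<rho> -` (- {0})"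
    using openE[of "P \<inter> \<rho> -` (- {0})" 0] P(2) nz by blast
  define Q where "Q = ball (0::real \<times> real) r"
  have Q: "open Q" "0 \<in> Q" "Q \<subseteq> P" "\<And>z. z \<in> Q \<Longrightarrow> \<rho> z \<noteq> 0" using r by (auto simp: Q_def)
  \<comment> \<open>Rescaling the integration variable turns the integral from 0 to a into the
    integral over [0,1] of a \<rho>(s a, b), which has fixed limits. The ball \<open>Q\<close> is
    stable under these rescalings.\<close>
  define h where "h p = (fst p * fst (snd p), snd (snd p))" for p :: "real \<times> real \<times> real"
  define W where "W = h -` P"
  have "continuous_on UNIV h" unfolding h_def by (intro continuous_intros)
  then have W: "open W" unfolding W_def using P(1) by (simp add: open_vimage continuous_on_eq_continuous_within)
  have hQ: "h (s, z) \<in> Q" if "s \<in> {0..1}" "z \<in> Q" for s z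
  proof -
    have "norm (h (s, z)) \<le> norm z"
    proof (cases z)
      case (Pair a b)
      have "\<bar>s * a\<bar> \<le> \<bar>a\<bar>" using that(1) by (auto simp: abs_mult mult_left_le_one_le)
      then show ?thesis using Pair by (simp add: h_def norm_Pair) (meson abs_le_square_iff)
    qed
    then show ?thesis using that(2) by (simp add: Q_def)
  qed
  then have sub: "{0..1} \<times> Q \<subseteq> W" by (auto simp: W_def intro!: subsetD[OF Q(3)])
  have bl1: "bounded_linear (\<lambda>p::real \<times> real \<times> real. fst (snd p))"
    and bl2: "bounded_linear (\<lambda>p::real \<times> real \<times> real. snd (snd p))"
    by (intro bounded_linear_compose[OF bounded_linear_fst bounded_linear_snd]
        bounded_linear_compose[OF bounded_linear_snd bounded_linear_snd])+
  have hC: "C_k_on k W h" for k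
    unfolding h_def
    by (intro C_k_on_Pair C_k_on_mult W C_k_on_bounded_linear bounded_linear_fst bl1 bl2)
  define f where "f p = fst (snd p) * \<rho> (h p)" for p
  have fC: "C_k_on k W f" for k
    unfolding f_def
    by (intro C_k_on_mult W C_k_on_bounded_linear bl1
        C_k_on_compose[OF fin W P(1) _ smooth[unfolded smooth_on_def, rule_format] hC]) (auto simp: W_def)
  define R where "R z = integral {0..1} (\<lambda>s. f (s, z))" for z
  define DR where "DR z = frechet_derivative R (at z)" for z
  have RC: "C_k_on k Q R" for k
    unfolding R_def by (rule C_k_on_integral_param[OF fin Q(1) sub fC])
  have derR: "(R has_derivative DR z) (at z)" if "z \<in> Q" for z
    unfolding DR_def by (rule C_k_on_SucD(1)[OF RC that])
  have linDR: "linear (DR z)" if "z \<in> Q" for z using derR[OF that] has_derivative_linear by blast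
  have d\<rho>0: "(\<rho> has_derivative frechet_derivative \<rho> (at z)) (at z)" if "z \<in> P" for z
    by (rule C_k_on_SucD(1)[of 0, OF smooth[unfolded smooth_on_def, rule_format] that])
  \<comment> \<open>The derivative of the integrand in direction (1, 0) equals the derivative of s
    \<rho>(s a, b) in s, so the integral is the value at s = 1.\<close>
  have DR10: "DR z (1, 0) = \<rho> z" if z: "z \<in> Q" for z
  proof -
    have *: "frechet_derivative f (at (s, z)) (0, (1, 0)) =
        \<rho> (h (s, z)) + fst z * frechet_derivative \<rho> (at (h (s, z))) (s, 0)" if s: "s \<in> {0..1}" for s
    proof -
      have d\<rho>: "(\<rho> has_derivative frechet_derivative \<rho> (at (h (s, z)))) (at (h (s, z)))"
        using d\<rho>0 hQ[OF s z] Q(3) by blast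
      have "((\<lambda>y. h (s, y)) has_derivative (\<lambda>v. (s * fst v, snd v))) (at z)"
        unfolding h_def by (auto intro!: derivative_eq_intros)
      from has_derivative_compose[OF this d\<rho>]
      have "((\<lambda>y. f (s, y)) has_derivative (\<lambda>v. fst z * frechet_derivative \<rho> (at (h (s, z))) (s * fst v, snd v)
          + fst v * \<rho> (h (s, z)))) (at z)"
        unfolding f_def fst_conv snd_conv
        by (intro has_derivative_mult has_derivative_fst has_derivative_ident)
      moreover have "(s, z) \<in> W" using sub s z by auto
      ultimately show ?thesis
        using fun_cong[OF has_derivative_unique[OF partial_derivative_snd[OF fC[of "Suc 0"]]], of s z _ "(1, 0)"]
        by fastforce
    qed
    have "((\<lambda>s. \<rho> (h (s, z)) + fst z * frechet_derivative \<rho> (at (h (s, z))) (s, 0)) has_integral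
        (1 * \<rho> (h (1, z)) - 0 * \<rho> (h (0, z)))) {0..1}"
    proof (rule fundamental_theorem_of_calculus)
      fix s :: real assume s: "s \<in> {0..1}"
      let ?D = "frechet_derivative \<rho> (at (h (s, z)))"
      have d\<rho>: "(\<rho> has_derivative ?D) (at (h (s, z)))"
        using d\<rho>0 hQ[OF s z] Q(3) by blast
      have lin: "linear ?D" using d\<rho> has_derivative_linear by blast
      have "((\<lambda>s. h (s, z)) has_derivative (\<lambda>t. (t * fst z, 0))) (at s)"
        unfolding h_def by (auto intro!: derivative_eq_intros)
      from has_derivative_compose[OF this d\<rho>]
      have "((\<lambda>s. \<rho> (h (s, z))) has_derivative (\<lambda>t. ?D (t * fst z, 0))) (at s)" .
      moreover have "(\<lambda>t. ?D (t * fst z, 0)) = (\<lambda>t. t * ?D (fst z, 0))"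
        using linear_scale[OF lin, of _ "(fst z, 0)"] by simp
      ultimately have "((\<lambda>s. \<rho> (h (s, z))) has_field_derivative ?D (fst z, 0)) (at s)"
        by (simp add: has_field_derivative_def mult_commute_abs)
      then have "((\<lambda>s. s * \<rho> (h (s, z))) has_field_derivative \<rho> (h (s, z)) + s * ?D (fst z, 0)) (at s)"
        by (auto intro!: derivative_eq_intros)
      moreover have "s * ?D (fst z, 0) = fst z * ?D (s, 0)"
        using linear_scale[OF lin, of s "(fst z, 0)"] linear_scale[OF lin, of "fst z" "(s, 0)"]
        by (simp add: mult.commute)
      ultimately show "((\<lambda>s. s * \<rho> (h (s, z))) has_vector_derivative \<rho> (h (s, z)) + fst z * ?D (s, 0)) (at s within {0..1})"
        by (simp add: has_real_derivative_iff_has_vector_derivative has_vector_derivative_at_within)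
    qed simp
    then have "integral {0..1} (\<lambda>s. \<rho> (h (s, z)) + fst z * frechet_derivative \<rho> (at (h (s, z))) (s, 0)) = \<rho> z"
      by (simp add: h_def integral_unique)
    moreover have "DR z (1, 0) = integral {0..1} (\<lambda>s. frechet_derivative f (at (s, z)) (0, (1, 0)))"
      using fun_cong[OF has_derivative_unique[OF derR[OF z, unfolded R_def[abs_def]]
            has_derivative_integral_param[OF fin Q(1) sub fC z]]] .
    moreover have "\<dots> = integral {0..1} (\<lambda>s. \<rho> (h (s, z)) + fst z * frechet_derivative \<rho> (at (h (s, z))) (s, 0))"
      by (rule integral_cong) (rule *)
    ultimately show ?thesis by simp
  qed
  have DR: "DR z v = fst v * \<rho> z + snd v * DR z (0, 1)" if "z \<in> Q" for z v
  proof -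
    have "DR z (fst v *\<^sub>R (1, 0) + snd v *\<^sub>R (0, 1)) = fst v * \<rho> z + snd v * DR z (0, 1)"
      by (simp only: linear_add[OF linDR[OF that]] linear_scale[OF linDR[OF that]] DR10[OF that] real_scaleR_def)
    then show ?thesis by simp
  qed
  define \<Psi> where "\<Psi> z = (R z, snd z)" for z
  define \<Psi>' where "\<Psi>' z = Blinfun (\<lambda>v. (DR z v, snd v))" for z
  have der\<Psi>: "(\<Psi> has_derivative (\<lambda>v. (DR z v, snd v))) (at z)" if "z \<in> Q" for z
    unfolding \<Psi>_def by (intro has_derivative_Pair derR that has_derivative_snd has_derivative_ident)
  have \<Psi>': "blinfun_apply (\<Psi>' z) = (\<lambda>v. (DR z v, snd v))" if "z \<in> Q" for z
    unfolding \<Psi>'_def by (rule bounded_linear_Blinfun_apply[OF has_derivative_bounded_linear[OF der\<Psi>[OF that]]])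
  have cont: "continuous_on Q \<Psi>'"
  proof (rule continuous_on_blinfun_componentwise)
    fix i :: "real \<times> real"
    have "continuous_on Q (\<lambda>z. (DR z i, snd i))"
      unfolding DR_def
      by (intro continuous_on_Pair C_k_on_imp_continuous_on[OF C_k_on_SucD(2)[OF RC[of "Suc 0"]]] continuous_intros)
    then show "continuous_on Q (\<lambda>z. blinfun_apply (\<Psi>' z) i)"
      by (rule continuous_on_eq) (simp add: \<Psi>')
  qed
  have \<Psi>0: "\<Psi> 0 = 0" by (simp add: \<Psi>_def R_def f_def zero_prod_def)
  \<comment> \<open>The explicit inverse of the triangular map \<open>\<Psi>' 0\<close>, whose
    diagonal entries are \<open>\<rho> 0\<close> and 1.\<close>
  define j where "j v = ((fst v - snd v * DR 0 (0, 1)) / \<rho> 0, snd v)" for v :: "real \<times> real"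
  have blj: "bounded_linear j"
    unfolding j_def
    by (intro bounded_linear_Pair bounded_linear_snd
        bounded_linear_compose[OF bounded_linear_divide bounded_linear_sub[OF bounded_linear_fst
            bounded_linear_compose[OF bounded_linear_mult_left bounded_linear_snd]]])
  have inv: "Blinfun j o\<^sub>L \<Psi>' 0 = id_blinfun"
  proof (rule blinfun_eqI)
    fix v
    have "DR 0 v - snd v * DR 0 (0, 1) = fst v * \<rho> 0" using DR[OF Q(2), of v] by simp
    then have "j (DR 0 v, snd v) = v" using nz by (simp add: j_def)
    then show "blinfun_apply (Blinfun j o\<^sub>L \<Psi>' 0) v = blinfun_apply id_blinfun v"
      by (simp add: \<Psi>'[OF Q(2)] bounded_linear_Blinfun_apply[OF blj])
  qed
  have d\<Psi>: "(\<Psi> has_derivative blinfun_apply (\<Psi>' z)) (at z)" if "z \<in> Q" for z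
    using der\<Psi>[OF that] \<Psi>'[OF that] by simp
  obtain U' V g g' where g: "open U'" "U' \<subseteq> Q" "0 \<in> U'" "open V" "\<Psi> 0 \<in> V" "homeomorphism U' V \<Psi> g"
    "\<And>y. y \<in> V \<Longrightarrow> (g has_derivative (g' y)) (at y)"
    by (rule inverse_function_theorem[OF Q(1) d\<Psi> cont Q(2) inv]) (assumption, rule that, assumption+)
  define u where "u y = fst (g y)" for y
  have gV: "g y \<in> Q" "\<Psi> (g y) = y" if "y \<in> V" for y
    using g(2,6) that by (auto simp: homeomorphism_def)
  have gu: "g y = (u y, snd y)" if "y \<in> V" for y
    using gV(2)[OF that] by (metis \<Psi>_def prod.collapse snd_conv u_def)
  have "g 0 = 0" using g(3,6) \<Psi>0 by (metis homeomorphism_apply1)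
  then have u0: "u 0 = 0" by (simp add: u_def)
  have contu: "continuous_on V u"
    unfolding u_def using g(6) by (intro continuous_on_fst) (simp add: homeomorphism_def)
  \<comment> \<open>Obtained by differentiating \<open>R (u y, snd y) = fst y\<close> and solving
    for the derivative of \<open>u\<close>; \<open>\<rho>\<close> has no zero on \<open>Q\<close>.
    The formula involves \<open>u\<close> itself only undifferentiated.\<close>
  have deru: "(u has_derivative (\<lambda>v. inverse (\<rho> (u y, snd y)) * (fst v + (- DR (u y, snd y) (0, 1)) * snd v))) (at y)"
    if y: "y \<in> V" for y
  proof -
    let ?g = "(u y, snd y)"
    have gQ: "?g \<in> Q" using gV(1)[OF y] gu[OF y] by simp
    define u' where "u' v = fst (g' y v)" for v
    have du: "(u has_derivative u') (at y)"
      unfolding u_def u'_def by (intro has_derivative_fst g(7) y)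
    have "((\<lambda>y. (u y, snd y)) has_derivative (\<lambda>v. (u' v, snd v))) (at y)"
      by (intro has_derivative_Pair du has_derivative_snd has_derivative_ident)
    from has_derivative_compose[OF this derR[OF gQ]]
    have "((\<lambda>y. R (u y, snd y)) has_derivative (\<lambda>v. DR ?g (u' v, snd v))) (at y)" .
    then have "(fst has_derivative (\<lambda>v. DR ?g (u' v, snd v))) (at y)"
      by (rule has_derivative_transform_within_open[OF _ g(4) y])
        (metis gV(2) gu \<Psi>_def fst_conv)
    from has_derivative_unique[OF this has_derivative_fst[OF has_derivative_ident]]
    have "DR ?g (u' v, snd v) = fst v" for v by (rule fun_cong)
    then have "u' v * \<rho> ?g + snd v * DR ?g (0, 1) = fst v" for v using DR[OF gQ, of "(u' v, snd v)"] by simp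
    then have "fst v = u' v * \<rho> ?g + DR ?g (0, 1) * snd v" for v by (metis mult.commute)
    then have "u' v = inverse (\<rho> ?g) * (fst v + (- DR ?g (0, 1)) * snd v)" for v
      using Q(4)[OF gQ] by (simp add: field_simps)
    then have "u' = (\<lambda>v. inverse (\<rho> ?g) * (fst v + (- DR ?g (0, 1)) * snd v))" by blast
    then show ?thesis using du by simp
  qed
  \<comment> \<open>Bootstrapping: the inverse function theorem gives differentiability only, but by
    \<open>deru\<close> the derivative is a smooth expression in \<open>u\<close>, so class
    \<open>k\<close> implies class \<open>Suc k\<close>.\<close>
  have "C_k_on k V u" for k
  proof (induction k)
    case 0
    show ?case using contu by simp
  next
    case (Suc k)
    have gC: "C_k_on k V (\<lambda>y. (u y, snd y))"
      by (intro C_k_on_Pair g(4) Suc.IH C_k_on_bounded_linear bounded_linear_snd)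
    have img: "(\<lambda>y. (u y, snd y)) ` V \<subseteq> Q" using gV(1) gu by force
    have \<rho>C: "C_k_on k Q \<rho>" using smooth by (intro C_k_on_subset[OF _ Q(3)]) (simp add: smooth_on_def)
    have sC: "C_k_on k Q (\<lambda>z. DR z (0, 1))" unfolding DR_def by (rule C_k_on_SucD(2)[OF RC])
    have c1: "C_k_on k V (\<lambda>y. inverse (\<rho> (u y, snd y)))"
    proof (rule C_k_on_compose[OF _ g(4) _ _ C_k_on_inverse])
      show "\<exists>B::real set. finite B \<and> span B = UNIV" using finite_Basis span_Basis by blast
      show "C_k_on k V (\<lambda>y. \<rho> (u y, snd y))" by (rule C_k_on_compose[OF fin g(4) Q(1) img \<rho>C gC])
      show "(\<lambda>y. \<rho> (u y, snd y)) ` V \<subseteq> - {0}" using img Q(4) by auto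
    qed auto
    have c2: "C_k_on k V (\<lambda>y. - DR (u y, snd y) (0, 1))"
      using C_k_on_mult[OF g(4) C_k_on_const[of k V "-1"] C_k_on_compose[OF fin g(4) Q(1) img sC gC]] by simp
    show ?case
      by (rule C_k_on_SucI[OF deru g(4)], assumption)
        (intro C_k_on_mult C_k_on_add g(4) c1 c2 C_k_on_const)
  qed
  then have sm: "smooth_on V u" by (simp add: smooth_on_def)
  have main: "(u z, snd z) \<in> P \<and> \<rho> (u z, snd z) * frechet_derivative u (at z) (1, 0) = 1" if z: "z \<in> V" for z
  proof -
    have gQ: "(u z, snd z) \<in> Q" using gV(1)[OF z] gu[OF z] by simp
    have "frechet_derivative u (at z) (1, 0) = inverse (\<rho> (u z, snd z))"
      using fun_cong[OF frechet_derivative_at[OF deru[OF z]], of "(1, 0)"] by simp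
    then show ?thesis using gQ Q(3) Q(4)[OF gQ] by auto
  qed
  have V0: "0 \<in> V" using g(5) \<Psi>0 by simp
  show ?thesis
    by (rule exI[of _ V], rule exI[of _ u], intro conjI ballI g(4) V0 sm u0 main[THEN conjunct1] main[THEN conjunct2])
qed

section \<open>Smooth maps and pullbacks in charts\<close>

text \<open>The topological part of \<open>smooth_manifold\<close>. Sheaves of tuples need no more
  of their base, and for the product of Y and M this is what gets verified.\<close>

definition atlas :: "('a, 'e::real_normed_vector, 'i, 'z) manifold_scheme \<Rightarrow> bool" where
  "atlas M \<longleftrightarrow> (\<Union>i\<in>charts M. cdom M i) = points M \<and>
     (\<forall>i\<in>charts M.
        openin (mtop M) (cdom M i) \<and> open (coord M i ` cdom M i) \<and>
        homeomorphic_map (subtopology (mtop M) (cdom M i))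
          (top_of_set (coord M i ` cdom M i)) (coord M i))"

definition finite_dim :: "('e::real_normed_vector) itself \<Rightarrow> bool" where
  "finite_dim _ \<longleftrightarrow> (\<exists>B::'e set. finite B \<and> span B = UNIV)"

lemma smooth_manifoldD:
  fixes M :: "('a, 'e::real_normed_vector, 'i, 'z) manifold_scheme"
  assumes "smooth_manifold M"
  shows "atlas M" "finite_dim TYPE('e)"
    "i \<in> charts M \<Longrightarrow> j \<in> charts M \<Longrightarrow>
      smooth_on (coord M i ` (cdom M i \<inter> cdom M j)) (coord M j \<circ> param M i)"
  using assms unfolding smooth_manifold_def atlas_def finite_dim_def by auto

lemma smooth_on_cong:
  assumes "open S" "\<And>x. x \<in> S \<Longrightarrow> f x = g x"
  shows "smooth_on S f \<longleftrightarrow> smooth_on S g"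
  unfolding smooth_on_def using C_k_on_cong[of S f g, OF assms] by blast

lemma smooth_on_subset: "smooth_on S f \<Longrightarrow> T \<subseteq> S \<Longrightarrow> smooth_on T f"
  unfolding smooth_on_def using C_k_on_subset by blast

lemma smooth_on_local:
  assumes "\<And>x. x \<in> S \<Longrightarrow> \<exists>T. open T \<and> x \<in> T \<and> smooth_on T f"
  shows "smooth_on S f"
  unfolding smooth_on_def
  by (intro allI C_k_on_local) (use assms smooth_on_def in blast)

lemma smooth_on_compose:
  fixes f :: "'f::real_normed_vector \<Rightarrow> 'h::real_normed_vector"
  assumes "finite_dim TYPE('f)" "open S" "open T" "g ` S \<subseteq> T" "smooth_on T f" "smooth_on S g"
  shows "smooth_on S (\<lambda>x. f (g x))"
proof -
  have "C_k_on k T f" "C_k_on k S g" for k using assms(5,6) by (simp_all add: smooth_on_def)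
  then have "C_k_on k S (\<lambda>x. f (g x))" for k
    using C_k_on_compose[OF assms(1)[unfolded finite_dim_def] assms(2-4), of k f] by blast
  then show ?thesis by (simp add: smooth_on_def)
qed

lemma smooth_on_has_derivative:
  assumes "smooth_on S f" "x \<in> S"
  shows "(f has_derivative frechet_derivative f (at x)) (at x)"
  using assms unfolding smooth_on_def by (intro C_k_on_SucD(1)[of 0 S]) auto

lemma frechet_derivative_cong_open:
  assumes "open S" "x \<in> S" "\<And>y. y \<in> S \<Longrightarrow> f y = g y"
  shows "frechet_derivative f (at x) = frechet_derivative g (at x)"
proof -
  have "(f has_derivative d) (at x) \<longleftrightarrow> (g has_derivative d) (at x)" for d
    using assms by (auto elim!: has_derivative_transform_within_open)
  then show ?thesis unfolding frechet_derivative_def by simp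
qed

section \<open>Charts as homeomorphisms onto open subsets of the model space\<close>

context
  fixes M :: "('a, 'e::real_normed_vector, 'i, 'z) manifold_scheme"
  assumes M: "atlas M"
begin

lemma points_chart: "p \<in> points M \<Longrightarrow> \<exists>i\<in>charts M. p \<in> cdom M i"
  using M unfolding atlas_def by blast

lemma openin_cdom: "i \<in> charts M \<Longrightarrow> openin (mtop M) (cdom M i)"
  using M unfolding atlas_def by blast

lemma cdom_points: "i \<in> charts M \<Longrightarrow> cdom M i \<subseteq> points M"
  using openin_cdom openin_subset by blast

lemma open_coord_cdom: "i \<in> charts M \<Longrightarrow> open (coord M i ` cdom M i)"
  using M unfolding atlas_def by blast

lemma coord_homeomorphic_map:
  "i \<in> charts M \<Longrightarrow> homeomorphic_map (subtopology (mtop M) (cdom M i))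
          (top_of_set (coord M i ` cdom M i)) (coord M i)"
  using M unfolding atlas_def by blast

lemma inj_on_coord: "i \<in> charts M \<Longrightarrow> inj_on (coord M i) (cdom M i)"
  using homeomorphic_imp_injective_map[OF coord_homeomorphic_map] cdom_points
  by (metis inf.absorb_iff2 topspace_subtopology)

lemma param_coord: "i \<in> charts M \<Longrightarrow> p \<in> cdom M i \<Longrightarrow> param M i (coord M i p) = p"
  by (simp add: param_def inv_into_f_f inj_on_coord)

lemma coord_param: "x \<in> coord M i ` cdom M i \<Longrightarrow> coord M i (param M i x) = x"
  by (simp add: param_def f_inv_into_f)

lemma param_in_cdom: "x \<in> coord M i ` cdom M i \<Longrightarrow> param M i x \<in> cdom M i"
  by (simp add: param_def inv_into_into)

lemma open_coord_image:
  assumes "i \<in> charts M" "openin (mtop M) U"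
  shows "open (coord M i ` (U \<inter> cdom M i))"
proof -
  have "openin (subtopology (mtop M) (cdom M i)) (U \<inter> cdom M i)"
    using assms(2) by (rule openin_subtopology_Int)
  then have "openin (top_of_set (coord M i ` cdom M i)) (coord M i ` (U \<inter> cdom M i))"
    using homeomorphic_imp_open_map[OF coord_homeomorphic_map[OF assms(1)]] by (simp add: open_map_def)
  then show ?thesis using open_coord_cdom[OF assms(1)] by (simp add: openin_open_eq)
qed

lemma openin_coord_vimage:
  assumes "i \<in> charts M" "open T"
  shows "openin (mtop M) {p \<in> cdom M i. coord M i p \<in> T}"
proof -
  have "openin (subtopology (mtop M) (cdom M i)) {p \<in> topspace (subtopology (mtop M) (cdom M i)). coord M i p \<in> T \<inter> coord M i ` cdom M i}"
    by (intro openin_continuous_map_preimage[OF homeomorphic_imp_continuous_map[OF coord_homeomorphic_map[OF assms(1)]]])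
       (use assms in \<open>auto simp: openin_open\<close>)
  moreover have "{p \<in> topspace (subtopology (mtop M) (cdom M i)). coord M i p \<in> T \<inter> coord M i ` cdom M i} = {p \<in> cdom M i. coord M i p \<in> T}"
    using cdom_points[OF assms(1)] by auto
  ultimately show ?thesis using openin_cdom[OF assms(1)] by (simp add: openin_open_subtopology)
qed

end

lemma openin_preimage:
  assumes "continuous_map (subtopology S U) T f" "openin S U" "openin T V"
  shows "openin S {p \<in> U. f p \<in> V}"
proof -
  have "openin (subtopology S U) {p \<in> topspace (subtopology S U). f p \<in> V}"
    by (rule openin_continuous_map_preimage[OF assms(1,3)])
  moreover have "{p \<in> topspace (subtopology S U). f p \<in> V} = {p \<in> U. f p \<in> V}"
    using openin_subset[OF assms(2)] by auto
  ultimately show ?thesis using assms(2) by (simp add: openin_open_subtopology)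
qed

lemma open_rep:
  assumes "atlas Y" "atlas X" "continuous_map (subtopology (mtop Y) U) (mtop X) f" "openin (mtop Y) U"
    "i \<in> charts Y" "j \<in> charts X"
  shows "open (coord Y i ` {p \<in> U \<inter> cdom Y i. f p \<in> cdom X j})"
proof -
  have "openin (mtop Y) {p \<in> U. f p \<in> cdom X j}"
    by (rule openin_preimage[OF assms(3,4) openin_cdom[OF assms(2,6)]])
  from open_coord_image[OF assms(1,5) this] show ?thesis
    by (simp add: Int_def conj_commute conj_left_commute)
qed

lemma smooth_mapD:
  assumes "smooth_map Y U X f"
  shows "continuous_map (subtopology (mtop Y) U) (mtop X) f"
    "i \<in> charts Y \<Longrightarrow> j \<in> charts X \<Longrightarrow>
      smooth_on (coord Y i ` {p \<in> U \<inter> cdom Y i. f p \<in> cdom X j}) (coord X j \<circ> f \<circ> param Y i)"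
  using assms unfolding smooth_map_def by auto

lemma smooth_map_in_points:
  assumes "smooth_map Y U X f" "openin (mtop Y) U" "p \<in> U" shows "f p \<in> points X"
  using smooth_mapD(1)[OF assms(1)] openin_subset[OF assms(2)] assms(3)
  by (auto simp: continuous_map_def)

lemma smooth_map_subset:
  assumes "smooth_map Y U X f" "V \<subseteq> U" shows "smooth_map Y V X f"
  unfolding smooth_map_def
proof (intro conjI ballI)
  show "continuous_map (subtopology (mtop Y) V) (mtop X) f"
    using continuous_map_from_subtopology_mono[OF smooth_mapD(1)[OF assms(1)] assms(2)] .
  show "smooth_on (coord Y i ` {p \<in> V \<inter> cdom Y i. f p \<in> cdom X j}) (coord X j \<circ> f \<circ> param Y i)"
    if "i \<in> charts Y" "j \<in> charts X" for i j
    by (rule smooth_on_subset[OF smooth_mapD(2)[OF assms(1) that]]) (use assms(2) in auto)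
qed

lemma has_differential:
  assumes "atlas Y" "atlas X" "smooth_map Y U X f" "i \<in> charts Y" "j \<in> charts X"
    "p \<in> U" "p \<in> cdom Y i" "f p \<in> cdom X j"
  shows "((coord X j \<circ> f \<circ> param Y i) has_derivative differential Y i X j f p) (at (coord Y i p))"
  unfolding differential_def
  by (rule smooth_on_has_derivative[OF smooth_mapD(2)[OF assms(3-5)]]) (use assms in auto)

lemma differential_cong:
  assumes "atlas Y" "i \<in> charts Y" "openin (mtop Y) U" "p \<in> U" "p \<in> cdom Y i" "\<And>q. q \<in> U \<Longrightarrow> f q = g q"
  shows "differential Y i X j f p = differential Y i X j g p"
  unfolding differential_def
proof (rule frechet_derivative_cong_open)
  show "open (coord Y i ` (U \<inter> cdom Y i))" by (rule open_coord_image[OF assms(1-3)])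
  show "coord Y i p \<in> coord Y i ` (U \<inter> cdom Y i)" using assms by auto
  show "(coord X j \<circ> f \<circ> param Y i) y = (coord X j \<circ> g \<circ> param Y i) y" if "y \<in> coord Y i ` (U \<inter> cdom Y i)" for y
    using that assms(6) by (auto simp: param_coord[OF assms(1,2)])
qed

lemma smooth_map_cong:
  assumes "atlas Y" "atlas X" "openin (mtop Y) U" "\<And>q. q \<in> U \<Longrightarrow> f q = g q" "smooth_map Y U X f"
  shows "smooth_map Y U X g"
  unfolding smooth_map_def
proof (intro conjI ballI)
  show "continuous_map (subtopology (mtop Y) U) (mtop X) g"
    by (rule continuous_map_eq[OF smooth_mapD(1)[OF assms(5)]]) (use assms(4) in auto)
next
  fix i j assume ij: "i \<in> charts Y" "j \<in> charts X"
  have eq: "{p \<in> U \<inter> cdom Y i. g p \<in> cdom X j} = {p \<in> U \<inter> cdom Y i. f p \<in> cdom X j}"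
    using assms(4) by auto
  show "smooth_on (coord Y i ` {p \<in> U \<inter> cdom Y i. g p \<in> cdom X j}) (coord X j \<circ> g \<circ> param Y i)"
    unfolding eq
  proof (rule smooth_on_cong[THEN iffD1, OF _ _ smooth_mapD(2)[OF assms(5) ij]])
    show "open (coord Y i ` {p \<in> U \<inter> cdom Y i. f p \<in> cdom X j})"
      by (rule open_rep[OF assms(1,2) smooth_mapD(1)[OF assms(5)] assms(3) ij])
    show "(coord X j \<circ> f \<circ> param Y i) x = (coord X j \<circ> g \<circ> param Y i) x"
      if "x \<in> coord Y i ` {p \<in> U \<inter> cdom Y i. f p \<in> cdom X j}" for x
      using that assms(4) by (auto simp: param_coord[OF assms(1) ij(1)])
  qed
qed

text \<open>Near each point the coordinate expressions are composed through a chart \<open>k\<close>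
  of the middle manifold. This chart depends on the point, hence the local criterion
  \<open>smooth_on_local\<close>.\<close>

lemma smooth_map_compose:
  fixes Z :: "('c, 'g::real_normed_vector, 'k, 'u) manifold_scheme"
  assumes Y: "atlas Y" and Z: "atlas Z" and X: "atlas X" and fin: "finite_dim TYPE('g)"
    and U: "openin (mtop Y) U" and V: "openin (mtop Z) V"
    and h: "smooth_map Y U Z h" and g: "smooth_map Z V X g" and im: "h ` U \<subseteq> V"
  shows "smooth_map Y U X (g \<circ> h)"
  unfolding smooth_map_def
proof (intro conjI ballI)
  have "continuous_map (subtopology (mtop Y) U) (subtopology (mtop Z) V) h"
    using smooth_mapD(1)[OF h] im by (auto simp: continuous_map_in_subtopology)
  then show cont: "continuous_map (subtopology (mtop Y) U) (mtop X) (g \<circ> h)"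
    using smooth_mapD(1)[OF g] continuous_map_compose by blast
  fix i j assume ij: "i \<in> charts Y" "j \<in> charts X"
  let ?S = "coord Y i ` {p \<in> U \<inter> cdom Y i. (g \<circ> h) p \<in> cdom X j}"
  show "smooth_on ?S (coord X j \<circ> (g \<circ> h) \<circ> param Y i)"
  proof (rule smooth_on_local)
    fix x assume "x \<in> ?S"
    then obtain p where p: "p \<in> U" "p \<in> cdom Y i" "g (h p) \<in> cdom X j" "x = coord Y i p" by auto
    have "h p \<in> points Z" by (rule smooth_map_in_points[OF h U p(1)])
    then obtain k where k: "k \<in> charts Z" "h p \<in> cdom Z k" using points_chart[OF Z] by blast
    define S1 where "S1 = coord Y i ` {p \<in> U \<inter> cdom Y i. h p \<in> cdom Z k}"
    define S2 where "S2 = coord Z k ` {q \<in> V \<inter> cdom Z k. g q \<in> cdom X j}"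
    have S1: "open S1" unfolding S1_def by (rule open_rep[OF Y Z smooth_mapD(1)[OF h] U ij(1) k(1)])
    have S2: "open S2" unfolding S2_def by (rule open_rep[OF Z X smooth_mapD(1)[OF g] V k(1) ij(2)])
    have S: "open ?S" by (rule open_rep[OF Y X cont U ij])
    define T where "T = S1 \<inter> ?S"
    have T: "open T" using S1 S by (simp add: T_def open_Int)
    have TD: "\<exists>q. y = coord Y i q \<and> q \<in> U \<and> q \<in> cdom Y i \<and> h q \<in> cdom Z k \<and> g (h q) \<in> cdom X j" if "y \<in> T" for y
      using that inj_onD[OF inj_on_coord[OF Y ij(1)]] unfolding T_def S1_def by fastforce
    have "smooth_on T (\<lambda>y. (coord X j \<circ> g \<circ> param Z k) ((coord Z k \<circ> h \<circ> param Y i) y))"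
    proof (rule smooth_on_compose[OF fin T S2])
      show "(coord Z k \<circ> h \<circ> param Y i) ` T \<subseteq> S2"
        using TD im unfolding S2_def by (fastforce simp: param_coord[OF Y ij(1)])
      show "smooth_on S2 (coord X j \<circ> g \<circ> param Z k)" unfolding S2_def by (rule smooth_mapD(2)[OF g k(1) ij(2)])
      show "smooth_on T (coord Z k \<circ> h \<circ> param Y i)"
        by (rule smooth_on_subset[OF smooth_mapD(2)[OF h ij(1) k(1)]]) (auto simp: T_def S1_def)
    qed
    then have "smooth_on T (coord X j \<circ> (g \<circ> h) \<circ> param Y i)"
      by (rule smooth_on_cong[THEN iffD1, OF T, rotated])
        (use TD in \<open>fastforce simp: param_coord[OF Y ij(1)] param_coord[OF Z k(1)]\<close>)
    moreover have "x \<in> T" using p k by (auto simp: T_def S1_def)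
    ultimately show "\<exists>T. open T \<and> x \<in> T \<and> smooth_on T (coord X j \<circ> (g \<circ> h) \<circ> param Y i)" using T by blast
  qed
qed

lemma differential_compose:
  assumes Y: "atlas Y" and Z: "atlas Z" and X: "atlas X"
    and U: "openin (mtop Y) U" and V: "openin (mtop Z) V"
    and h: "smooth_map Y U Z h" and g: "smooth_map Z V X g"
    and i: "i \<in> charts Y" and k: "k \<in> charts Z" and j: "j \<in> charts X"
    and p: "p \<in> U" "p \<in> cdom Y i" "h p \<in> V" "h p \<in> cdom Z k" "g (h p) \<in> cdom X j"
  shows "differential Y i X j (g \<circ> h) p v = differential Z k X j g (h p) (differential Y i Z k h p v)"
proof -
  define S1 where "S1 = coord Y i ` {p \<in> U \<inter> cdom Y i. h p \<in> cdom Z k}"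
  have S1: "open S1" unfolding S1_def by (rule open_rep[OF Y Z smooth_mapD(1)[OF h] U i k])
  have d1: "((coord Z k \<circ> h \<circ> param Y i) has_derivative differential Y i Z k h p) (at (coord Y i p))"
    by (rule has_differential[OF Y Z h i k p(1,2,4)])
  have "((coord X j \<circ> g \<circ> param Z k) has_derivative differential Z k X j g (h p)) (at (coord Z k (h p)))"
    by (rule has_differential[OF Z X g k j p(3-5)])
  then have d2: "((coord X j \<circ> g \<circ> param Z k) has_derivative differential Z k X j g (h p))
      (at ((coord Z k \<circ> h \<circ> param Y i) (coord Y i p)))"
    by (simp add: param_coord[OF Y i p(2)])
  have "((\<lambda>y. (coord X j \<circ> g \<circ> param Z k) ((coord Z k \<circ> h \<circ> param Y i) y)) has_derivative
      (\<lambda>v. differential Z k X j g (h p) (differential Y i Z k h p v))) (at (coord Y i p))"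
    by (rule has_derivative_compose[OF d1 d2])
  then have "((coord X j \<circ> (g \<circ> h) \<circ> param Y i) has_derivative
      (\<lambda>v. differential Z k X j g (h p) (differential Y i Z k h p v))) (at (coord Y i p))"
    by (rule has_derivative_transform_within_open[OF _ S1])
      (use p in \<open>auto simp: S1_def param_coord[OF Y i] param_coord[OF Z k]\<close>)
  from frechet_derivative_at[OF this] show ?thesis unfolding differential_def by metis
qed

lemma smooth_map_id:
  assumes "smooth_manifold M" shows "smooth_map M (points M) M (\<lambda>x. x)"
  unfolding smooth_map_def
proof (intro conjI ballI)
  show "continuous_map (subtopology (mtop M) (points M)) (mtop M) (\<lambda>x. x)" by simp
  fix i j assume ij: "i \<in> charts M" "j \<in> charts M"
  have "{p \<in> points M \<inter> cdom M i. p \<in> cdom M j} = cdom M i \<inter> cdom M j"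
    using cdom_points[OF smooth_manifoldD(1)[OF assms] ij(1)] by auto
  then show "smooth_on (coord M i ` {p \<in> points M \<inter> cdom M i. p \<in> cdom M j}) (coord M j \<circ> (\<lambda>x. x) \<circ> param M i)"
    using smooth_manifoldD(3)[OF assms ij] by (simp add: comp_def)
qed

text \<open>\<open>pullback\<close> picks its chart by \<open>SOME\<close>. The chain rule through
  the identity map of X passes to any other chart, and the overlap condition in
  \<open>two_form\<close> absorbs the transition differential.\<close>

lemma pullback_eq:
  assumes Y: "atlas Y" and X: "smooth_manifold X" and \<omega>: "two_form X \<omega>"
    and U: "openin (mtop Y) U" and f: "smooth_map Y U X f"
    and i: "i \<in> charts Y" and j: "j \<in> charts X" and p: "p \<in> U" "p \<in> cdom Y i" "f p \<in> cdom X j"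
  shows "pullback Y X f \<omega> i p v w = \<omega> j (f p) (differential Y i X j f p v) (differential Y i X j f p w)"
proof -
  note X' = smooth_manifoldD(1)[OF X]
  define k where "k = (SOME k. k \<in> charts X \<and> f p \<in> cdom X k)"
  have k: "k \<in> charts X" "f p \<in> cdom X k"
    using someI[of "\<lambda>k. k \<in> charts X \<and> f p \<in> cdom X k" j] j p(3) by (auto simp: k_def)
  have fp: "f p \<in> points X" using p(3) cdom_points[OF X' j] by auto
  have d: "differential Y i X j f p v = differential X k X j (\<lambda>x. x) (f p) (differential Y i X k f p v)" for v
    using differential_compose[OF Y X' X' U openin_topspace f smooth_map_id[OF X] i k(1) j p(1,2) fp k(2) p(3)]
    by (simp add: comp_def)
  have "pullback Y X f \<omega> i p v w = \<omega> k (f p) (differential Y i X k f p v) (differential Y i X k f p w)"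
    by (simp add: pullback_def k_def Let_def)
  also have "\<dots> = \<omega> j (f p) (differential Y i X j f p v) (differential Y i X j f p w)"
    using \<omega> k j p(3) unfolding two_form_def d by blast
  finally show ?thesis .
qed

lemma pullback_cong:
  assumes "atlas Y" "i \<in> charts Y" "openin (mtop Y) U" "p \<in> U" "p \<in> cdom Y i" "\<And>q. q \<in> U \<Longrightarrow> f q = g q"
  shows "pullback Y X f \<omega> i p v w = pullback Y X g \<omega> i p v w"
proof -
  have "differential Y i X j f p = differential Y i X j g p" for j by (rule differential_cong[OF assms])
  then show ?thesis using assms(4,6) by (simp add: pullback_def)
qed

text \<open>Read in one chart \<open>j\<close> of X on both sides, this is the chain rule.\<close>

lemma pullback_compose:
  assumes Y: "atlas Y" and Z: "atlas Z" and X: "smooth_manifold X" and \<omega>: "two_form X \<omega>"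
    and U: "openin (mtop Y) U" and V: "openin (mtop Z) V"
    and h: "smooth_map Y U Z h" and g: "smooth_map Z V X g" and gh: "smooth_map Y U X (g \<circ> h)"
    and i: "i \<in> charts Y" and k: "k \<in> charts Z"
    and p: "p \<in> U" "p \<in> cdom Y i" "h p \<in> V" "h p \<in> cdom Z k"
  shows "pullback Y X (g \<circ> h) \<omega> i p v w =
      pullback Z X g \<omega> k (h p) (differential Y i Z k h p v) (differential Y i Z k h p w)"
proof -
  note X' = smooth_manifoldD(1)[OF X]
  have "g (h p) \<in> points X" by (rule smooth_map_in_points[OF g V p(3)])
  then obtain j where j: "j \<in> charts X" "g (h p) \<in> cdom X j" using points_chart[OF X'] by blast
  have j': "(g \<circ> h) p \<in> cdom X j" using j by simp
  show ?thesis
    unfolding pullback_eq[OF Y X \<omega> U gh i j(1) p(1,2) j'] pullback_eq[OF Z X \<omega> V g k j(1) p(3,4) j(2)]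
    by (simp add: differential_compose[OF Y Z X' U V h g i k j(1) p j(2)])
qed

section \<open>Closed 2-forms as total pullbacks\<close>

text \<open>The model space as a manifold with one chart. Charts and parametrisations become smooth
  maps to and from it, so a map built in coordinates is a composition of smooth maps.\<close>

definition flat :: "('e::real_normed_vector, 'e, unit) manifold" where
  "flat = \<lparr>mtop = euclidean, charts = {()}, cdom = (\<lambda>_. UNIV), coord = (\<lambda>_ x. x)\<rparr>"

lemma flat_simps [simp]:
  "mtop flat = euclidean" "charts flat = {()}" "cdom flat i = UNIV" "coord flat i = (\<lambda>x. x)"
  by (simp_all add: flat_def)

lemma param_flat [simp]: "param flat i = (\<lambda>x. x)"
proof
  show "param flat i x = x" for x
    using f_inv_into_f[of x "\<lambda>x. x" UNIV] by (simp add: param_def)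
qed

lemma atlas_flat: "atlas flat"
  by (simp add: atlas_def homeomorphic_map_id[unfolded id_def])

lemma smooth_map_flat:
  assumes "smooth_on T G" shows "smooth_map flat T flat G"
proof -
  have "continuous_on T G" using assms C_k_on_imp_continuous_on unfolding smooth_on_def by blast
  then show ?thesis using assms by (simp add: smooth_map_def comp_def)
qed

lemma smooth_map_coord:
  assumes "smooth_manifold Y" "i \<in> charts Y"
  shows "smooth_map Y (cdom Y i) flat (coord Y i)"
  unfolding smooth_map_def
proof (intro conjI ballI)
  show "continuous_map (subtopology (mtop Y) (cdom Y i)) (mtop flat) (coord Y i)"
    using homeomorphic_imp_continuous_map[OF coord_homeomorphic_map[OF smooth_manifoldD(1)[OF assms(1)] assms(2)]]
    by (simp add: continuous_map_in_subtopology)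
  fix i' j assume "i' \<in> charts Y"
  moreover have "{p \<in> cdom Y i \<inter> cdom Y i'. coord Y i p \<in> cdom flat j} = cdom Y i' \<inter> cdom Y i" by auto
  ultimately show "smooth_on (coord Y i' ` {p \<in> cdom Y i \<inter> cdom Y i'. coord Y i p \<in> cdom flat j})
      (coord flat j \<circ> coord Y i \<circ> param Y i')"
    using smooth_manifoldD(3)[OF assms(1) _ assms(2)] by (simp add: comp_def)
qed

lemma smooth_map_param:
  assumes "smooth_manifold X" "j \<in> charts X"
  shows "smooth_map flat (coord X j ` cdom X j) X (param X j)"
  unfolding smooth_map_def
proof (intro conjI ballI)
  note X = smooth_manifoldD(1)[OF assms(1)]
  let ?S = "coord X j ` cdom X j"
  obtain g where g: "homeomorphic_maps (subtopology (mtop X) (cdom X j)) (top_of_set ?S) (coord X j) g"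
    using coord_homeomorphic_map[OF X assms(2)] by (auto simp: homeomorphic_map_maps)
  have top: "topspace (subtopology (mtop X) (cdom X j)) = cdom X j"
    using cdom_points[OF X assms(2)] by auto
  have "param X j x = g x" if "x \<in> ?S" for x
    using g that unfolding homeomorphic_maps_def top by (auto simp: param_coord[OF X assms(2)])
  then have "continuous_map (top_of_set ?S) (subtopology (mtop X) (cdom X j)) (param X j)"
    using g by (auto simp: homeomorphic_maps_def intro: continuous_map_eq)
  then show "continuous_map (subtopology (mtop flat) ?S) (mtop X) (param X j)"
    by (simp add: continuous_map_in_subtopology)
  fix i j' assume "j' \<in> charts X"
  moreover have "coord flat i ` {p \<in> ?S \<inter> cdom flat i. param X j p \<in> cdom X j'} = coord X j ` (cdom X j \<inter> cdom X j')"
    by (auto simp: param_coord[OF X assms(2)])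
  ultimately show "smooth_on (coord flat i ` {p \<in> ?S \<inter> cdom flat i. param X j p \<in> cdom X j'})
      (coord X j' \<circ> param X j \<circ> param flat i)"
    using smooth_manifoldD(3)[OF assms(1,2)] by (simp add: comp_def)
qed

text \<open>The map is \<open>coord Y i\<close>, then \<open>G\<close>, then
  \<open>param X j\<close>. Read in chart \<open>j\<close> the parametrisation has identity
  differential, so that only \<open>G\<close> and the change from chart \<open>i'\<close> to chart
  \<open>i\<close> are left.\<close>

lemma chart_map:
  fixes Y :: "('a, 'e::real_normed_vector, 'i, 'z) manifold_scheme"
    and X :: "('b, 'f::real_normed_vector, 'j, 'w) manifold_scheme"
  assumes Y: "smooth_manifold Y" and X: "smooth_manifold X" and \<omega>: "two_form X \<omega>"
    and i: "i \<in> charts Y" and j: "j \<in> charts X"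
    and T: "open T" and G: "smooth_on T G" "G ` T \<subseteq> coord X j ` cdom X j"
  defines "V \<equiv> {p \<in> cdom Y i. coord Y i p \<in> T}" and "\<psi> \<equiv> \<lambda>p. param X j (G (coord Y i p))"
  shows "smooth_map Y V X \<psi>"
    "i' \<in> charts Y \<Longrightarrow> p \<in> V \<Longrightarrow> p \<in> cdom Y i' \<Longrightarrow> pullback Y X \<psi> \<omega> i' p v w =
      \<omega> j (\<psi> p) (frechet_derivative G (at (coord Y i p)) (differential Y i' Y i (\<lambda>x. x) p v))
        (frechet_derivative G (at (coord Y i p)) (differential Y i' Y i (\<lambda>x. x) p w))"
proof -
  note Y' = smooth_manifoldD(1)[OF Y] and X' = smooth_manifoldD(1)[OF X]
  note finY = smooth_manifoldD(2)[OF Y] and finX = smooth_manifoldD(2)[OF X]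
  have V: "openin (mtop Y) V" unfolding V_def by (rule openin_coord_vimage[OF Y' i T])
  let ?S = "coord X j ` cdom X j"
  have S: "openin (mtop (flat :: ('f, 'f, unit) manifold)) ?S" using open_coord_cdom[OF X' j] by simp
  have T': "openin (mtop (flat :: ('e, 'e, unit) manifold)) T" using T by simp
  have s1: "smooth_map Y V flat (coord Y i)"
    by (rule smooth_map_subset[OF smooth_map_coord[OF Y i]]) (auto simp: V_def)
  have im1: "coord Y i ` V \<subseteq> T" by (auto simp: V_def)
  have s2: "smooth_map Y V flat (G \<circ> coord Y i)"
    by (rule smooth_map_compose[OF Y' atlas_flat atlas_flat finY V T' s1 smooth_map_flat[OF G(1)] im1])
  have im2: "(G \<circ> coord Y i) ` V \<subseteq> ?S" using im1 G(2) by auto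
  have s3: "smooth_map Y V X (param X j \<circ> (G \<circ> coord Y i))"
    by (rule smooth_map_compose[OF Y' atlas_flat X' finX V S s2 smooth_map_param[OF X j] im2])
  have \<psi>: "\<psi> = param X j \<circ> (G \<circ> coord Y i)" by (auto simp: \<psi>_def)
  show "smooth_map Y V X \<psi>" unfolding \<psi> by (rule s3)
  assume i': "i' \<in> charts Y" and p: "p \<in> V" "p \<in> cdom Y i'"
  have GS: "G (coord Y i p) \<in> ?S" using p(1) G(2) by (auto simp: V_def)
  have \<psi>p: "(param X j \<circ> (G \<circ> coord Y i)) p \<in> cdom X j" using param_in_cdom[OF X' GS] by simp
  have d3: "differential flat () X j (param X j) (G (coord Y i p)) v = v" for v
  proof -
    have "frechet_derivative (coord X j \<circ> param X j) (at (G (coord Y i p))) = frechet_derivative (\<lambda>x. x) (at (G (coord Y i p)))"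
      by (rule frechet_derivative_cong_open[OF open_coord_cdom[OF X' j] GS]) (simp add: coord_param[OF X'])
    then show ?thesis by (simp add: differential_def comp_def)
  qed
  have "differential Y i' X j (param X j \<circ> (G \<circ> coord Y i)) p v = differential Y i' flat () (G \<circ> coord Y i) p v" for v
    using differential_compose[OF Y' atlas_flat X' V S s2 smooth_map_param[OF X j] i' _ j p, of "()"] GS \<psi>p d3 by simp
  moreover have "differential Y i' flat () (G \<circ> coord Y i) p v =
      frechet_derivative G (at (coord Y i p)) (differential Y i' Y i (\<lambda>x. x) p v)" for v
    using differential_compose[OF Y' atlas_flat atlas_flat V T' s1 smooth_map_flat[OF G(1)] i' _ _ p, of "()" "()"] p im1
    by (simp add: differential_def comp_def image_subset_iff)
  ultimately show "pullback Y X \<psi> \<omega> i' p v w =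
      \<omega> j (\<psi> p) (frechet_derivative G (at (coord Y i p)) (differential Y i' Y i (\<lambda>x. x) p v))
        (frechet_derivative G (at (coord Y i p)) (differential Y i' Y i (\<lambda>x. x) p w))"
    unfolding \<psi> pullback_eq[OF Y' X \<omega> V s3 i' j p \<psi>p] by simp
qed

text \<open>Each summand \<open>dA\<^sub>c \<and> d\<xi>\<^sub>c\<close> of \<open>\<theta>\<close> is the pullback of \<open>\<omega>\<^sub>X\<close> along \<open>(A\<^sub>c, \<xi>\<^sub>c)\<close>, composed with an
  area-preserving map into the affine plane through \<open>q\<close> spanned by \<open>a\<close> and \<open>b\<close> in the chart \<open>j\<close>.\<close>

lemma local_tuple:
  fixes Y :: "('a, 'e::real_normed_vector, 'i) symplectic" and X :: "('b, 'f::real_normed_vector, 'j) symplectic"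
  assumes Y: "smooth_manifold Y" and \<theta>: "two_form Y \<theta>" "closed_form Y \<theta>"
    and X: "smooth_manifold X" and \<omega>: "two_form X (sform X)"
    and j: "j \<in> charts X" and q: "q \<in> cdom X j" and nz: "sform X j q a b \<noteq> 0"
    and p: "p \<in> points Y"
  shows "\<exists>V fs. openin (mtop Y) V \<and> p \<in> V \<and> fs \<in> tuples Y X \<theta> (size fs) V"
proof -
  note Y' = smooth_manifoldD(1)[OF Y] and X' = smooth_manifoldD(1)[OF X]
  note finY = smooth_manifoldD(2)[OF Y] and finX = smooth_manifoldD(2)[OF X]
  obtain B :: "'e set" where B: "fin_basis B"
    using fin_basis_exists finY unfolding finite_dim_def by blast
  then have finB: "finite B" by (simp add: fin_basis_def)
  have repr: "bounded_linear (\<lambda>v. representation B v c)" for c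
    by (rule bounded_linear_representation[OF B])
  obtain i where i: "i \<in> charts Y" "p \<in> cdom Y i" using points_chart[OF Y' p] by blast
  define S where "S = coord Y i ` cdom Y i"
  define x\<^sub>0 where "x\<^sub>0 = coord Y i p"
  have S: "open S" "x\<^sub>0 \<in> S" using open_coord_cdom[OF Y' i(1)] i(2) by (auto simp: S_def x\<^sub>0_def)
  have pS: "param Y i x \<in> cdom Y i" if "x \<in> S" for x
    using that param_in_cdom[OF Y'] by (simp add: S_def)
  have "\<exists>T A. open T \<and> x\<^sub>0 \<in> T \<and> T \<subseteq> S \<and> (\<forall>b. smooth_on T (A b) \<and> A b x\<^sub>0 = 0) \<and>
     (\<forall>x\<in>T. \<forall>v w. \<theta> i (param Y i x) v w = (\<Sum>b\<in>B. frechet_derivative (A b) (at x) v * representation B w b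
         - frechet_derivative (A b) (at x) w * representation B v b))"
  proof (rule poincare[OF B S])
    show "linear (\<lambda>v. \<theta> i (param Y i x) v w)" if "x \<in> S" for x w
      using \<theta>(1) i(1) pS[OF that] unfolding two_form_def by blast
    show "\<theta> i (param Y i x) w v = - \<theta> i (param Y i x) v w" if "x \<in> S" for x v w
      using \<theta>(1) i(1) pS[OF that] unfolding two_form_def by blast
    show "smooth_on S (\<lambda>x. \<theta> i (param Y i x) v w)" for v w
      using \<theta>(1) i(1) unfolding two_form_def S_def by blast
    show "frechet_derivative (\<lambda>x. \<theta> i (param Y i x) v w) (at x) u
      - frechet_derivative (\<lambda>x. \<theta> i (param Y i x) u w) (at x) v
      + frechet_derivative (\<lambda>x. \<theta> i (param Y i x) u v) (at x) w = 0" if "x \<in> S" for x u v w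
      using \<theta>(2) i(1) that unfolding closed_form_def S_def by blast
  qed
  then obtain T A where TA: "open T \<and> x\<^sub>0 \<in> T \<and> T \<subseteq> S \<and> (\<forall>b. smooth_on T (A b) \<and> A b x\<^sub>0 = 0) \<and>
     (\<forall>x\<in>T. \<forall>v w. \<theta> i (param Y i x) v w = (\<Sum>b\<in>B. frechet_derivative (A b) (at x) v * representation B w b
         - frechet_derivative (A b) (at x) w * representation B v b))"
    by (elim exE) (rule that)
  then have T: "open T" "x\<^sub>0 \<in> T" "T \<subseteq> S" and A: "\<And>b. smooth_on T (A b)" "\<And>b. A b x\<^sub>0 = 0" by blast+
  from TA have \<theta>A: "\<And>x v w. x \<in> T \<Longrightarrow> \<theta> i (param Y i x) v w = (\<Sum>b\<in>B. frechet_derivative (A b) (at x) v * representation B w b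
         - frechet_derivative (A b) (at x) w * representation B v b)" by blast
  define x\<^sub>1 where "x\<^sub>1 = coord X j q"
  \<comment> \<open>Affine parametrisation of the plane through \<open>q\<close>. The coefficient of
    \<open>sform X\<close> on it is its value on the pair \<open>a\<close>, \<open>b\<close>,
    nonzero at the origin by \<open>nz\<close>.\<close>
  define l where "l z = x\<^sub>1 + fst z *\<^sub>R a + snd z *\<^sub>R b" for z :: "real \<times> real"
  define SX where "SX = coord X j ` cdom X j"
  have SX: "open SX" using open_coord_cdom[OF X' j] by (simp add: SX_def)
  define P where "P = l -` SX"
  have "continuous_on UNIV l" unfolding l_def by (intro continuous_intros)
  then have P: "open P" unfolding P_def using SX by (simp add: open_vimage continuous_on_eq_continuous_within)
  have l0: "l 0 = x\<^sub>1" by (simp add: l_def)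
  then have P0: "0 \<in> P" using q by (simp add: P_def SX_def x\<^sub>1_def)
  have sl: "smooth_on P l"
    unfolding smooth_on_def l_def
    by (intro allI C_k_on_add C_k_on_scaleR C_k_on_const P C_k_on_bounded_linear bounded_linear_fst bounded_linear_snd)
  have s0: "smooth_on SX (\<lambda>x. sform X j (param X j x) a b)"
    using \<omega> j unfolding two_form_def SX_def by blast
  have "l ` P \<subseteq> SX" by (auto simp: P_def)
  from smooth_on_compose[OF finX P SX this s0 sl]
  have s\<rho>: "smooth_on P (\<lambda>z. sform X j (param X j (l z)) a b)" .
  have \<rho>0: "sform X j (param X j (l 0)) a b \<noteq> 0"
    using nz q j by (simp add: l0 x\<^sub>1_def param_coord[OF X'])
  obtain N :: "(real \<times> real) set" and u where N: "open N" "0 \<in> N" and u: "smooth_on N u" "u 0 = 0"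
    "\<And>z. z \<in> N \<Longrightarrow> (u z, snd z) \<in> P"
    "\<And>z. z \<in> N \<Longrightarrow> sform X j (param X j (l (u z, snd z))) a b * frechet_derivative u (at z) (1, 0) = 1"
    using planar_darboux[OF P P0 s\<rho> \<rho>0] by metis
  \<comment> \<open>Both components vanish at \<open>x\<^sub>0\<close>, so near this point
    \<open>Z c\<close> takes values in the domain \<open>N\<close> of \<open>u\<close>, which is
    known only as a neighbourhood of 0.\<close>
  define Z where "Z c x = (A c x, representation B (x - x\<^sub>0) c)" for c x
  have sZ: "smooth_on T (Z c)" for c
    unfolding smooth_on_def Z_def
    using A(1) by (intro allI C_k_on_Pair T(1) C_k_on_bounded_linear_comp[OF repr] C_k_on_diff_const) (simp add: smooth_on_def)
  have contZ: "continuous_on T (Z c)" for c using sZ C_k_on_imp_continuous_on unfolding smooth_on_def by blast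
  \<comment> \<open>The outer \<open>T\<close> matters for empty \<open>B\<close>, where the
    intersection is the whole space.\<close>
  define T' where "T' = T \<inter> (\<Inter>c\<in>B. T \<inter> Z c -` N)"
  have T': "open T'"
    unfolding T'_def using finB T(1) N(1) continuous_open_preimage[OF contZ T(1) N(1)]
    by (intro open_Int open_INT) auto
  have "Z c x\<^sub>0 = 0" for c
    using A(2) linear_0[OF bounded_linear.linear[OF repr]] by (simp add: Z_def zero_prod_def)
  then have x0T': "x\<^sub>0 \<in> T'" using T(2) N(2) by (simp add: T'_def)
  have T'T: "T' \<subseteq> T" and ZN: "\<And>c x. c \<in> B \<Longrightarrow> x \<in> T' \<Longrightarrow> Z c x \<in> N" unfolding T'_def by blast+
  define G where "G c x = x\<^sub>1 + u (Z c x) *\<^sub>R a + representation B (x - x\<^sub>0) c *\<^sub>R b" for c x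
  have Gl: "G c x = l (u (Z c x), snd (Z c x))" for c x by (simp add: G_def l_def Z_def)
  have fin2: "finite_dim TYPE(real \<times> real)" unfolding finite_dim_def using finite_Basis span_Basis by blast
  have sG: "smooth_on T' (G c)" if c: "c \<in> B" for c
  proof -
    have "smooth_on T' (\<lambda>x. u (Z c x))"
      by (rule smooth_on_compose[OF fin2 T' N(1) _ u(1) smooth_on_subset[OF sZ T'T]]) (use ZN[OF c] in auto)
    then show ?thesis
      unfolding smooth_on_def G_def
      by (intro allI C_k_on_add C_k_on_scaleR C_k_on_const T' C_k_on_bounded_linear_comp[OF repr] C_k_on_diff_const) simp
  qed
  have GS: "G c ` T' \<subseteq> coord X j ` cdom X j" if "c \<in> B" for c
    using u(3)[OF ZN[OF that]] by (auto simp: Gl P_def SX_def)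
  have key: "sform X j (param X j (G c x)) (frechet_derivative (G c) (at x) v) (frechet_derivative (G c) (at x) w)
      = frechet_derivative (A c) (at x) v * representation B w c - frechet_derivative (A c) (at x) w * representation B v c"
    if c: "c \<in> B" and x: "x \<in> T'" for c x v w
  proof -
    let ?\<xi> = "\<lambda>v. representation B v c" and ?DA = "frechet_derivative (A c) (at x)"
    let ?Du = "frechet_derivative u (at (Z c x))" and ?\<eta> = "sform X j (param X j (G c x))"
    have xT: "x \<in> T" using x T'T by auto
    have dA: "(A c has_derivative ?DA) (at x)" by (rule smooth_on_has_derivative[OF A(1) xT])
    have du: "(u has_derivative ?Du) (at (Z c x))" by (rule smooth_on_has_derivative[OF u(1) ZN[OF c x]])
    have d\<xi>: "((\<lambda>x. ?\<xi> (x - x\<^sub>0)) has_derivative ?\<xi>) (at x)"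
      by (rule bounded_linear.has_derivative[OF repr]) (auto intro!: derivative_eq_intros)
    have dZ: "(Z c has_derivative (\<lambda>v. (?DA v, ?\<xi> v))) (at x)"
      unfolding Z_def by (intro has_derivative_Pair dA d\<xi>)
    have duZ: "((\<lambda>x. u (Z c x)) has_derivative (\<lambda>v. ?Du (?DA v, ?\<xi> v))) (at x)"
      by (rule has_derivative_compose[OF dZ du])
    have "(G c has_derivative (\<lambda>v. ?Du (?DA v, ?\<xi> v) *\<^sub>R a + ?\<xi> v *\<^sub>R b)) (at x)"
      unfolding G_def using duZ d\<xi> by (auto intro!: derivative_eq_intros)
    from fun_cong[OF frechet_derivative_at[OF this]]
    have DG: "frechet_derivative (G c) (at x) v = ?Du (?DA v, ?\<xi> v) *\<^sub>R a + ?\<xi> v *\<^sub>R b" for v by (rule sym)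
    have linu: "linear ?Du" using du has_derivative_linear by blast
    have Du: "?Du (s, t) = s * ?Du (1, 0) + t * ?Du (0, 1)" for s t
    proof -
      have "?Du (s *\<^sub>R (1, 0) + t *\<^sub>R (0, 1)) = s * ?Du (1, 0) + t * ?Du (0, 1)"
        by (simp only: linear_add[OF linu] linear_scale[OF linu] real_scaleR_def)
      then show ?thesis by simp
    qed
    have "G c x \<in> coord X j ` cdom X j" using GS[OF c] x by auto
    then have pc: "param X j (G c x) \<in> cdom X j" by (rule param_in_cdom[OF X'])
    have lin1: "linear (\<lambda>v. ?\<eta> v w)" and anti: "?\<eta> w v = - ?\<eta> v w" for v w
      using \<omega> j pc unfolding two_form_def by blast+
    have e1: "?\<eta> (s *\<^sub>R a + t *\<^sub>R b) w = s * ?\<eta> a w + t * ?\<eta> b w" for s t w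
      using linear_add[OF lin1] linear_scale[OF lin1] by simp
    have "?\<eta> a a = 0" "?\<eta> b b = 0" "?\<eta> b a = - ?\<eta> a b" using anti[of a a] anti[of b b] anti[of b a] by simp_all
    moreover have "?\<eta> a (s *\<^sub>R a + t *\<^sub>R b) = s * ?\<eta> a a + t * ?\<eta> a b" for s t
      using e1[of s t a] anti[of a "s *\<^sub>R a + t *\<^sub>R b"] anti[of b a] anti[of a a] by simp
    moreover have "?\<eta> b (s *\<^sub>R a + t *\<^sub>R b) = s * ?\<eta> b a + t * ?\<eta> b b" for s t
      using e1[of s t b] anti[of b "s *\<^sub>R a + t *\<^sub>R b"] anti[of a b] anti[of b b] by simp
    ultimately have "?\<eta> (s *\<^sub>R a + t *\<^sub>R b) (s' *\<^sub>R a + t' *\<^sub>R b) = (s * t' - t * s') * ?\<eta> a b" for s t s' t'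
      by (simp add: e1 algebra_simps)
    then have "?\<eta> (frechet_derivative (G c) (at x) v) (frechet_derivative (G c) (at x) w)
      = (?Du (?DA v, ?\<xi> v) * ?\<xi> w - ?\<xi> v * ?Du (?DA w, ?\<xi> w)) * ?\<eta> a b"
      by (simp add: DG)
    \<comment> \<open>The partial derivative of \<open>u\<close> in direction (0, 1) cancels by
      antisymmetry. The remaining factor is 1 by the choice of \<open>u\<close>.\<close>
    also have "\<dots> = (?DA v * ?\<xi> w - ?DA w * ?\<xi> v) * (?\<eta> a b * ?Du (1, 0))"
      unfolding Du[of "?DA v"] Du[of "?DA w"] by (simp add: algebra_simps)
    also have "?\<eta> a b * ?Du (1, 0) = 1" using u(4)[OF ZN[OF c x]] by (simp add: Gl)
    finally show ?thesis by simp
  qed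
  define V where "V = {p \<in> cdom Y i. coord Y i p \<in> T'}"
  have V: "openin (mtop Y) V" unfolding V_def by (rule openin_coord_vimage[OF Y' i(1) T'])
  define \<psi> where "\<psi> c p = param X j (G c (coord Y i p))" for c p
  define fs where "fs = image_mset (\<lambda>c. restrict (\<psi> c) V) (mset_set B)"
  have s\<psi>: "smooth_map Y V X (\<psi> c)" if "c \<in> B" for c
    unfolding V_def \<psi>_def by (rule chart_map(1)[OF Y X \<omega> i(1) j T' sG[OF that] GS[OF that]])
  have "fs \<in> tuples Y X \<theta> (size fs) V"
    unfolding tuples_def
  proof (intro CollectI conjI ballI allI refl)
    fix f assume "f \<in># fs"
    then obtain c where c: "c \<in> B" "f = restrict (\<psi> c) V" using finB by (auto simp: fs_def)
    show "f \<in> extensional V" using c by simp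
    show "smooth_map Y V X f"
      using smooth_map_cong[OF Y' X' V _ s\<psi>[OF c(1)], of f] c(2) by simp
  next
    fix i' y v w assume i': "i' \<in> charts Y" and y: "y \<in> V \<inter> cdom Y i'"
    let ?D = "differential Y i' Y i (\<lambda>x. x) y"
    have yi: "y \<in> cdom Y i" "coord Y i y \<in> T'" using y by (auto simp: V_def)
    have "(\<Sum>f\<in>#fs. pullback Y X f (sform X) i' y v w) = (\<Sum>c\<in>B. pullback Y X (restrict (\<psi> c) V) (sform X) i' y v w)"
      by (simp add: fs_def image_mset.compositionality comp_def sum_unfold_sum_mset)
    also have "\<dots> = (\<Sum>c\<in>B. frechet_derivative (A c) (at (coord Y i y)) (?D v) * representation B (?D w) c
        - frechet_derivative (A c) (at (coord Y i y)) (?D w) * representation B (?D v) c)"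
    proof (rule sum.cong[OF refl])
      fix c assume c: "c \<in> B"
      have "pullback Y X (restrict (\<psi> c) V) (sform X) i' y v w = pullback Y X (\<psi> c) (sform X) i' y v w"
        using y by (intro pullback_cong[OF Y' i' V]) auto
      also have "\<dots> = sform X j (\<psi> c y) (frechet_derivative (G c) (at (coord Y i y)) (?D v))
         (frechet_derivative (G c) (at (coord Y i y)) (?D w))"
        unfolding \<psi>_def using y i' unfolding V_def
        by (intro chart_map(2)[OF Y X \<omega> i(1) j T' sG[OF c] GS[OF c]]) auto
      finally show "pullback Y X (restrict (\<psi> c) V) (sform X) i' y v w =
         frechet_derivative (A c) (at (coord Y i y)) (?D v) * representation B (?D w) c
        - frechet_derivative (A c) (at (coord Y i y)) (?D w) * representation B (?D v) c"
        using key[OF c yi(2)] by (simp add: \<psi>_def)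
    qed
    also have "\<dots> = \<theta> i (param Y i (coord Y i y)) (?D v) (?D w)" using \<theta>A[of "coord Y i y"] yi(2) T'T by auto
    also have "\<dots> = \<theta> i' y v w"
      using \<theta>(1) i(1) i' y yi(1) unfolding two_form_def param_coord[OF Y' i(1) yi(1)] by (metis IntD2 IntI)
    finally show "(\<Sum>f\<in>#fs. pullback Y X f (sform X) i' y v w) = \<theta> i' y v w" .
  qed
  moreover have "p \<in> V" using i(2) x0T' by (simp add: V_def x\<^sub>0_def)
  ultimately show ?thesis using V by blast
qed

section \<open>Presheaves and stable equivalence\<close>

text \<open>The record \<open>presheaf\<close> carries no laws; these are the two through which
  germs are compared.\<close>

definition presheaf_on :: "'a topology \<Rightarrow> ('a, 's) presheaf \<Rightarrow> bool" where
  "presheaf_on T P \<longleftrightarrow>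
     (\<forall>U V s. openin T U \<and> openin T V \<and> V \<subseteq> U \<and> s \<in> sections P U \<longrightarrow> res P V s \<in> sections P V) \<and>
     (\<forall>U V W s. openin T U \<and> openin T V \<and> openin T W \<and> V \<subseteq> U \<and> W \<subseteq> V \<and> s \<in> sections P U \<longrightarrow>
        res P W (res P V s) = res P W s)"

lemma presheaf_on_res:
  "presheaf_on T P \<Longrightarrow> openin T U \<Longrightarrow> openin T V \<Longrightarrow> V \<subseteq> U \<Longrightarrow> s \<in> sections P U \<Longrightarrow> res P V s \<in> sections P V"
  unfolding presheaf_on_def by blast

lemma presheaf_on_res_res:
  "presheaf_on T P \<Longrightarrow> openin T U \<Longrightarrow> openin T V \<Longrightarrow> openin T W \<Longrightarrow> V \<subseteq> U \<Longrightarrow> W \<subseteq> V \<Longrightarrow> s \<in> sections P U \<Longrightarrow>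
     res P W (res P V s) = res P W s"
  unfolding presheaf_on_def by blast

lemma germ_subset:
  assumes P: "presheaf_on T P" and o: "openin T U" "openin T V" "openin T W" and x: "x \<in> W" "W \<subseteq> U \<inter> V"
    and s: "s \<in> sections P U" and t: "t \<in> sections P V" and eq: "res P W s = res P W t"
  shows "germ T P U s x \<subseteq> germ T P V t x"
proof
  fix d assume "d \<in> germ T P U s x"
  then obtain V' r W' where d: "d = (V', r)" "openin T V'" "x \<in> V'" "r \<in> sections P V'"
    and W': "openin T W'" "x \<in> W'" "W' \<subseteq> U \<inter> V'" "res P W' s = res P W' r"
    unfolding germ_def by blast
  define W'' where "W'' = W \<inter> W'"
  have W'': "openin T W''" "x \<in> W''" "W'' \<subseteq> W" "W'' \<subseteq> W'" using o(3) W' x by (auto simp: W''_def)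
  have "res P W'' t = res P W'' (res P W t)"
    using presheaf_on_res_res[OF P o(2,3) W''(1) _ W''(3) t] x by simp
  also have "\<dots> = res P W'' s"
    using presheaf_on_res_res[OF P o(1,3) W''(1) _ W''(3) s] x eq by simp
  also have "\<dots> = res P W'' (res P W' s)"
    using presheaf_on_res_res[OF P o(1) W'(1) W''(1) _ W''(4) s] W'(3) by simp
  also have "\<dots> = res P W'' r"
    using presheaf_on_res_res[OF P d(2) W'(1) W''(1) _ W''(4) d(4)] W'(3,4) by simp
  finally have "res P W'' t = res P W'' r" .
  moreover have "W'' \<subseteq> V \<inter> V'" using W'' x W'(3) by blast
  ultimately show "d \<in> germ T P V t x" unfolding germ_def d(1) using d W'' by blast
qed

lemma germ_eqI:
  assumes "presheaf_on T P" "openin T U" "openin T V" "openin T W" "x \<in> W" "W \<subseteq> U \<inter> V"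
    "s \<in> sections P U" "t \<in> sections P V" "res P W s = res P W t"
  shows "germ T P U s x = germ T P V t x"
proof
  show "germ T P U s x \<subseteq> germ T P V t x" by (rule germ_subset[OF assms])
  show "germ T P V t x \<subseteq> germ T P U s x"
    by (rule germ_subset[OF assms(1,3,2,4,5) _ assms(8,7) assms(9)[symmetric]]) (use assms(6) in blast)
qed

lemma germ_res:
  assumes P: "presheaf_on T P" and o: "openin T U" "openin T V" "V \<subseteq> U" and x: "x \<in> V" and s: "s \<in> sections P U"
  shows "germ T P V (res P V s) x = germ T P U s x"
  by (rule germ_eqI[OF P o(2,1,2) x _ presheaf_on_res[OF P o s] s presheaf_on_res_res[OF P o(1,2,2,3) order_refl s]])
    (use o in auto)

lemma to_sheaf_section:
  assumes "openin T U" "s \<in> sections P U"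
  shows "to_sheaf T P U s \<in> sections (sheafify T P) U"
  using assms unfolding to_sheaf_def sheafify_def by fastforce

lemma sheafify_local:
  assumes "\<sigma> \<in> sections (sheafify T P) U" "x \<in> U"
  shows "\<exists>V s. openin T V \<and> x \<in> V \<and> V \<subseteq> U \<and> s \<in> sections P V \<and> (\<forall>z\<in>V. \<sigma> z = germ T P V s z)"
  using assms by (simp add: sheafify_def)

lemma sheafify_restrict:
  assumes P: "presheaf_on T P" and o: "openin T U" "openin T V" "V \<subseteq> U" and \<sigma>: "\<sigma> \<in> sections (sheafify T P) U"
  shows "restrict \<sigma> V \<in> sections (sheafify T P) V"
proof -
  have "\<exists>W s. openin T W \<and> x \<in> W \<and> W \<subseteq> V \<and> s \<in> sections P W \<and> (\<forall>z\<in>W. restrict \<sigma> V z = germ T P W s z)"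
    if x: "x \<in> V" for x
  proof -
    obtain W s where W: "openin T W" "x \<in> W" "W \<subseteq> U" "s \<in> sections P W" "\<And>z. z \<in> W \<Longrightarrow> \<sigma> z = germ T P W s z"
      using sheafify_local[OF \<sigma> subsetD[OF o(3) x]] by blast
    have oW: "openin T (W \<inter> V)" using W o by auto
    have "restrict \<sigma> V z = germ T P (W \<inter> V) (res P (W \<inter> V) s) z" if "z \<in> W \<inter> V" for z
      using W(5) germ_res[OF P W(1) oW _ that W(4)] that by simp
    then show ?thesis using presheaf_on_res[OF P W(1) oW _ W(4)] oW x W(2) by blast
  qed
  then show ?thesis unfolding sheafify_def by simp
qed

lemma restrict_to_sheaf:
  assumes P: "presheaf_on T P" and o: "openin T U" "openin T V" "V \<subseteq> U" and s: "s \<in> sections P U"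
  shows "restrict (to_sheaf T P U s) V = to_sheaf T P V (res P V s)"
proof
  fix x show "restrict (to_sheaf T P U s) V x = to_sheaf T P V (res P V s) x"
    using germ_res[OF P o _ s, of x] o(3) by (auto simp: to_sheaf_def)
qed

text \<open>The condition under which \<open>quotient_presheaf\<close> is well defined. It is
  verified for \<open>same_values\<close> and for \<open>stable_equiv\<close>.\<close>

definition compatible :: "'a topology \<Rightarrow> ('a, 's) presheaf \<Rightarrow> ('a set \<Rightarrow> ('s \<times> 's) set) \<Rightarrow> bool" where
  "compatible T P R \<longleftrightarrow> (\<forall>U. openin T U \<longrightarrow> equiv (sections P U) (R U)) \<and>
     (\<forall>U V s t. openin T U \<and> openin T V \<and> V \<subseteq> U \<and> (s, t) \<in> R U \<longrightarrow> (res P V s, res P V t) \<in> R V)"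

text \<open>All members of a class restrict into a single class, so the image under
  \<open>R V\<close> collapses to that class.\<close>

lemma quotient_res:
  assumes C: "compatible T P R" and o: "openin T U" "openin T V" "V \<subseteq> U" and s: "s \<in> sections P U"
  shows "res (quotient_presheaf R P) V (R U `` {s}) = R V `` {res P V s}"
proof -
  have eU: "equiv (sections P U) (R U)" and eV: "equiv (sections P V) (R V)"
    using C o unfolding compatible_def by blast+
  have "R V `` {res P V t} = R V `` {res P V s}" if "(s, t) \<in> R U" for t
  proof -
    have "(res P V s, res P V t) \<in> R V" using C o that unfolding compatible_def by blast
    then show ?thesis using equiv_class_eq[OF eV] by metis
  qed
  moreover have "(s, s) \<in> R U" using eU s unfolding equiv_def refl_on_def by blast
  ultimately have "(\<Union>t\<in>R U `` {s}. R V `` {res P V t}) = R V `` {res P V s}" by blast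
  moreover have "R V `` (res P V ` (R U `` {s})) = (\<Union>t\<in>R U `` {s}. R V `` {res P V t})" by blast
  ultimately show ?thesis by (simp add: quotient_presheaf_def)
qed

lemma presheaf_on_quotient:
  assumes P: "presheaf_on T P" and C: "compatible T P R"
  shows "presheaf_on T (quotient_presheaf R P)"
  unfolding presheaf_on_def
proof (intro conjI allI impI; elim conjE)
  fix U V c assume o: "openin T U" "openin T V" "V \<subseteq> U" and c: "c \<in> sections (quotient_presheaf R P) U"
  then obtain s where s: "s \<in> sections P U" "c = R U `` {s}"
    unfolding quotient_presheaf_def by (auto elim: quotientE)
  show "res (quotient_presheaf R P) V c \<in> sections (quotient_presheaf R P) V"
    using quotient_res[OF C o s(1)] presheaf_on_res[OF P o s(1)] s(2)
    by (simp add: quotient_presheaf_def quotientI)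
next
  fix U V W c assume o: "openin T U" "openin T V" "openin T W" "V \<subseteq> U" "W \<subseteq> V"
    and c: "c \<in> sections (quotient_presheaf R P) U"
  then obtain s where s: "s \<in> sections P U" "c = R U `` {s}"
    unfolding quotient_presheaf_def by (auto elim: quotientE)
  have "W \<subseteq> U" using o by auto
  then show "res (quotient_presheaf R P) W (res (quotient_presheaf R P) V c) = res (quotient_presheaf R P) W c"
    using quotient_res[OF C o(1,2,4) s(1)] quotient_res[OF C o(2,3,5) presheaf_on_res[OF P o(1,2,4) s(1)]]
      quotient_res[OF C o(1,3) _ s(1)] presheaf_on_res_res[OF P o s(1)] s(2) by simp
qed

section \<open>Tuples of maps, the correspondences they define, and their restrictions\<close>

lemma tuplesD:
  assumes "fs \<in> tuples Y X \<theta> n U"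
  shows "size fs = n" "f \<in># fs \<Longrightarrow> f \<in> extensional U" "f \<in># fs \<Longrightarrow> smooth_map Y U X f"
    "i \<in> charts Y \<Longrightarrow> y \<in> U \<Longrightarrow> y \<in> cdom Y i \<Longrightarrow> (\<Sum>f\<in>#fs. pullback Y X f (sform X) i y v w) = \<theta> i y v w"
  using assms unfolding tuples_def by auto

lemma tuples_add:
  assumes "fs \<in> tuples Y X \<theta>\<^sub>1 n U" "gs \<in> tuples Y X \<theta>\<^sub>2 m U"
    "\<And>i y v w. i \<in> charts Y \<Longrightarrow> y \<in> U \<Longrightarrow> y \<in> cdom Y i \<Longrightarrow> \<theta> i y v w = \<theta>\<^sub>1 i y v w + \<theta>\<^sub>2 i y v w"
  shows "fs + gs \<in> tuples Y X \<theta> (n + m) U"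
  using assms unfolding tuples_def by auto

lemma tuples_restrict:
  assumes Y: "atlas Y" and X: "atlas X" and o: "openin (mtop Y) V" "V \<subseteq> U"
    and fs: "fs \<in> tuples Y X \<theta> n U"
  shows "image_mset (\<lambda>f. restrict f V) fs \<in> tuples Y X \<theta> n V"
proof -
  have sm: "smooth_map Y V X (restrict f V)" if "f \<in># fs" for f
    by (rule smooth_map_cong[OF Y X o(1) _ smooth_map_subset[OF tuplesD(3)[OF fs that] o(2)]]) simp
  have "(\<Sum>f\<in>#fs. pullback Y X (restrict f V) (sform X) i y v w) = \<theta> i y v w"
    if "i \<in> charts Y" "y \<in> V" "y \<in> cdom Y i" for i y v w
  proof -
    have "pullback Y X (restrict f V) (sform X) i y v w = pullback Y X f (sform X) i y v w" for f
      by (rule pullback_cong[OF Y that(1) o(1) that(2,3)]) simp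
    then show ?thesis using tuplesD(4)[OF fs that(1) _ that(3)] that(2) o(2) by auto
  qed
  then show ?thesis
    using sm tuplesD(1)[OF fs] unfolding tuples_def by (auto simp: image_mset.compositionality comp_def)
qed

text \<open>The presheaf section behind \<open>cor_of_tuple\<close>, before passing to
  germs.\<close>

definition tuple_class ::
  "('a, 'e::real_normed_vector, 'i) symplectic \<Rightarrow> ('b, 'f::real_normed_vector, 'j) symplectic \<Rightarrow>
   'a set \<Rightarrow> ('a, 'b) tuple \<Rightarrow> (nat \<times> ('a, 'b) cor_n) set" where
  "tuple_class Y X U fs = stable_equiv Y X U `` {(size fs, cor_n_of_tuple Y X (sform Y) (size fs) U fs)}"

text \<open>Neither agreement on overlaps nor a common length is asked. The form is a parameter
  because both \<omega> and -\<omega> occur.\<close>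

definition locally_represented ::
  "('a, 'e::real_normed_vector, 'i) symplectic \<Rightarrow> ('b, 'f::real_normed_vector, 'j) symplectic \<Rightarrow>
   ('a, 'e, 'i) form2 \<Rightarrow> bool" where
  "locally_represented Y X \<theta> \<longleftrightarrow>
     (\<forall>y\<in>points Y. \<exists>V fs. openin (mtop Y) V \<and> y \<in> V \<and> fs \<in> tuples Y X \<theta> (size fs) V)"

context
  fixes Y :: "('a, 'e::real_normed_vector, 'i) symplectic" and X :: "('b, 'f::real_normed_vector, 'j) symplectic"
  assumes Y: "atlas Y" and X: "atlas X"
begin

lemma presheaf_on_tuple: "presheaf_on (mtop Y) (tuple_presheaf Y X \<theta> n)"
  unfolding presheaf_on_def tuple_presheaf_def
  by (auto simp: tuples_restrict[OF Y X] image_mset.compositionality comp_def Int_absorb1 Int_absorb2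
      intro!: image_mset_cong)

lemma compatible_same_values:
  "compatible (mtop Y) (tuple_presheaf Y X \<theta> n) (same_values Y X \<theta> n)"
  unfolding compatible_def
proof (intro conjI allI impI; (elim conjE)?)
  show "equiv (sections (tuple_presheaf Y X \<theta> n) U) (same_values Y X \<theta> n U)" for U
    by (auto simp: tuple_presheaf_def same_values_def equiv_def refl_on_def sym_def trans_def)
  fix U V fs gs assume o: "openin (mtop Y) U" "openin (mtop Y) V" "V \<subseteq> U" and fg: "(fs, gs) \<in> same_values Y X \<theta> n U"
  have r: "image_mset (\<lambda>f. f y) (image_mset (\<lambda>f. restrict f V) hs) = image_mset (\<lambda>f. f y) hs" if "y \<in> V"
    for y and hs :: "('a \<Rightarrow> 'b) multiset"
    using that by (simp add: image_mset.compositionality comp_def)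
  show "(res (tuple_presheaf Y X \<theta> n) V fs, res (tuple_presheaf Y X \<theta> n) V gs) \<in> same_values Y X \<theta> n V"
    using fg tuples_restrict[OF Y X o(2,3)] o(3) r unfolding same_values_def tuple_presheaf_def by auto
qed

lemma presheaf_on_cor_n: "presheaf_on (mtop Y) (cor_n_presheaf Y X \<theta> n)"
  unfolding cor_n_presheaf_def by (rule presheaf_on_quotient[OF presheaf_on_tuple compatible_same_values])

lemma same_values_section:
  "fs \<in> tuples Y X \<theta> n U \<Longrightarrow> same_values Y X \<theta> n U `` {fs} \<in> sections (cor_n_presheaf Y X \<theta> n) U"
  by (simp add: cor_n_presheaf_def quotient_presheaf_def tuple_presheaf_def quotientI)

lemma cor_n_of_tuple_in:
  "openin (mtop Y) U \<Longrightarrow> fs \<in> tuples Y X \<theta> n U \<Longrightarrow> cor_n_of_tuple Y X \<theta> n U fs \<in> cor_n Y X \<theta> n U"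
  unfolding cor_n_of_tuple_def cor_n_def by (intro to_sheaf_section same_values_section)

lemma restrict_cor_n_of_tuple:
  assumes o: "openin (mtop Y) U" "openin (mtop Y) V" "V \<subseteq> U" and fs: "fs \<in> tuples Y X \<theta> n U"
  shows "restrict (cor_n_of_tuple Y X \<theta> n U fs) V = cor_n_of_tuple Y X \<theta> n V (image_mset (\<lambda>f. restrict f V) fs)"
proof -
  have "fs \<in> sections (tuple_presheaf Y X \<theta> n) U" using fs by (simp add: tuple_presheaf_def)
  from quotient_res[OF compatible_same_values o this]
  have "res (cor_n_presheaf Y X \<theta> n) V (same_values Y X \<theta> n U `` {fs})
      = same_values Y X \<theta> n V `` {image_mset (\<lambda>f. restrict f V) fs}"
    by (simp add: cor_n_presheaf_def tuple_presheaf_def)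
  then show ?thesis
    using restrict_to_sheaf[OF presheaf_on_cor_n o same_values_section[OF fs]]
    by (simp add: cor_n_of_tuple_def)
qed

lemma cor_n_restrict:
  "openin (mtop Y) U \<Longrightarrow> openin (mtop Y) V \<Longrightarrow> V \<subseteq> U \<Longrightarrow> F \<in> cor_n Y X \<theta> n U \<Longrightarrow> restrict F V \<in> cor_n Y X \<theta> n V"
  unfolding cor_n_def by (rule sheafify_restrict[OF presheaf_on_cor_n])

lemma presheaf_on_coprod: "presheaf_on (mtop Y) (coprod_presheaf Y X)"
  unfolding presheaf_on_def coprod_presheaf_def
  by (auto simp: SCor_n_def cor_n_restrict Int_absorb1 Int_absorb2)

lemma is_concat_restrict:
  assumes o: "openin (mtop Y) U" "openin (mtop Y) V" "V \<subseteq> U" and c: "is_concat Y X U n m F G K"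
  shows "is_concat Y X V n m (restrict F V) (restrict G V) (restrict K V)"
  unfolding is_concat_def
proof
  fix y assume y: "y \<in> V"
  obtain W fs gs where W: "openin (mtop Y) W" "y \<in> W" "W \<subseteq> U"
    and fs: "fs \<in> tuples Y X (sform Y) n W" and gs: "gs \<in> tuples Y X zero_form m W"
    and F: "restrict F W = cor_n_of_tuple Y X (sform Y) n W fs"
    and G: "restrict G W = cor_n_of_tuple Y X zero_form m W gs"
    and K: "restrict K W = cor_n_of_tuple Y X (sform Y) (n + m) W (fs + gs)"
    using c y o(3) unfolding is_concat_def by (meson subsetD)
  have fg: "fs + gs \<in> tuples Y X (sform Y) (n + m) W"
    by (rule tuples_add[OF fs gs]) (simp add: zero_form_def)
  define W' where "W' = W \<inter> V"
  have W': "openin (mtop Y) W'" "y \<in> W'" "W' \<subseteq> V" "W' \<subseteq> W" using W o y by (auto simp: W'_def)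
  let ?r = "image_mset (\<lambda>f. restrict f W')"
  have rr: "restrict (restrict L V) W' = restrict (restrict L W) W'" for L :: "('a, 'b) cor_n"
    using W'(3,4) by (simp add: Int_absorb1)
  show "\<exists>W fs gs. openin (mtop Y) W \<and> y \<in> W \<and> W \<subseteq> V \<and>
        fs \<in> tuples Y X (sform Y) n W \<and> gs \<in> tuples Y X zero_form m W \<and>
        restrict (restrict F V) W = cor_n_of_tuple Y X (sform Y) n W fs \<and>
        restrict (restrict G V) W = cor_n_of_tuple Y X zero_form m W gs \<and>
        restrict (restrict K V) W = cor_n_of_tuple Y X (sform Y) (n + m) W (fs + gs)"
    by (rule exI[of _ W'], rule exI[of _ "?r fs"], rule exI[of _ "?r gs"])
      (use restrict_cor_n_of_tuple[OF W(1) W'(1,4) fs] restrict_cor_n_of_tuple[OF W(1) W'(1,4) gs]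
        restrict_cor_n_of_tuple[OF W(1) W'(1,4) fg] tuples_restrict[OF Y X W'(1,4) fs]
        tuples_restrict[OF Y X W'(1,4) gs] W' in \<open>simp add: rr F G K del: restrict_restrict\<close>)
qed

lemma add_isotropic_restrict:
  assumes o: "openin (mtop Y) U" "openin (mtop Y) V" "V \<subseteq> U" and a: "add_isotropic Y X U A B"
  shows "add_isotropic Y X V (res (coprod_presheaf Y X) V A) (res (coprod_presheaf Y X) V B)"
proof -
  obtain n m F G K where *: "A = (n, F)" "B = (n + m, K)" "F \<in> SCor_n Y X n U" "G \<in> SCor0_n Y X m U"
    "K \<in> SCor_n Y X (n + m) U" "is_concat Y X U n m F G K"
    using a unfolding add_isotropic_def by blast
  show ?thesis
    unfolding add_isotropic_def *(1,2)
    using * is_concat_restrict[OF o *(6)] cor_n_restrict[OF o]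
    by (intro exI[of _ n] exI[of _ m] exI[of _ "restrict F V"] exI[of _ "restrict G V"] exI[of _ "restrict K V"])
      (simp add: coprod_presheaf_def SCor_n_def SCor0_n_def)
qed

text \<open>A single \<open>add_isotropic\<close> step restricts to such a step, so a chain of steps
  in either direction restricts link by link.\<close>

lemma compatible_stable_equiv: "compatible (mtop Y) (coprod_presheaf Y X) (stable_equiv Y X)"
  unfolding compatible_def
proof (intro conjI allI impI; (elim conjE)?)
  show "equiv (sections (coprod_presheaf Y X) U) (stable_equiv Y X U)" for U
  proof (rule equivI)
    show "stable_equiv Y X U \<subseteq> sections (coprod_presheaf Y X) U \<times> sections (coprod_presheaf Y X) U"
      by (auto simp: stable_equiv_def)
    show "refl_on (sections (coprod_presheaf Y X) U) (stable_equiv Y X U)"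
      by (auto simp: stable_equiv_def refl_on_def)
    show "sym (stable_equiv Y X U)"
      by (auto simp: stable_equiv_def sym_def intro: equivclp_sym)
    show "trans (stable_equiv Y X U)"
      unfolding stable_equiv_def trans_def by (blast intro: equivclp_trans)
  qed
  fix U V A B assume o: "openin (mtop Y) U" "openin (mtop Y) V" "V \<subseteq> U" and AB: "(A, B) \<in> stable_equiv Y X U"
  let ?r = "res (coprod_presheaf Y X) V"
  have "equivclp (add_isotropic Y X U) A B" using AB by (simp add: stable_equiv_def)
  then have "equivclp (add_isotropic Y X V) (?r A) (?r B)"
  proof (induction rule: equivclp_induct)
    case base
    show ?case by simp
  next
    case (step B C)
    have "equivclp (add_isotropic Y X V) (?r B) (?r C)"
      using step(2) add_isotropic_restrict[OF o] by (metis equivclp_sym r_into_equivclp)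
    with step(3) show ?case by (rule equivclp_trans)
  qed
  then show "(?r A, ?r B) \<in> stable_equiv Y X V"
    using AB presheaf_on_res[OF presheaf_on_coprod o] by (simp add: stable_equiv_def)
qed

lemma presheaf_on_cor: "presheaf_on (mtop Y) (cor_presheaf Y X)"
  unfolding cor_presheaf_def by (rule presheaf_on_quotient[OF presheaf_on_coprod compatible_stable_equiv])

lemma coprod_section:
  "openin (mtop Y) U \<Longrightarrow> fs \<in> tuples Y X (sform Y) n U \<Longrightarrow>
    (n, cor_n_of_tuple Y X (sform Y) n U fs) \<in> sections (coprod_presheaf Y X) U"
  by (simp add: coprod_presheaf_def SCor_n_def cor_n_of_tuple_in)

lemma tuple_class_section:
  assumes "openin (mtop Y) U" "fs \<in> tuples Y X (sform Y) n U"
  shows "tuple_class Y X U fs \<in> sections (cor_presheaf Y X) U"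
  using coprod_section[OF assms] tuplesD(1)[OF assms(2)]
  by (simp add: cor_presheaf_def quotient_presheaf_def tuple_class_def quotientI)

lemma res_tuple_class:
  assumes o: "openin (mtop Y) U" "openin (mtop Y) V" "V \<subseteq> U" and fs: "fs \<in> tuples Y X (sform Y) n U"
  shows "res (cor_presheaf Y X) V (tuple_class Y X U fs) = tuple_class Y X V (image_mset (\<lambda>f. restrict f V) fs)"
  using quotient_res[OF compatible_stable_equiv o coprod_section[OF o(1) fs]]
    restrict_cor_n_of_tuple[OF o fs] tuplesD(1)[OF fs]
  by (simp add: cor_presheaf_def tuple_class_def coprod_presheaf_def)

lemma cor_of_tuple_in_SCor:
  assumes "fs \<in> tuples Y X (sform Y) n (points Y)"
  shows "cor_of_tuple Y X (points Y) fs \<in> SCor Y X"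
  using to_sheaf_section[OF openin_topspace tuple_class_section[OF openin_topspace assms]]
  by (simp add: SCor_def cor_of_tuple_def tuple_class_def)

text \<open>Two sheafifications are unwound: near y the germs come from the class of some
  \<open>(n, F)\<close>, and \<open>F\<close> in turn comes from a tuple on a smaller
  \<open>V\<close>. Restricting the class to \<open>V\<close> turns it into
  \<open>tuple_class\<close>.\<close>

lemma SCor_local:
  assumes \<sigma>: "\<sigma> \<in> SCor Y X" and y: "y \<in> points Y"
  shows "\<exists>V fs. openin (mtop Y) V \<and> y \<in> V \<and> fs \<in> tuples Y X (sform Y) (size fs) V \<and>
    (\<forall>z\<in>V. \<sigma> z = germ (mtop Y) (cor_presheaf Y X) V (tuple_class Y X V fs) z)"
proof -
  let ?P = "cor_presheaf Y X"
  obtain U s where U: "openin (mtop Y) U" "y \<in> U" and s: "s \<in> sections ?P U"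
    and \<sigma>s: "\<And>z. z \<in> U \<Longrightarrow> \<sigma> z = germ (mtop Y) ?P U s z"
    using sheafify_local[OF \<sigma>[unfolded SCor_def] y] by blast
  obtain n F where F: "F \<in> SCor_n Y X n U" "s = stable_equiv Y X U `` {(n, F)}"
    using s unfolding cor_presheaf_def quotient_presheaf_def coprod_presheaf_def by (auto elim!: quotientE)
  obtain V c where V: "openin (mtop Y) V" "y \<in> V" "V \<subseteq> U" and c: "c \<in> sections (cor_n_presheaf Y X (sform Y) n) V"
    and Fc: "\<And>z. z \<in> V \<Longrightarrow> F z = germ (mtop Y) (cor_n_presheaf Y X (sform Y) n) V c z"
    using sheafify_local[OF F(1)[unfolded SCor_n_def cor_n_def] U(2)] by blast
  obtain fs where fs: "fs \<in> tuples Y X (sform Y) n V" "c = same_values Y X (sform Y) n V `` {fs}"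
    using c unfolding cor_n_presheaf_def quotient_presheaf_def tuple_presheaf_def by (auto elim!: quotientE)
  have FV: "restrict F V = cor_n_of_tuple Y X (sform Y) n V fs"
    using Fc unfolding cor_n_of_tuple_def to_sheaf_def fs(2) by (intro restrict_ext) simp
  have "(n, F) \<in> sections (coprod_presheaf Y X) U" using F(1) by (simp add: coprod_presheaf_def)
  from quotient_res[OF compatible_stable_equiv U(1) V(1,3) this]
  have "res ?P V s = tuple_class Y X V fs"
    using FV tuplesD(1)[OF fs(1)] F(2) by (simp add: cor_presheaf_def coprod_presheaf_def tuple_class_def)
  then have "\<sigma> z = germ (mtop Y) ?P V (tuple_class Y X V fs) z" if "z \<in> V" for z
    using germ_res[OF presheaf_on_cor U(1) V(1,3) that s] \<sigma>s V(3) that by auto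
  then show ?thesis using V fs(1) tuplesD(1)[OF fs(1)] by blast
qed

lemma add_isotropic_tuple:
  assumes U: "openin (mtop Y) U" and fs: "fs \<in> tuples Y X (sform Y) n U" and gs: "gs \<in> tuples Y X zero_form m U"
  shows "add_isotropic Y X U (n, cor_n_of_tuple Y X (sform Y) n U fs)
    (n + m, cor_n_of_tuple Y X (sform Y) (n + m) U (fs + gs))"
proof -
  have fg: "fs + gs \<in> tuples Y X (sform Y) (n + m) U"
    by (rule tuples_add[OF fs gs]) (simp add: zero_form_def)
  have r: "restrict (cor_n_of_tuple Y X \<theta> k U hs) U = cor_n_of_tuple Y X \<theta> k U hs" for \<theta> k hs
    by (simp add: cor_n_of_tuple_def to_sheaf_def)
  have "is_concat Y X U n m (cor_n_of_tuple Y X (sform Y) n U fs) (cor_n_of_tuple Y X zero_form m U gs)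
      (cor_n_of_tuple Y X (sform Y) (n + m) U (fs + gs))"
    unfolding is_concat_def using U fs gs r by blast
  then show ?thesis
    using cor_n_of_tuple_in[OF U] fs gs fg unfolding add_isotropic_def SCor_n_def SCor0_n_def by blast
qed

text \<open>If \<open>as\<close> is a tuple with total pullback \<open>-\<omega>\<close>, then \<open>gs + as\<close> and \<open>fs + as\<close> are both isotropic, so
  \<open>fs \<sim> fs + (gs + as) = gs + (fs + as) \<sim> gs\<close>.\<close>

lemma tuple_class_eq:
  assumes U: "openin (mtop Y) U" and fs: "fs \<in> tuples Y X (sform Y) n U" and gs: "gs \<in> tuples Y X (sform Y) m U"
    and as: "as \<in> tuples Y X (\<lambda>i p v w. - sform Y i p v w) k U"
  shows "tuple_class Y X U fs = tuple_class Y X U gs"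
proof -
  have ga: "gs + as \<in> tuples Y X zero_form (m + k) U" and fa: "fs + as \<in> tuples Y X zero_form (n + k) U"
    by (rule tuples_add[OF gs as] tuples_add[OF fs as]; simp add: zero_form_def)+
  have e1: "equivclp (add_isotropic Y X U) (n, cor_n_of_tuple Y X (sform Y) n U fs)
      (n + (m + k), cor_n_of_tuple Y X (sform Y) (n + (m + k)) U (fs + (gs + as)))"
    by (intro r_into_equivclp add_isotropic_tuple U fs ga)
  have e2: "equivclp (add_isotropic Y X U) (m, cor_n_of_tuple Y X (sform Y) m U gs)
      (m + (n + k), cor_n_of_tuple Y X (sform Y) (m + (n + k)) U (gs + (fs + as)))"
    by (intro r_into_equivclp add_isotropic_tuple U gs fa)
  have c: "gs + (fs + as) = fs + (gs + as)" "m + (n + k) = n + (m + k)" by (simp_all add: ac_simps)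
  have "equivclp (add_isotropic Y X U) (n, cor_n_of_tuple Y X (sform Y) n U fs)
      (m, cor_n_of_tuple Y X (sform Y) m U gs)"
    using e1 equivclp_sym[OF e2] unfolding c by (rule equivclp_trans)
  then have "((n, cor_n_of_tuple Y X (sform Y) n U fs), (m, cor_n_of_tuple Y X (sform Y) m U gs)) \<in> stable_equiv Y X U"
    using coprod_section[OF U fs] coprod_section[OF U gs] by (simp add: stable_equiv_def)
  moreover have "equiv (sections (coprod_presheaf Y X) U) (stable_equiv Y X U)"
    using compatible_stable_equiv U unfolding compatible_def by blast
  ultimately show ?thesis
    unfolding tuple_class_def tuplesD(1)[OF fs] tuplesD(1)[OF gs] by (metis equiv_class_eq)
qed

section \<open>Global correspondences when -\<omega> is locally a total pullback\<close>

context
  assumes anti: "locally_represented Y X (\<lambda>i p v w. - sform Y i p v w)"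
begin

text \<open>\<open>tuple_class_eq\<close> wants both tuples and one for -\<omega> on the same
  domain, so all three are restricted to a common neighbourhood of z. The germ thus depends neither
  on the tuple nor on its length.\<close>

lemma germ_tuple_class_eq:
  assumes U: "openin (mtop Y) U" and V: "openin (mtop Y) V"
    and fs: "fs \<in> tuples Y X (sform Y) n U" and gs: "gs \<in> tuples Y X (sform Y) m V"
    and z: "z \<in> U" "z \<in> V"
  shows "germ (mtop Y) (cor_presheaf Y X) U (tuple_class Y X U fs) z
       = germ (mtop Y) (cor_presheaf Y X) V (tuple_class Y X V gs) z"
proof -
  have "z \<in> points Y" using U z(1) openin_subset by blast
  then obtain W as where W: "openin (mtop Y) W" "z \<in> W"
    and as: "as \<in> tuples Y X (\<lambda>i p v w. - sform Y i p v w) (size as) W"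
    using anti unfolding locally_represented_def by blast
  define N where "N = U \<inter> V \<inter> W"
  have N: "openin (mtop Y) N" "z \<in> N" "N \<subseteq> U" "N \<subseteq> V" "N \<subseteq> W" using U V W z by (auto simp: N_def)
  have eq: "tuple_class Y X N (image_mset (\<lambda>f. restrict f N) fs) = tuple_class Y X N (image_mset (\<lambda>f. restrict f N) gs)"
    by (rule tuple_class_eq[OF N(1) tuples_restrict[OF Y X N(1,3) fs] tuples_restrict[OF Y X N(1,4) gs]
          tuples_restrict[OF Y X N(1,5) as]])
  show ?thesis
    by (rule germ_eqI[OF presheaf_on_cor U V N(1,2) _ tuple_class_section[OF U fs] tuple_class_section[OF V gs]])
      (use N eq res_tuple_class[OF U N(1,3) fs] res_tuple_class[OF V N(1,4) gs] in auto)
qed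

text \<open>Near each point H has the germ of some tuple, hence of every tuple. Local tuples can
  therefore be prescribed when H is composed with a slice.\<close>

lemma SCor_given_by:
  assumes H: "H \<in> SCor Y X" and V: "openin (mtop Y) V" and fs: "fs \<in> tuples Y X (sform Y) n V"
  shows "given_by Y X V fs H"
proof -
  have "H z = germ (mtop Y) (cor_presheaf Y X) V (tuple_class Y X V fs) z" if z: "z \<in> V" for z
  proof -
    have "z \<in> points Y" using V z openin_subset by blast
    from SCor_local[OF H this] obtain W gs where W: "openin (mtop Y) W" "z \<in> W"
      and gs: "gs \<in> tuples Y X (sform Y) (size gs) W"
      and "\<And>z. z \<in> W \<Longrightarrow> H z = germ (mtop Y) (cor_presheaf Y X) W (tuple_class Y X W gs) z" by blast
    then show ?thesis using germ_tuple_class_eq[OF W(1) V gs fs W(2) z] by simp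
  qed
  then have "restrict H V = cor_of_tuple Y X V fs"
    unfolding cor_of_tuple_def to_sheaf_def tuple_class_def by (intro restrict_ext) simp
  then show ?thesis using V fs tuplesD(1)[OF fs] by (simp add: given_by_def)
qed

lemma SCor_unique:
  assumes "H \<in> SCor Y X" "K \<in> SCor Y X" shows "H = K"
proof (rule extensionalityI)
  show "H \<in> extensional (points Y)" "K \<in> extensional (points Y)"
    using assms by (auto simp: SCor_def sheafify_def)
  fix z assume "z \<in> points Y"
  from SCor_local[OF assms(1) this] obtain V fs where V: "openin (mtop Y) V" "z \<in> V"
    and fs: "fs \<in> tuples Y X (sform Y) (size fs) V" by blast
  have "restrict H V = restrict K V"
    using SCor_given_by[OF assms(1) V(1) fs] SCor_given_by[OF assms(2) V(1) fs] by (simp add: given_by_def)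
  then show "H z = K z" using V(2) by (metis restrict_apply')
qed

text \<open>One tuple is chosen per point and its germ taken there. These germs form a section
  because on overlaps they coincide by \<open>germ_tuple_class_eq\<close>.\<close>

lemma SCor_nonempty:
  assumes "locally_represented Y X (sform Y)" shows "\<exists>H. H \<in> SCor Y X"
proof -
  obtain V fs where V: "\<And>y. y \<in> points Y \<Longrightarrow> openin (mtop Y) (V y) \<and> y \<in> V y \<and> fs y \<in> tuples Y X (sform Y) (size (fs y)) (V y)"
    using assms unfolding locally_represented_def by metis
  define H where "H = (\<lambda>y\<in>points Y. germ (mtop Y) (cor_presheaf Y X) (V y) (tuple_class Y X (V y) (fs y)) y)"
  have "H z = germ (mtop Y) (cor_presheaf Y X) (V y) (tuple_class Y X (V y) (fs y)) z"
    if y: "y \<in> points Y" and z: "z \<in> V y" for y z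
  proof -
    have "z \<in> points Y" using V[OF y] z openin_subset by blast
    then show ?thesis
      unfolding H_def restrict_apply'[OF \<open>z \<in> points Y\<close>]
      using V[of z] V[OF y] z by (intro germ_tuple_class_eq) blast+
  qed
  moreover have "V y \<subseteq> points Y" if "y \<in> points Y" for y using V[OF that] openin_subset by blast
  ultimately have "\<exists>W s. openin (mtop Y) W \<and> y \<in> W \<and> W \<subseteq> points Y \<and> s \<in> sections (cor_presheaf Y X) W \<and>
      (\<forall>z\<in>W. H z = germ (mtop Y) (cor_presheaf Y X) W s z)" if "y \<in> points Y" for y
    using V[OF that] tuple_class_section that
    by (intro exI[of _ "V y"] exI[of _ "tuple_class Y X (V y) (fs y)"] conjI) auto
  moreover have "H \<in> extensional (points Y)" by (simp add: H_def)
  ultimately have "H \<in> SCor Y X" by (simp add: SCor_def sheafify_def)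
  then show ?thesis by blast
qed

end

end

text \<open>The chain rule for pullbacks, summed over the tuple. One chart \<open>k\<close> at each
  point is enough in the hypothesis on \<theta>', since \<open>pullback_compose\<close> holds in
  every chart of Z.\<close>

lemma tuples_compose:
  fixes Z :: "('c, 'g::real_normed_vector, 'k) symplectic"
  assumes Y: "atlas Y" and Z: "atlas Z" and fin: "finite_dim TYPE('g)"
    and X: "smooth_manifold X" and \<omega>: "two_form X (sform X)"
    and U: "openin (mtop Y) U" and V: "openin (mtop Z) V"
    and h: "smooth_map Y U Z h" and im: "h ` U \<subseteq> V" and fs: "fs \<in> tuples Z X \<theta> n V"
    and \<theta>': "\<And>i y. i \<in> charts Y \<Longrightarrow> y \<in> U \<Longrightarrow> y \<in> cdom Y i \<Longrightarrow> \<exists>k\<in>charts Z. h y \<in> cdom Z k \<and>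
      (\<forall>v w. \<theta> k (h y) (differential Y i Z k h y v) (differential Y i Z k h y w) = \<theta>' i y v w)"
  shows "image_mset (\<lambda>f. restrict (f \<circ> h) U) fs \<in> tuples Y X \<theta>' n U"
proof -
  note X' = smooth_manifoldD(1)[OF X]
  have sm: "smooth_map Y U X (f \<circ> h)" if "f \<in># fs" for f
    by (rule smooth_map_compose[OF Y Z X' fin U V h tuplesD(3)[OF fs that] im])
  have "smooth_map Y U X (restrict (f \<circ> h) U)" if "f \<in># fs" for f
    by (rule smooth_map_cong[OF Y X' U _ sm[OF that]]) simp
  moreover have "(\<Sum>f\<in>#fs. pullback Y X (restrict (f \<circ> h) U) (sform X) i y v w) = \<theta>' i y v w"
    if i: "i \<in> charts Y" and y: "y \<in> U" "y \<in> cdom Y i" for i y v w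
  proof -
    obtain k where k: "k \<in> charts Z" "h y \<in> cdom Z k"
      and eq: "\<theta> k (h y) (differential Y i Z k h y v) (differential Y i Z k h y w) = \<theta>' i y v w"
      using \<theta>'[OF i y] by blast
    have hy: "h y \<in> V" using im y by auto
    have "pullback Y X (restrict (f \<circ> h) U) (sform X) i y v w =
        pullback Z X f (sform X) k (h y) (differential Y i Z k h y v) (differential Y i Z k h y w)" if f: "f \<in># fs" for f
    proof -
      have "pullback Y X (restrict (f \<circ> h) U) (sform X) i y v w = pullback Y X (f \<circ> h) (sform X) i y v w"
        by (rule pullback_cong[OF Y i U y]) simp
      then show ?thesis
        using pullback_compose[OF Y Z X \<omega> U V h tuplesD(3)[OF fs f] sm[OF f] i k(1) y hy k(2)] by simp
    qed
    then have "(\<Sum>f\<in>#fs. pullback Y X (restrict (f \<circ> h) U) (sform X) i y v w) =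
        (\<Sum>f\<in>#fs. pullback Z X f (sform X) k (h y) (differential Y i Z k h y v) (differential Y i Z k h y w))"
      by (intro arg_cong[where f = sum_mset] image_mset_cong)
    then show ?thesis using tuplesD(4)[OF fs k(1) hy k(2)] eq by simp
  qed
  ultimately show ?thesis
    using tuplesD(1)[OF fs] unfolding tuples_def by (auto simp: image_mset.compositionality comp_def)
qed

section \<open>Products of symplectic manifolds\<close>

lemma prod_symplectic_simps [simp]:
  "mtop (prod_symplectic Y M) = prod_topology (mtop Y) (mtop M)"
  "charts (prod_symplectic Y M) = charts Y \<times> charts M"
  "cdom (prod_symplectic Y M) (i, k) = cdom Y i \<times> cdom M k"
  "coord (prod_symplectic Y M) (i, k) = (\<lambda>(p, q). (coord Y i p, coord M k q))"
  "sform (prod_symplectic Y M) (i, k) (p, q) (v, v') (w, w') = sform Y i p v w + sform M k q v' w'"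
  by (simp_all add: prod_symplectic_def prod_manifold_def)

lemma image_coord_prod:
  "coord (prod_symplectic Y M) (i, k) ` (A \<times> C) = coord Y i ` A \<times> coord M k ` C"
  by auto

lemma atlas_prod:
  assumes Y: "atlas Y" and M: "atlas M" shows "atlas (prod_symplectic Y M)"
  unfolding atlas_def
proof (intro conjI ballI)
  have "(\<Union>i\<in>charts Y. cdom Y i) = points Y" "(\<Union>i\<in>charts M. cdom M i) = points M"
    using Y M by (auto simp: atlas_def)
  then show "(\<Union>i\<in>charts (prod_symplectic Y M). cdom (prod_symplectic Y M) i) = points (prod_symplectic Y M)"
    by fastforce
  fix ik assume "ik \<in> charts (prod_symplectic Y M)"
  then obtain i k where ik: "ik = (i, k)" "i \<in> charts Y" "k \<in> charts M" by auto
  show "openin (mtop (prod_symplectic Y M)) (cdom (prod_symplectic Y M) ik)"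
    using openin_cdom[OF Y ik(2)] openin_cdom[OF M ik(3)] by (simp add: ik(1) openin_prod_Times_iff)
  have im: "coord (prod_symplectic Y M) ik ` cdom (prod_symplectic Y M) ik = coord Y i ` cdom Y i \<times> coord M k ` cdom M k"
    unfolding ik(1) prod_symplectic_simps(3) by (rule image_coord_prod)
  show "open (coord (prod_symplectic Y M) ik ` cdom (prod_symplectic Y M) ik)"
    unfolding im by (intro open_Times open_coord_cdom Y M ik)
  obtain f' g' where "homeomorphic_maps (subtopology (mtop Y) (cdom Y i)) (top_of_set (coord Y i ` cdom Y i)) (coord Y i) f'"
    "homeomorphic_maps (subtopology (mtop M) (cdom M k)) (top_of_set (coord M k ` cdom M k)) (coord M k) g'"
    using coord_homeomorphic_map[OF Y ik(2)] coord_homeomorphic_map[OF M ik(3)] by (auto simp: homeomorphic_map_maps)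
  then have "homeomorphic_maps (prod_topology (subtopology (mtop Y) (cdom Y i)) (subtopology (mtop M) (cdom M k)))
      (prod_topology (top_of_set (coord Y i ` cdom Y i)) (top_of_set (coord M k ` cdom M k)))
      (\<lambda>(p, q). (coord Y i p, coord M k q)) (\<lambda>(x, y). (f' x, g' y))"
    unfolding homeomorphic_maps_prod by blast
  then show "homeomorphic_map (subtopology (mtop (prod_symplectic Y M)) (cdom (prod_symplectic Y M) ik))
      (top_of_set (coord (prod_symplectic Y M) ik ` cdom (prod_symplectic Y M) ik)) (coord (prod_symplectic Y M) ik)"
    unfolding im homeomorphic_map_maps by (auto simp: ik(1) subtopology_Times)
qed

lemma param_prod:
  assumes "atlas Y" "atlas M" "i \<in> charts Y" "k \<in> charts M" "p \<in> cdom Y i" "q \<in> cdom M k"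
  shows "param (prod_symplectic Y M) (i, k) (coord Y i p, coord M k q) = (p, q)"
  using param_coord[OF atlas_prod[OF assms(1,2)], of "(i, k)" "(p, q)"] assms(3-6) by simp

lemma frechet_derivative_bounded_linear: "bounded_linear L \<Longrightarrow> frechet_derivative L (at x) = L"
  using frechet_derivative_at[OF bounded_linear_imp_has_derivative] by metis

lemma smooth_on_bounded_linear: "bounded_linear L \<Longrightarrow> smooth_on S L"
  by (simp add: smooth_on_def C_k_on_bounded_linear)

lemma prod_chart_cases:
  assumes "ik \<in> charts (prod_symplectic Y M)"
  obtains i k where "ik = (i, k)" "i \<in> charts Y" "k \<in> charts M"
  using assms by auto

lemma smooth_map_fst:
  fixes Y :: "('a, 'e::real_normed_vector, 'i) symplectic" and M :: "('b, 'f::real_normed_vector, 'k) symplectic"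
  assumes Y: "smooth_manifold Y" and M: "atlas M" and U: "openin (mtop (prod_symplectic Y M)) U"
  shows "smooth_map (prod_symplectic Y M) U Y fst"
  unfolding smooth_map_def
proof (intro conjI ballI)
  note Y' = smooth_manifoldD(1)[OF Y]
  show cont: "continuous_map (subtopology (mtop (prod_symplectic Y M)) U) (mtop Y) fst"
    by (simp add: continuous_map_from_subtopology continuous_map_fst)
  fix ik i' assume ik': "ik \<in> charts (prod_symplectic Y M)" and i': "i' \<in> charts Y"
  from ik' obtain i k where ik: "ik = (i, k)" "i \<in> charts Y" "k \<in> charts M" by (rule prod_chart_cases)
  let ?S = "coord (prod_symplectic Y M) ik ` {p \<in> U \<inter> cdom (prod_symplectic Y M) ik. fst p \<in> cdom Y i'}"
  let ?T = "coord Y i ` (cdom Y i \<inter> cdom Y i')"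
  have S: "open ?S" by (rule open_rep[OF atlas_prod[OF Y' M] Y' cont U ik' i'])
  have T: "open ?T" using open_coord_image[OF Y' ik(2) openin_cdom[OF Y' i']] by (simp add: Int_commute)
  have "fst ` ?S \<subseteq> ?T" by (auto simp: ik(1))
  from smooth_on_compose[OF smooth_manifoldD(2)[OF Y] S T this smooth_manifoldD(3)[OF Y ik(2) i']
      smooth_on_bounded_linear[OF bounded_linear_fst]]
  have "smooth_on ?S (\<lambda>z. (coord Y i' \<circ> param Y i) (fst z))" .
  then show "smooth_on ?S (coord Y i' \<circ> fst \<circ> param (prod_symplectic Y M) ik)"
    by (rule smooth_on_cong[THEN iffD1, OF S, rotated])
      (auto simp: ik(1) param_prod[OF Y' M ik(2,3)] param_coord[OF Y' ik(2)])
qed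

lemma smooth_map_snd:
  fixes Y :: "('a, 'e::real_normed_vector, 'i) symplectic" and M :: "('b, 'f::real_normed_vector, 'k) symplectic"
  assumes Y: "atlas Y" and M: "smooth_manifold M" and U: "openin (mtop (prod_symplectic Y M)) U"
  shows "smooth_map (prod_symplectic Y M) U M snd"
  unfolding smooth_map_def
proof (intro conjI ballI)
  note M' = smooth_manifoldD(1)[OF M]
  show cont: "continuous_map (subtopology (mtop (prod_symplectic Y M)) U) (mtop M) snd"
    by (simp add: continuous_map_from_subtopology continuous_map_snd)
  fix ik k' assume ik': "ik \<in> charts (prod_symplectic Y M)" and k': "k' \<in> charts M"
  from ik' obtain i k where ik: "ik = (i, k)" "i \<in> charts Y" "k \<in> charts M" by (rule prod_chart_cases)
  let ?S = "coord (prod_symplectic Y M) ik ` {p \<in> U \<inter> cdom (prod_symplectic Y M) ik. snd p \<in> cdom M k'}"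
  let ?T = "coord M k ` (cdom M k \<inter> cdom M k')"
  have S: "open ?S" by (rule open_rep[OF atlas_prod[OF Y M'] M' cont U ik' k'])
  have T: "open ?T" using open_coord_image[OF M' ik(3) openin_cdom[OF M' k']] by (simp add: Int_commute)
  have "snd ` ?S \<subseteq> ?T" by (auto simp: ik(1))
  from smooth_on_compose[OF smooth_manifoldD(2)[OF M] S T this smooth_manifoldD(3)[OF M ik(3) k']
      smooth_on_bounded_linear[OF bounded_linear_snd]]
  have "smooth_on ?S (\<lambda>z. (coord M k' \<circ> param M k) (snd z))" .
  then show "smooth_on ?S (coord M k' \<circ> snd \<circ> param (prod_symplectic Y M) ik)"
    by (rule smooth_on_cong[THEN iffD1, OF S, rotated])
      (auto simp: ik(1) param_prod[OF Y M' ik(2,3)] param_coord[OF M' ik(3)])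
qed

text \<open>In product charts the projections are linear, hence equal to their
  differentials.\<close>

lemma differential_fst_snd:
  assumes Y: "atlas Y" and M: "atlas M" and i: "i \<in> charts Y" and k: "k \<in> charts M"
    and p: "p \<in> cdom Y i \<times> cdom M k"
  shows "differential (prod_symplectic Y M) (i, k) Y i fst p = fst"
    "differential (prod_symplectic Y M) (i, k) M k snd p = snd"
proof -
  let ?S = "coord Y i ` cdom Y i \<times> coord M k ` cdom M k"
  have S: "open ?S" by (intro open_Times open_coord_cdom Y M i k)
  have x: "coord (prod_symplectic Y M) (i, k) p \<in> ?S" using p by auto
  have "frechet_derivative (coord Y i \<circ> fst \<circ> param (prod_symplectic Y M) (i, k)) (at (coord (prod_symplectic Y M) (i, k) p))
      = frechet_derivative fst (at (coord (prod_symplectic Y M) (i, k) p))"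
    by (rule frechet_derivative_cong_open[OF S x]) (auto simp: param_prod[OF Y M i k])
  then show "differential (prod_symplectic Y M) (i, k) Y i fst p = fst"
    by (simp add: differential_def frechet_derivative_bounded_linear bounded_linear_fst)
  have "frechet_derivative (coord M k \<circ> snd \<circ> param (prod_symplectic Y M) (i, k)) (at (coord (prod_symplectic Y M) (i, k) p))
      = frechet_derivative snd (at (coord (prod_symplectic Y M) (i, k) p))"
    by (rule frechet_derivative_cong_open[OF S x]) (auto simp: param_prod[OF Y M i k])
  then show "differential (prod_symplectic Y M) (i, k) M k snd p = snd"
    by (simp add: differential_def frechet_derivative_bounded_linear bounded_linear_snd)
qed

lemma smooth_map_slice:
  fixes Y :: "('a, 'e::real_normed_vector, 'i) symplectic" and M :: "('b, 'f::real_normed_vector, 'k) symplectic"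
  assumes Y: "smooth_manifold Y" and M: "atlas M" and U: "openin (mtop Y) U" and m: "m \<in> points M"
  shows "smooth_map Y U (prod_symplectic Y M) (\<lambda>y. (y, m))"
  unfolding smooth_map_def
proof (intro conjI ballI)
  note Y' = smooth_manifoldD(1)[OF Y]
  show cont: "continuous_map (subtopology (mtop Y) U) (mtop (prod_symplectic Y M)) (\<lambda>y. (y, m))"
    using m by (simp add: continuous_map_paired continuous_map_from_subtopology)
  fix i ik assume i: "i \<in> charts Y" and ik': "ik \<in> charts (prod_symplectic Y M)"
  from ik' obtain i' k where ik: "ik = (i', k)" "i' \<in> charts Y" "k \<in> charts M" by (rule prod_chart_cases)
  let ?S = "coord Y i ` {p \<in> U \<inter> cdom Y i. (p, m) \<in> cdom (prod_symplectic Y M) ik}"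
  have S: "open ?S" by (rule open_rep[OF Y' atlas_prod[OF Y' M] cont U i ik'])
  have "smooth_on ?S (coord Y i' \<circ> param Y i)"
    by (rule smooth_on_subset[OF smooth_manifoldD(3)[OF Y i ik(2)]]) (auto simp: ik(1))
  then have "smooth_on ?S (\<lambda>x. ((coord Y i' \<circ> param Y i) x, coord M k m))"
    unfolding smooth_on_def by (intro allI C_k_on_Pair[OF S _ C_k_on_const]) (rule spec)
  then show "smooth_on ?S (coord (prod_symplectic Y M) ik \<circ> (\<lambda>y. (y, m)) \<circ> param Y i)"
    by (rule smooth_on_cong[THEN iffD1, OF S, rotated]) (simp add: ik(1))
qed

lemma differential_slice:
  assumes Y: "atlas Y" and i: "i \<in> charts Y" and y: "y \<in> cdom Y i"
  shows "differential Y i (prod_symplectic Y M) (i, k) (\<lambda>y. (y, m)) y v = (v, 0)"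
proof -
  let ?x = "coord Y i y"
  have "frechet_derivative (coord (prod_symplectic Y M) (i, k) \<circ> (\<lambda>y. (y, m)) \<circ> param Y i) (at ?x)
      = frechet_derivative (\<lambda>x. (x, coord M k m)) (at ?x)"
    by (rule frechet_derivative_cong_open[OF open_coord_cdom[OF Y i]]) (use y in \<open>auto simp: param_coord[OF Y i]\<close>)
  moreover have "((\<lambda>x. (x, coord M k m)) has_derivative (\<lambda>v. (v, 0))) (at ?x)"
    by (intro has_derivative_Pair has_derivative_ident has_derivative_const)
  ultimately show ?thesis unfolding differential_def by (metis frechet_derivative_at)
qed

text \<open>Tuples on the factors are pulled back along the projections and concatenated, so their
  forms add. Leaving the forms general covers \<omega> and -\<omega> on the product.\<close>

lemma locally_represented_prod:
  fixes Y :: "('a, 'e::real_normed_vector, 'i) symplectic" and M :: "('b, 'f::real_normed_vector, 'k) symplectic"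
    and X :: "('c, 'g::real_normed_vector, 'j) symplectic"
  assumes Y: "smooth_manifold Y" and M: "smooth_manifold M" and X: "smooth_manifold X" and \<omega>: "two_form X (sform X)"
    and \<theta>: "locally_represented Y X \<theta>" and \<eta>: "locally_represented M X \<eta>"
    and \<zeta>: "\<And>i k p q v v' w w'. \<zeta> (i, k) (p, q) (v, v') (w, w') = \<theta> i p v w + \<eta> k q v' w'"
  shows "locally_represented (prod_symplectic Y M) X \<zeta>"
  unfolding locally_represented_def
proof
  note Y' = smooth_manifoldD(1)[OF Y] and M' = smooth_manifoldD(1)[OF M]
  note YM = atlas_prod[OF Y' M']
  fix z assume z: "z \<in> points (prod_symplectic Y M)"
  then obtain y m where ym: "z = (y, m)" "y \<in> points Y" "m \<in> points M" by auto
  obtain U fs where U: "openin (mtop Y) U" "y \<in> U" and fs: "fs \<in> tuples Y X \<theta> (size fs) U"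
    using \<theta> ym(2) unfolding locally_represented_def by blast
  obtain W gs where W: "openin (mtop M) W" "m \<in> W" and gs: "gs \<in> tuples M X \<eta> (size gs) W"
    using \<eta> ym(3) unfolding locally_represented_def by blast
  have UW: "openin (mtop (prod_symplectic Y M)) (U \<times> W)" using U W by (simp add: openin_prod_Times_iff)
  let ?fs = "image_mset (\<lambda>f. restrict (f \<circ> fst) (U \<times> W)) fs"
  let ?gs = "image_mset (\<lambda>f. restrict (f \<circ> snd) (U \<times> W)) gs"
  have 1: "?fs \<in> tuples (prod_symplectic Y M) X (\<lambda>(i, k) (p, q) (v, v') (w, w'). \<theta> i p v w) (size fs) (U \<times> W)"
    by (rule tuples_compose[OF YM Y' smooth_manifoldD(2)[OF Y] X \<omega> UW U(1) smooth_map_fst[OF Y M' UW] _ fs])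
      (auto simp: differential_fst_snd[OF Y' M'])
  have 2: "?gs \<in> tuples (prod_symplectic Y M) X (\<lambda>(i, k) (p, q) (v, v') (w, w'). \<eta> k q v' w') (size gs) (U \<times> W)"
    by (rule tuples_compose[OF YM M' smooth_manifoldD(2)[OF M] X \<omega> UW W(1) smooth_map_snd[OF Y' M UW] _ gs])
      (auto simp: differential_fst_snd[OF Y' M'])
  have "?fs + ?gs \<in> tuples (prod_symplectic Y M) X \<zeta> (size (?fs + ?gs)) (U \<times> W)"
    using tuples_add[OF 1 2, of \<zeta>] \<zeta> by (auto simp: split_beta)
  then show "\<exists>V fs. openin (mtop (prod_symplectic Y M)) V \<and> z \<in> V \<and> fs \<in> tuples (prod_symplectic Y M) X \<zeta> (size fs) V"
    using UW U(2) W(2) ym(1) by blast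
qed

text \<open>On a slice the component in M is constant, so the M-part of the product form is
  evaluated on zero vectors and drops out.\<close>

lemma slice_tuple:
  fixes Y :: "('a, 'e::real_normed_vector, 'i) symplectic" and M :: "('b, 'f::real_normed_vector, 'k) symplectic"
    and X :: "('c, 'g::real_normed_vector, 'j) symplectic"
  assumes Y: "smooth_manifold Y" and M: "smooth_manifold M" "two_form M (sform M)"
    and X: "smooth_manifold X" and \<omega>: "two_form X (sform X)"
    and U: "openin (mtop Y) U" and V: "openin (mtop (prod_symplectic Y M)) V" and im: "(\<lambda>y. (y, m)) ` U \<subseteq> V" and m: "m \<in> points M"
    and fs: "fs \<in> tuples (prod_symplectic Y M) X (sform (prod_symplectic Y M)) n V"
  shows "image_mset (\<lambda>f. restrict (f \<circ> (\<lambda>y. (y, m))) U) fs \<in> tuples Y X (sform Y) n U"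
proof -
  note Y' = smooth_manifoldD(1)[OF Y] and M' = smooth_manifoldD(1)[OF M(1)]
  \<comment> \<open>The product is the middle space of the chain rule here. Spanning sets of the
    factors are placed on the two axes.\<close>
  have "finite_dim TYPE('e \<times> 'f)"
  proof -
    obtain B :: "'e set" and C :: "'f set" where B: "finite B" "span B = UNIV" and C: "finite C" "span C = UNIV"
      using smooth_manifoldD(2)[OF Y] smooth_manifoldD(2)[OF M(1)] unfolding finite_dim_def by blast
    have "span (B \<times> {0} \<union> {0} \<times> C) = UNIV"
    proof -
      have "(x, 0) \<in> span (B \<times> {0} \<union> {0} \<times> C)" for x
      proof -
        have "(\<lambda>x. (x, 0::'f)) ` span B = span ((\<lambda>x. (x, 0)) ` B)"
          by (rule linear_span_image[symmetric]) (auto intro!: linearI)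
        then have "(x, 0::'f) \<in> span ((\<lambda>x. (x, 0)) ` B)" using B(2) by blast
        then show ?thesis by (rule subsetD[OF span_mono, rotated]) auto
      qed
      moreover have "(0, y) \<in> span (B \<times> {0} \<union> {0} \<times> C)" for y
      proof -
        have "(\<lambda>y. (0::'e, y)) ` span C = span ((\<lambda>y. (0, y)) ` C)"
          by (rule linear_span_image[symmetric]) (auto intro!: linearI)
        then have "(0::'e, y) \<in> span ((\<lambda>y. (0, y)) ` C)" using C(2) by blast
        then show ?thesis by (rule subsetD[OF span_mono, rotated]) auto
      qed
      ultimately have "(x, 0) + (0, y) \<in> span (B \<times> {0} \<union> {0} \<times> C)" for x y by (rule span_add)
      then show ?thesis by auto
    qed
    then show ?thesis unfolding finite_dim_def using B(1) C(1) by (intro exI[of _ "B \<times> {0} \<union> {0} \<times> C"]) auto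
  qed
  then show ?thesis
  proof (rule tuples_compose[OF Y' atlas_prod[OF Y' M'] _ X \<omega> U V smooth_map_slice[OF Y M' U m] im fs])
    fix i y assume i: "i \<in> charts Y" and y: "y \<in> U" "y \<in> cdom Y i"
    obtain k where k: "k \<in> charts M" "m \<in> cdom M k" using points_chart[OF M' m] by blast
    have "linear (\<lambda>v. sform M k m v 0)" using M(2) k unfolding two_form_def by blast
    then have "sform M k m 0 0 = 0" using linear_0 by blast
    then show "\<exists>k\<in>charts (prod_symplectic Y M). (y, m) \<in> cdom (prod_symplectic Y M) k \<and>
      (\<forall>v w. sform (prod_symplectic Y M) k (y, m) (differential Y i (prod_symplectic Y M) k (\<lambda>y. (y, m)) y v)
        (differential Y i (prod_symplectic Y M) k (\<lambda>y. (y, m)) y w) = sform Y i y v w)"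
      using i k y by (intro bexI[of _ "(i, k)"]) (simp_all add: differential_slice[OF Y' i y(2)])
  qed
qed

text \<open>A local tuple for \<omega> forces \<open>sform X\<close> to be nonzero at some
  \<open>f p\<close> as soon as there are nonzero tangent vectors. From such a point
  \<open>local_tuple\<close> realises every closed 2-form, in particular -\<omega>.\<close>

lemma locally_represented_uminus:
  fixes N :: "('a, 'e::real_normed_vector, 'i) symplectic" and X :: "('b, 'f::real_normed_vector, 'j) symplectic"
  assumes N: "symplectic_manifold N" and X: "symplectic_manifold X" and rep: "locally_represented N X (sform N)"
  shows "locally_represented N X (\<lambda>i p v w. - sform N i p v w)"
  unfolding locally_represented_def
proof
  have Nm: "smooth_manifold N" and N2: "two_form N (sform N)" and Ncl: "closed_form N (sform N)"
    and Nnd: "nondegenerate N (sform N)" using N by (auto simp: symplectic_manifold_def)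
  have Xm: "smooth_manifold X" and X2: "two_form X (sform X)" using X by (auto simp: symplectic_manifold_def)
  note N' = smooth_manifoldD(1)[OF Nm] and X' = smooth_manifoldD(1)[OF Xm]
  fix p assume p: "p \<in> points N"
  obtain i where i: "i \<in> charts N" "p \<in> cdom N i" using points_chart[OF N' p] by blast
  obtain V fs where V: "openin (mtop N) V" "p \<in> V" and fs: "fs \<in> tuples N X (sform N) (size fs) V"
    using rep p unfolding locally_represented_def by blast
  show "\<exists>V fs. openin (mtop N) V \<and> p \<in> V \<and> fs \<in> tuples N X (\<lambda>i p v w. - sform N i p v w) (size fs) V"
  proof (cases "\<exists>v::'e. v \<noteq> 0")
    case True
    then obtain v w where vw: "sform N i p v w \<noteq> 0" using Nnd i unfolding nondegenerate_def by blast
    have "\<exists>f\<in>#fs. pullback N X f (sform X) i p v w \<noteq> 0"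
    proof (rule ccontr)
      assume "\<not> ?thesis"
      then have "(\<Sum>f\<in>#fs. pullback N X f (sform X) i p v w) = 0" by (simp add: sum_mset.neutral)
      then show False using vw tuplesD(4)[OF fs i(1) V(2) i(2)] by simp
    qed
    then obtain f where f: "f \<in># fs" "pullback N X f (sform X) i p v w \<noteq> 0" by blast
    \<comment> \<open>The chart chosen inside \<open>pullback\<close>, repeated so that the nonzero
      pullback is literally a nonzero value of \<open>sform X\<close>.\<close>
    define j where "j = (SOME j. j \<in> charts X \<and> f p \<in> cdom X j)"
    have "f p \<in> points X" by (rule smooth_map_in_points[OF tuplesD(3)[OF fs f(1)] V])
    then have "\<exists>j. j \<in> charts X \<and> f p \<in> cdom X j" using points_chart[OF X'] by blast
    then have j: "j \<in> charts X \<and> f p \<in> cdom X j" unfolding j_def by (rule someI_ex)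
    have nz: "sform X j (f p) (differential N i X j f p v) (differential N i X j f p w) \<noteq> 0"
      using f(2) by (simp add: pullback_def Let_def j_def)
    have two: "two_form N (\<lambda>i p v w. - sform N i p v w)"
      unfolding two_form_def
    proof (intro conjI ballI allI)
      fix i p assume ip: "i \<in> charts N" "p \<in> cdom N i"
      show "linear (\<lambda>v. - sform N i p v w)" for w
        using N2 ip unfolding two_form_def by (intro linear_compose_neg) blast
      show "- sform N i p w v = - (- sform N i p v w)" for v w
        using N2 ip unfolding two_form_def by (metis minus_minus)
    next
      fix i j p v w assume "i \<in> charts N" "j \<in> charts N" "p \<in> cdom N i \<inter> cdom N j"
      then show "- sform N i p v w = - sform N j p (differential N i N j (\<lambda>x. x) p v) (differential N i N j (\<lambda>x. x) p w)"
        using N2 unfolding two_form_def by metis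
    next
      fix i v w assume i: "i \<in> charts N"
      have "smooth_on (coord N i ` cdom N i) (\<lambda>x. sform N i (param N i x) v w)"
        using N2 i unfolding two_form_def by blast
      then show "smooth_on (coord N i ` cdom N i) (\<lambda>x. - sform N i (param N i x) v w)"
        using C_k_on_bounded_linear_comp[OF bounded_linear_minus[OF bounded_linear_ident] open_coord_cdom[OF N' i]]
        unfolding smooth_on_def by blast
    qed
    have "closed_form N (\<lambda>i p v w. - sform N i p v w)"
      unfolding closed_form_def
    proof (intro ballI allI)
      fix i x u v w assume i: "i \<in> charts N" and x: "x \<in> coord N i ` cdom N i"
      have m: "frechet_derivative (\<lambda>x. - sform N i (param N i x) v w) (at x) = (\<lambda>u. - frechet_derivative (\<lambda>x. sform N i (param N i x) v w) (at x) u)" for v w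
      proof -
        have "smooth_on (coord N i ` cdom N i) (\<lambda>x. sform N i (param N i x) v w)"
          using N2 i unfolding two_form_def by blast
        from has_derivative_minus[OF smooth_on_has_derivative[OF this x]]
        show ?thesis by (rule frechet_derivative_at[symmetric])
      qed
      have "frechet_derivative (\<lambda>x. sform N i (param N i x) v w) (at x) u
          - frechet_derivative (\<lambda>x. sform N i (param N i x) u w) (at x) v
          + frechet_derivative (\<lambda>x. sform N i (param N i x) u v) (at x) w = 0"
        using Ncl i x unfolding closed_form_def by blast
      then show "frechet_derivative (\<lambda>x. - sform N i (param N i x) v w) (at x) u
          - frechet_derivative (\<lambda>x. - sform N i (param N i x) u w) (at x) v
          + frechet_derivative (\<lambda>x. - sform N i (param N i x) u v) (at x) w = 0"
        unfolding m by linarith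
    qed
    from local_tuple[OF Nm two this Xm X2 _ _ nz p] j show ?thesis by blast
  next
    case False
    have "sform N i p v w = 0" if "i \<in> charts N" "p \<in> cdom N i" for i p v w
    proof -
      have "linear (\<lambda>v. sform N i p v w)" using N2 that unfolding two_form_def by blast
      then show ?thesis using linear_0[of "\<lambda>v. sform N i p v w"] False by metis
    qed
    \<comment> \<open>In dimension 0 the form vanishes, and so does the empty sum of
      pullbacks.\<close>
    then have "{#} \<in> tuples N X (\<lambda>i p v w. - sform N i p v w) (size {#}) V" by (auto simp: tuples_def)
    then show ?thesis using V by blast
  qed
qed

theorem theorem9p4:
  fixes X :: "('x, 'ex::real_normed_vector, 'ix) symplectic"
    and Y :: "('y, 'ey::real_normed_vector, 'iy) symplectic"
    and M :: "('m, 'em::real_normed_vector, 'im) symplectic"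
    and p\<^sub>0 p\<^sub>1 :: 'm
    and \<phi> :: "real \<Rightarrow> 'y \<Rightarrow> 'x"
  assumes "symplectic_manifold X" and "symplectic_manifold Y"
    and "symplectic_manifold M" and "connected_space (mtop M)"
    and "p\<^sub>0 \<in> points M" and "p\<^sub>1 \<in> points M"
    and "symplectic_isotopy Y X \<phi>"
    and "\<exists>I. I \<in> SCor M X"
  shows "M_homotopic M p\<^sub>0 p\<^sub>1 Y X (embedding_cor Y X (\<phi> 0)) (embedding_cor Y X (\<phi> 1))"
proof -
  let ?YM = "prod_symplectic Y M"
  have Xm: "smooth_manifold X" and X2: "two_form X (sform X)" and Ym: "smooth_manifold Y"
    and Mm: "smooth_manifold M" and M2: "two_form M (sform M)"
    using assms(1-3) by (auto simp: symplectic_manifold_def)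
  note X' = smooth_manifoldD(1)[OF Xm] and Y' = smooth_manifoldD(1)[OF Ym] and M' = smooth_manifoldD(1)[OF Mm]
  note YM' = atlas_prod[OF Y' M']
  have emb: "{#restrict f (points Y)#} \<in> tuples Y X (sform Y) 1 (points Y)" if f: "symplectic_embedding Y X f" for f
  proof -
    have sf: "smooth_map Y (points Y) X f" using f by (simp add: symplectic_embedding_def smooth_embedding_def)
    have "pullback Y X (restrict f (points Y)) (sform X) i p v w = sform Y i p v w"
      if i: "i \<in> charts Y" and p: "p \<in> points Y" "p \<in> cdom Y i" for i p v w
    proof -
      have "pullback Y X (restrict f (points Y)) (sform X) i p v w = pullback Y X f (sform X) i p v w"
        by (rule pullback_cong[OF Y' i openin_topspace p]) simp
      then show ?thesis using f i p(2) by (simp add: symplectic_embedding_def)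
    qed
    moreover have "smooth_map Y (points Y) X (restrict f (points Y))"
      by (rule smooth_map_cong[OF Y' X' openin_topspace _ sf]) simp
    ultimately show ?thesis by (simp add: tuples_def)
  qed
  have \<phi>: "symplectic_embedding Y X (\<phi> 0)" "symplectic_embedding Y X (\<phi> 1)"
    using assms(7) by (auto simp: symplectic_isotopy_def)
  have repY: "locally_represented Y X (sform Y)"
    unfolding locally_represented_def
  proof
    fix y assume "y \<in> points Y"
    then show "\<exists>V fs. openin (mtop Y) V \<and> y \<in> V \<and> fs \<in> tuples Y X (sform Y) (size fs) V"
      using emb[OF \<phi>(1)] openin_topspace
      by (intro exI[of _ "points Y"] exI[of _ "{#restrict (\<phi> 0) (points Y)#}"]) simp
  qed
  have repM: "locally_represented M X (sform M)"
    unfolding locally_represented_def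
  proof
    fix y assume "y \<in> points M"
    then obtain V fs where "openin (mtop M) V" "y \<in> V" "fs \<in> tuples M X (sform M) (size fs) V"
      using SCor_local[OF M' X'] assms(8) by metis
    then show "\<exists>V fs. openin (mtop M) V \<and> y \<in> V \<and> fs \<in> tuples M X (sform M) (size fs) V" by blast
  qed
  have repYM: "locally_represented ?YM X (sform ?YM)"
    by (rule locally_represented_prod[OF Ym Mm Xm X2 repY repM]) simp
  have antiY: "locally_represented Y X (\<lambda>i p v w. - sform Y i p v w)"
    by (rule locally_represented_uminus[OF assms(2,1) repY])
  have antiM: "locally_represented M X (\<lambda>i p v w. - sform M i p v w)"
    by (rule locally_represented_uminus[OF assms(3,1) repM])
  \<comment> \<open>Deduced from the factors; \<open>locally_represented_uminus\<close> would
    require the product to be a \<open>symplectic_manifold\<close>.\<close>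
  have antiYM: "locally_represented ?YM X (\<lambda>i p v w. - sform ?YM i p v w)"
    by (rule locally_represented_prod[OF Ym Mm Xm X2 antiY antiM]) simp
  obtain H where H: "H \<in> SCor ?YM X" using SCor_nonempty[OF YM' X' antiYM repYM] by blast
  \<comment> \<open>Here \<open>m\<close> and \<open>K\<close> are arbitrary: a tuple near a point
    of the slice restricts to a symplectic tuple on Y, and \<open>SCor_given_by\<close> says that
    this tuple gives \<open>K\<close>, whichever \<open>K\<close> was taken.\<close>
  have "is_cor_comp Y ?YM X H (\<lambda>y. (y, m)) K" if m: "m \<in> points M" and K: "K \<in> SCor Y X" for m K
    unfolding is_cor_comp_def
  proof (intro conjI K ballI)
    fix y assume y: "y \<in> points Y"
    then have "(y, m) \<in> points ?YM" using m by simp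
    then obtain V fs where V: "openin (mtop ?YM) V" "(y, m) \<in> V" and fs: "fs \<in> tuples ?YM X (sform ?YM) (size fs) V"
      using repYM unfolding locally_represented_def by blast
    define U where "U = {y \<in> points Y. (y, m) \<in> V}"
    have "continuous_map (subtopology (mtop Y) (points Y)) (mtop ?YM) (\<lambda>y. (y, m))"
      using m by (simp add: continuous_map_paired)
    then have U: "openin (mtop Y) U" unfolding U_def by (rule openin_preimage[OF _ openin_topspace V(1)])
    have im: "(\<lambda>y. (y, m)) ` U \<subseteq> V" by (auto simp: U_def)
    have "given_by ?YM X V fs H" by (rule SCor_given_by[OF YM' X' antiYM H V(1) fs])
    moreover have "given_by Y X U (image_mset (\<lambda>f. restrict (f \<circ> (\<lambda>y. (y, m))) U) fs) K"
      by (rule SCor_given_by[OF Y' X' antiY K U slice_tuple[OF Ym Mm M2 Xm X2 U V(1) im m fs]])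
    moreover have "y \<in> U" using y V(2) by (simp add: U_def)
    ultimately show "\<exists>U V fs. y \<in> U \<and> (\<lambda>y. (y, m)) ` U \<subseteq> V \<and> given_by ?YM X V fs H \<and>
        given_by Y X U (image_mset (\<lambda>f. restrict (f \<circ> (\<lambda>y. (y, m))) U) fs) K"
      using im by blast
  qed
  \<comment> \<open>\<open>cor_comp\<close> is a definite description, and
    \<open>SCor_unique\<close> supplies its uniqueness; every slice of \<open>H\<close> is thus the
    prescribed \<open>K\<close>.\<close>
  then have comp: "cor_comp Y ?YM X H (\<lambda>y. (y, m)) = K" if "m \<in> points M" "K \<in> SCor Y X" for m K
    unfolding cor_comp_def using that SCor_unique[OF Y' X' antiY]
    by (intro the_equality) (auto simp: is_cor_comp_def)
  have K: "cor_of_tuple Y X (points Y) {#restrict (\<phi> 0) (points Y)#} \<in> SCor Y X"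
    "cor_of_tuple Y X (points Y) {#restrict (\<phi> 1) (points Y)#} \<in> SCor Y X"
    by (rule cor_of_tuple_in_SCor[OF Y' X' emb[OF \<phi>(1)]], rule cor_of_tuple_in_SCor[OF Y' X' emb[OF \<phi>(2)]])
  show ?thesis
    unfolding M_homotopic_def
  \<comment> \<open>A single generator is enough as witness, because composition with a slice sends
    generators to generators.\<close>
  proof (intro conjI bexI[of _ "frag_of H"])
    show "embedding_cor Y X (\<phi> 0) \<in> SC Y X" "embedding_cor Y X (\<phi> 1) \<in> SC Y X" "frag_of H \<in> SC ?YM X"
      using K H by (simp_all add: SC_def embedding_cor_def)
    show "SC_comp Y ?YM X (frag_of H) (\<lambda>y. (y, p\<^sub>0)) = embedding_cor Y X (\<phi> 0)"
      "SC_comp Y ?YM X (frag_of H) (\<lambda>y. (y, p\<^sub>1)) = embedding_cor Y X (\<phi> 1)"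
      using comp[OF assms(5) K(1)] comp[OF assms(6) K(2)] by (simp_all add: SC_comp_def embedding_cor_def)
  qed
qed

end
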